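(* Let $K$ be an infinite field and $\lambda=(\lambda_1\ge\cdots\ge\lambda_n)$ a partition with positive parts. Then the reduction number of the Ferrers ideal $I_\lambda$ is $$r(I_\lambda)=\min\{n-1,\ \lambda_i+i-3\ :\ 2\le i\le n\},$$ and this also equals $r_{J_\lambda}(I_\lambda)$, where $J_\lambda$ is the minimal reduction generated by the diagonals $\sum_{i\ge1,\,k+i\le\lambda_i}x_iy_{k+i}$ ($k=0,\dots,\lambda_1-1$) and $\sum_{i\ge1,\,k+i\le n,\,i\le\lambda_{k+i}}x_{k+i}y_i$ ($k=1,\dots,n-1$).
   Context: The Ferrers ideal is $I_\lambda=(x_iy_j:1\le i\le n,\ 1\le j\le\lambda_i)\subset K[x_1,\dots,x_n,y_1,\dots,y_{\lambda_1}]$. An ideal $J\subset I$ is a reduction of $I$ if $I^{r+1}=JI^r$ for some $r\ge0$; the least such $r$ is $r_J(I)$. A reduction is minimal if no strictly smaller ideal is a reduction of $I$. The reduction number is $r(I)=\min\{r_J(I): J\text{ a minimal reduction of }I\}$. *)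

theory Defs
  imports Main "HOL-Library.Poly_Mapping"
begin

datatype var = X nat | Y nat

type_synonym 'k mpoly = "(var \<Rightarrow>\<^sub>0 nat) \<Rightarrow>\<^sub>0 'k"

definition poly_ring :: "var set \<Rightarrow> ('k::comm_ring_1) mpoly set" where
  "poly_ring V = {p :: 'k mpoly. \<forall>m :: var \<Rightarrow>\<^sub>0 nat. m \<in> Poly_Mapping.keys p \<longrightarrow> Poly_Mapping.keys m \<subseteq> V}"

definition ideal_in :: "'a::comm_ring_1 set \<Rightarrow> 'a set \<Rightarrow> bool" where
  "ideal_in R J \<longleftrightarrow> J \<subseteq> R \<and> 0 \<in> J \<and> (\<forall>a\<in>J. \<forall>b\<in>J. a + b \<in> J)
      \<and> (\<forall>r\<in>R. \<forall>a\<in>J. r * a \<in> J)"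

definition gen_ideal :: "'a::comm_ring_1 set \<Rightarrow> 'a set \<Rightarrow> 'a set" where
  "gen_ideal R S = \<Inter>{J. ideal_in R J \<and> S \<subseteq> J}"

definition ideal_prod :: "'a::comm_ring_1 set \<Rightarrow> 'a set \<Rightarrow> 'a set \<Rightarrow> 'a set" where
  "ideal_prod R I J = gen_ideal R {a * b | a b. a \<in> I \<and> b \<in> J}"

fun ideal_pow :: "'a::comm_ring_1 set \<Rightarrow> 'a set \<Rightarrow> nat \<Rightarrow> 'a set" where
  "ideal_pow R I 0 = R"
| "ideal_pow R I (Suc k) = ideal_prod R (ideal_pow R I k) I"

definition is_reduction :: "'a::comm_ring_1 set \<Rightarrow> 'a set \<Rightarrow> 'a set \<Rightarrow> bool" where
  "is_reduction R J I \<longleftrightarrow> ideal_in R J \<and> J \<subseteq> I \<and>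
     (\<exists>r. ideal_pow R I (Suc r) = ideal_prod R J (ideal_pow R I r))"

definition red_num_wrt :: "'a::comm_ring_1 set \<Rightarrow> 'a set \<Rightarrow> 'a set \<Rightarrow> nat" where
  "red_num_wrt R J I = (LEAST r. ideal_pow R I (Suc r) = ideal_prod R J (ideal_pow R I r))"

definition minimal_reduction :: "'a::comm_ring_1 set \<Rightarrow> 'a set \<Rightarrow> 'a set \<Rightarrow> bool" where
  "minimal_reduction R J I \<longleftrightarrow> is_reduction R J I \<and>
     (\<forall>J'. is_reduction R J' I \<and> J' \<subseteq> J \<longrightarrow> J' = J)"

definition reduction_number :: "'a::comm_ring_1 set \<Rightarrow> 'a set \<Rightarrow> nat" where
  "reduction_number R I = (LEAST n. \<exists>J. minimal_reduction R J I \<and> red_num_wrt R J I = n)"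

text \<open>Ferrers ideal data; lam i = \<lambda>_i for 1 \<le> i \<le> n (1-based).\<close>
definition xy :: "nat \<Rightarrow> nat \<Rightarrow> ('k::comm_ring_1) mpoly" where
  "xy i j = Poly_Mapping.single (Poly_Mapping.single (X i) 1 + Poly_Mapping.single (Y j) 1) 1"

definition ferrers_vars :: "nat \<Rightarrow> (nat \<Rightarrow> nat) \<Rightarrow> var set" where
  "ferrers_vars n lam = {X i | i. 1 \<le> i \<and> i \<le> n} \<union> {Y j | j. 1 \<le> j \<and> j \<le> lam 1}"

definition ferrers_ring :: "nat \<Rightarrow> (nat \<Rightarrow> nat) \<Rightarrow> ('k::comm_ring_1) mpoly set" where
  "ferrers_ring n lam = poly_ring (ferrers_vars n lam)"

definition ferrers_ideal :: "nat \<Rightarrow> (nat \<Rightarrow> nat) \<Rightarrow> ('k::comm_ring_1) mpoly set" where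
  "ferrers_ideal n lam = gen_ideal (ferrers_ring n lam)
      {xy i j | i j. 1 \<le> i \<and> i \<le> n \<and> 1 \<le> j \<and> j \<le> lam i}"

definition diag_upper :: "nat \<Rightarrow> (nat \<Rightarrow> nat) \<Rightarrow> nat \<Rightarrow> ('k::comm_ring_1) mpoly" where
  "diag_upper n lam k = (\<Sum>i \<in> {i. 1 \<le> i \<and> i \<le> n \<and> k + i \<le> lam i}. xy i (k + i))"

definition diag_lower :: "nat \<Rightarrow> (nat \<Rightarrow> nat) \<Rightarrow> nat \<Rightarrow> ('k::comm_ring_1) mpoly" where
  "diag_lower n lam k = (\<Sum>i \<in> {i. 1 \<le> i \<and> k + i \<le> n \<and> i \<le> lam (k + i)}. xy (k + i) i)"

definition diag_reduction :: "nat \<Rightarrow> (nat \<Rightarrow> nat) \<Rightarrow> ('k::comm_ring_1) mpoly set" where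
  "diag_reduction n lam = gen_ideal (ferrers_ring n lam)
      ({diag_upper n lam k | k. k < lam 1} \<union> {diag_lower n lam k | k. 1 \<le> k \<and> k \<le> n - 1})"

end

theory Submission
  imports Defs "HOL-Library.Multiset" "HOL-Computational_Algebra.Polynomial"
    "Jordan_Normal_Form.Determinant"
begin

text \<open>
  Only the lowest degree part of a reduction matters for the lower bound: \<open>J I^r = I^(r+1)\<close> forces
  \<open>V F_r = F_(r+1)\<close> in the fiber ring \<open>F = K[x_i y_j]\<close>, where \<open>V\<close> consists of the degree two parts of
  \<open>J\<close>. With respect to the convex weight \<open>(j - i)^2\<close> of a cell, \<open>F\<close> degenerates to the Stanley-Reisner
  ring of chains of cells, whose facets are lattice paths meeting each diagonal exactly once. So the
  diagonals are a linear system of parameters over which \<open>F\<close> is free, with basis the products of cells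
  at which a path turns from right to up; such cells form strict chains in the diagram without its
  first row and column, of length at most the stated minimum.

  A generic system of \<open>n + lam 1 - 1\<close> linear forms generates at least as much in each degree as the
  diagonals and as any given system of that size, and by freeness it cannot do strictly better than the
  diagonals. Hence a reduction with \<open>n + lam 1 - 1\<close> generators has at least that reduction number, and by
  Noether normalization a minimal reduction has no more degree two parts than that.

  The ring is not local, so the minimality of the ideal of the diagonals is checked at an arbitrary
  prime \<open>P\<close> containing \<open>I\<close>. There the ideal is generated by some variables and by the diagonals of a smaller
  Ferrers diagram; these are analytically independent, since their initial monomials for a suitable
  weight are.
\<close>

section \<open>Weight components and substitutions\<close>

text \<open>The swap relation x_a y_b x_a' y_b' = x_a y_b' x_a' y_b changes the weight by
  2(a'-a)(b'-b), while all cells of one diagonal have equal weight; this is why the degeneration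
  respects the diagonals. Freeness is not proved as such: straightening gives a spanning set of each
  degree indexed by corners and monomials in the parameters, an injection from the same indices into
  chains bounds the dimension from below, and only these two counts are compared. The bound is the
  largest size of a corner set: rows 2 to n give n - 1, and cutting at row i leaves at most i - 2
  corners above and \<open>lam i\<close> - 1 from there on. A minimal reduction need not be
  homogeneous, and some of its generators may vanish in degree two; hence its degree two parts are
  bounded, not its generators. For the minimality of the diagonals, saturation replaces localization
  and a determinant of linear forms replaces integral dependence, so that every computation stays in
  the polynomial ring.\<close>

type_synonym ('v, 'k) mvpoly = "('v \<Rightarrow>\<^sub>0 nat) \<Rightarrow>\<^sub>0 'k"

abbreviation "keys \<equiv> Poly_Mapping.keys"
abbreviation "lookup \<equiv> Poly_Mapping.lookup"
abbreviation "single \<equiv> Poly_Mapping.single"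

lemma poly_mapping_sum_single: "p = (\<Sum>m\<in>keys p. single m (lookup p m))"
  by (rule poly_mapping_eqI)
     (auto simp: lookup_sum lookup_single when_def in_keys_iff sum.delta)

definition wt :: "('v \<Rightarrow> nat) \<Rightarrow> ('v \<Rightarrow>\<^sub>0 nat) \<Rightarrow> nat" where
  "wt u m = (\<Sum>v\<in>keys m. u v * lookup m v)"

lemma wt_superset: "finite A \<Longrightarrow> keys m \<subseteq> A \<Longrightarrow> wt u m = (\<Sum>v\<in>A. u v * lookup m v)"
  unfolding wt_def by (rule sum.mono_neutral_left) (auto simp: in_keys_iff)

lemma wt_zero [simp]: "wt u 0 = 0"
  by (simp add: wt_def)

lemma wt_add [simp]: "wt u (m + m') = wt u m + wt u m'"
proof -
  let ?A = "keys m \<union> keys m'"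
  have "keys (m + m') \<subseteq> ?A" by (rule keys_add)
  then show ?thesis
    by (subst (1 2 3) wt_superset[of ?A]) (auto simp: lookup_add algebra_simps sum.distrib)
qed

lemma wt_single [simp]: "wt u (single v k) = u v * k"
  by (simp add: wt_def)

definition wcomp :: "('v \<Rightarrow> nat) \<Rightarrow> nat \<Rightarrow> ('v, 'k::zero) mvpoly \<Rightarrow> ('v, 'k) mvpoly" where
  "wcomp u d p = Poly_Mapping.mapp (\<lambda>m c. c when wt u m = d) p"

lemma lookup_wcomp: "lookup (wcomp u d p) m = (lookup p m when wt u m = d)"
  by (auto simp: wcomp_def lookup_mapp when_def in_keys_iff)

lemma keys_wcomp: "keys (wcomp u d p) = {m \<in> keys p. wt u m = d}"
  by (auto simp: in_keys_iff lookup_wcomp)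

lemma wcomp_add: "wcomp u d (p + q) = wcomp u d p + wcomp u d (q :: ('v, 'k::comm_monoid_add) mvpoly)"
  by (rule poly_mapping_eqI) (simp add: lookup_wcomp lookup_add when_def)

lemma wcomp_zero [simp]: "wcomp u d 0 = 0"
  by (rule poly_mapping_eqI) (simp add: lookup_wcomp)

lemma wcomp_uminus: "wcomp u d (- p) = - wcomp u d (p :: ('v, 'k::ab_group_add) mvpoly)"
  by (rule poly_mapping_eqI) (simp add: lookup_wcomp when_def)

lemma wcomp_sum: "wcomp u d (sum f A) = (\<Sum>a\<in>A. wcomp u d (f a :: ('v, 'k::comm_monoid_add) mvpoly))"
  by (induction A rule: infinite_finite_induct) (auto simp: wcomp_add)

lemma wcomp_single: "wcomp u d (single m c) = (if wt u m = d then single m c else 0)"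
  by (rule poly_mapping_eqI) (auto simp: lookup_wcomp lookup_single when_def)

lemma wcomp_id: "(\<And>m. m \<in> keys p \<Longrightarrow> wt u m = d) \<Longrightarrow> wcomp u d p = p"
  by (rule poly_mapping_eqI) (auto simp: lookup_wcomp when_def in_keys_iff)

text \<open>A lower bound on the order rather than the order itself: zero needs no special value,
  and \<open>wcomp u d p\<close> is then the initial form of \<open>p\<close> or zero.\<close>

definition ordge :: "('v \<Rightarrow> nat) \<Rightarrow> nat \<Rightarrow> ('v, 'k::zero) mvpoly \<Rightarrow> bool" where
  "ordge u d p \<longleftrightarrow> (\<forall>m\<in>keys p. d \<le> wt u m)"

lemma ordge_0 [simp]: "ordge u 0 p" and ordge_zero [simp]: "ordge u d 0"
  by (auto simp: ordge_def)

lemma ordge_add: "ordge u d p \<Longrightarrow> ordge u d q \<Longrightarrow> ordge u d (p + (q :: ('v, 'k::comm_monoid_add) mvpoly))"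
  using keys_add[of p q] by (auto simp: ordge_def)

lemma ordge_sum:
  fixes f :: "'a \<Rightarrow> ('v, 'k::comm_monoid_add) mvpoly"
  shows "(\<And>a. a \<in> A \<Longrightarrow> ordge u d (f a)) \<Longrightarrow> ordge u d (sum f A)"
  by (induction A rule: infinite_finite_induct) (auto intro: ordge_add)

lemma ordge_mult: "ordge u a p \<Longrightarrow> ordge u b q \<Longrightarrow> ordge u (a + b) (p * (q :: ('v, 'k::comm_ring_1) mvpoly))"
  using keys_mult[of p q] by (fastforce simp: ordge_def intro: add_mono)

lemma wcomp_eq_0: "ordge u (Suc d) p \<Longrightarrow> wcomp u d p = 0"
  by (rule poly_mapping_eqI) (force simp: lookup_wcomp when_def ordge_def in_keys_iff not_less_eq_eq)

lemma mult_sum_single: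
  fixes p q :: "('a::comm_monoid_add) \<Rightarrow>\<^sub>0 'k::comm_ring_1"
  shows "p * q = (\<Sum>m\<in>keys p. \<Sum>m'\<in>keys q. single (m + m') (lookup p m * lookup q m'))"
  by (subst poly_mapping_sum_single[of p], subst poly_mapping_sum_single[of q])
     (simp add: sum_product mult_single)

text \<open>Neither factor has terms below its bound, so two terms reach the total weight
  \<open>a + b\<close> only by attaining both bounds.\<close>

lemma wcomp_mult:
  fixes p q :: "('v, 'k::comm_ring_1) mvpoly"
  assumes "ordge u a p" "ordge u b q"
  shows "wcomp u (a + b) (p * q) = wcomp u a p * wcomp u b q"
proof -
  have p: "wcomp u a p = (\<Sum>m\<in>keys p. if wt u m = a then single m (lookup p m) else 0)"
    by (subst poly_mapping_sum_single[of p]) (simp add: wcomp_sum wcomp_single)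
  have q: "wcomp u b q = (\<Sum>m\<in>keys q. if wt u m = b then single m (lookup q m) else 0)"
    by (subst poly_mapping_sum_single[of q]) (simp add: wcomp_sum wcomp_single)
  have e: "wt u m + wt u m' = a + b \<longleftrightarrow> wt u m = a \<and> wt u m' = b" if "m \<in> keys p" "m' \<in> keys q" for m m'
  proof -
    have "a \<le> wt u m" "b \<le> wt u m'" using assms that by (auto simp: ordge_def)
    then show ?thesis by auto
  qed
  have "wcomp u (a + b) (p * q) = (\<Sum>m\<in>keys p. \<Sum>m'\<in>keys q. if wt u m = a \<and> wt u m' = b
      then single (m + m') (lookup p m * lookup q m') else 0)"
    unfolding mult_sum_single[of p q] wcomp_sum wcomp_single
    by (intro sum.cong refl) (use e in auto)
  also have "\<dots> = wcomp u a p * wcomp u b q"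
    unfolding p q sum_product by (intro sum.cong refl) (auto simp: mult_single)
  finally show ?thesis .
qed

section \<open>Substitution homomorphisms\<close>

definition monom_subst :: "('v \<Rightarrow> 'a::comm_monoid_mult) \<Rightarrow> ('v \<Rightarrow>\<^sub>0 nat) \<Rightarrow> 'a" where
  "monom_subst s m = (\<Prod>v\<in>keys m. s v ^ lookup m v)"

lemma monom_subst_superset:
  "finite A \<Longrightarrow> keys m \<subseteq> A \<Longrightarrow> monom_subst s m = (\<Prod>v\<in>A. s v ^ lookup m v)"
  unfolding monom_subst_def by (rule prod.mono_neutral_left) (auto simp: in_keys_iff)

lemma monom_subst_zero [simp]: "monom_subst s 0 = 1"
  by (simp add: monom_subst_def)

lemma monom_subst_single [simp]: "monom_subst s (single v k) = s v ^ k"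
  by (cases "k = 0") (simp_all add: monom_subst_def)

lemma monom_subst_add: "monom_subst s (m + m') = monom_subst s m * monom_subst s m'"
proof -
  let ?A = "keys m \<union> keys m'"
  have "keys (m + m') \<subseteq> ?A" by (rule keys_add)
  then show ?thesis
    by (subst (1 2 3) monom_subst_superset[of ?A]) (auto simp: lookup_add power_add prod.distrib)
qed

definition subst :: "('v \<Rightarrow> ('w, 'k::comm_ring_1) mvpoly) \<Rightarrow> ('v, 'k) mvpoly \<Rightarrow> ('w, 'k) mvpoly" where
  "subst s p = (\<Sum>m\<in>keys p. single 0 (lookup p m) * monom_subst s m)"

lemma subst_superset:
  "finite A \<Longrightarrow> keys p \<subseteq> A \<Longrightarrow> subst s p = (\<Sum>m\<in>A. single 0 (lookup p m) * monom_subst s m)"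
  unfolding subst_def by (rule sum.mono_neutral_left) (auto simp: in_keys_iff)

lemma subst_zero [simp]: "subst s 0 = 0"
  by (simp add: subst_def)

lemma subst_single: "subst s (single m c) = single 0 c * monom_subst s m"
  by (cases "c = 0") (simp_all add: subst_def)

lemma subst_const [simp]: "subst s (single 0 c) = single 0 c"
  by (simp add: subst_single)

lemma subst_one [simp]: "subst s 1 = 1"
  using subst_const[of s 1] by simp

lemma subst_add: "subst s (p + q) = subst s p + subst s q"
proof -
  let ?A = "keys p \<union> keys q"
  have "keys (p + q) \<subseteq> ?A" by (rule keys_add)
  then show ?thesis
    by (subst (1 2 3) subst_superset[of ?A])
       (auto simp: lookup_add single_add algebra_simps sum.distrib)
qed

lemma subst_sum: "subst s (sum f A) = (\<Sum>a\<in>A. subst s (f a))"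
  by (induction A rule: infinite_finite_induct) (auto simp: subst_add)

lemma subst_mult: "subst s (p * q) = subst s p * subst s q"
  unfolding mult_sum_single[of p q] subst_sum subst_single
  by (simp add: subst_def sum_product monom_subst_add mult_single[of 0 _ 0, simplified, symmetric] ac_simps)

lemma subst_uminus: "subst s (- p) = - subst s p"
  using subst_add[of s p "- p"] by (simp add: eq_neg_iff_add_eq_0 add.commute)

lemma subst_diff: "subst s (p - q) = subst s p - subst s q"
  using subst_add[of s p "- q"] by (simp add: subst_uminus)

lemma subst_power: "subst s (p ^ k) = subst s p ^ k"
  by (induction k) (simp_all add: subst_mult)

lemma ordge_prod:
  fixes f :: "'a \<Rightarrow> ('v, 'k::comm_ring_1) mvpoly"
  assumes "\<And>v. v \<in> A \<Longrightarrow> ordge u (d v) (f v)"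
  shows "ordge u (sum d A) (prod f A) \<and> wcomp u (sum d A) (prod f A) = (\<Prod>v\<in>A. wcomp u (d v) (f v))"
  using assms
proof (induction A rule: infinite_finite_induct)
  case (insert x F)
  then show ?case by (auto simp: ordge_mult wcomp_mult)
next
  case (infinite A)
  have "wcomp u 0 (1 :: ('v, 'k) mvpoly) = 1"
    by (rule wcomp_id) (simp add: in_keys_iff lookup_one when_def split: if_splits)
  with infinite show ?case by simp
next
  case empty
  have "wcomp u 0 (1 :: ('v, 'k) mvpoly) = 1"
    by (rule wcomp_id) (simp add: in_keys_iff lookup_one when_def split: if_splits)
  then show ?case by simp
qed

lemma ordge_power:
  fixes p :: "('v, 'k::comm_ring_1) mvpoly"
  assumes "ordge u d p"
  shows "ordge u (d * k) (p ^ k) \<and> wcomp u (d * k) (p ^ k) = wcomp u d p ^ k"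
  using ordge_prod[of "{..<k}" u "\<lambda>_. d" "\<lambda>_. p"] assms by (simp add: mult.commute)

lemma monom_subst_initial:
  fixes s :: "'v \<Rightarrow> ('w, 'k::comm_ring_1) mvpoly"
  assumes s: "\<And>v. v \<in> keys m \<Longrightarrow> ordge u (u' v) (s v)"
  shows "ordge u (wt u' m) (monom_subst s m)"
    and "wcomp u (wt u' m) (monom_subst s m) = monom_subst (\<lambda>v. wcomp u (u' v) (s v)) m"
proof -
  have "ordge u (u' v * lookup m v) (s v ^ lookup m v)
      \<and> wcomp u (u' v * lookup m v) (s v ^ lookup m v) = wcomp u (u' v) (s v) ^ lookup m v" if "v \<in> keys m" for v
    using ordge_power s that by blast
  then show "ordge u (wt u' m) (monom_subst s m)"
    and "wcomp u (wt u' m) (monom_subst s m) = monom_subst (\<lambda>v. wcomp u (u' v) (s v)) m"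
    using ordge_prod[of "keys m" u "\<lambda>v. u' v * lookup m v" "\<lambda>v. s v ^ lookup m v"]
    by (simp_all add: wt_def monom_subst_def cong: prod.cong)
qed

text \<open>A term of source weight \<open>e\<close> is sent to a polynomial of order at least
  \<open>e\<close>, since \<open>u'\<close> bounds the orders of the values of the variables. Hence
  the part of weight \<open>d\<close> of the result comes only from the terms of weight
  \<open>d\<close>.\<close>

lemma subst_initial:
  fixes s :: "'v \<Rightarrow> ('w, 'k::comm_ring_1) mvpoly"
  assumes s: "\<And>m v. m \<in> keys p \<Longrightarrow> v \<in> keys m \<Longrightarrow> ordge u (u' v) (s v)" and p: "ordge u' d p"
  shows "wcomp u d (subst s p) = subst (\<lambda>v. wcomp u (u' v) (s v)) (wcomp u' d p)"
proof -
  have const: "wcomp u 0 (single 0 c) = (single 0 c :: ('w, 'k) mvpoly)" for c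
    by (simp add: wcomp_single)
  have *: "wcomp u d (single 0 c * monom_subst s m)
      = (if wt u' m = d then single 0 c * monom_subst (\<lambda>v. wcomp u (u' v) (s v)) m else 0)"
    if m: "m \<in> keys p" for m c
  proof -
    have o: "ordge u (wt u' m) (monom_subst s m)" using monom_subst_initial(1)[of m u u' s] s[OF m] by blast
    have d: "d \<le> wt u' m" using p m by (auto simp: ordge_def)
    show ?thesis
    proof (cases "wt u' m = d")
      case True
      then show ?thesis
        using wcomp_mult[of u 0 "single 0 c" d "monom_subst s m"] o
          monom_subst_initial(2)[of m u u' s] s[OF m] const[of c] by auto
    next
      case False
      then have "ordge u (0 + Suc d) (single 0 c * monom_subst s m)"
        using o d by (intro ordge_mult) (auto simp: ordge_def intro: order_trans)
      then show ?thesis using False by (simp add: wcomp_eq_0)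
    qed
  qed
  have "wcomp u d (subst s p) = (\<Sum>m\<in>keys p. if wt u' m = d then
      single 0 (lookup p m) * monom_subst (\<lambda>v. wcomp u (u' v) (s v)) m else 0)"
    unfolding subst_def wcomp_sum by (intro sum.cong refl *)
  also have "\<dots> = subst (\<lambda>v. wcomp u (u' v) (s v)) (wcomp u' d p)"
    by (subst subst_superset[of "keys p"]) (auto simp: keys_wcomp lookup_wcomp when_def intro!: sum.cong)
  finally show ?thesis .
qed

section \<open>Powers of the Ferrers ideal and its fiber ring\<close>

interpretation mp: vector_space "\<lambda>c p. single 0 c * (p :: ('v, 'k::field) mvpoly)"
  by unfold_locales
     (simp_all add: distrib_left distrib_right single_add mult_single mult.assoc[symmetric])

text \<open>The Ferrers ring is a subset of the polynomials in all variables \<open>X i\<close> and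
  \<open>Y j\<close>, so closure under the operations has to be carried along as a
  predicate.\<close>

definition is_subring :: "'a::comm_ring_1 set \<Rightarrow> bool" where
  "is_subring R \<longleftrightarrow> 0 \<in> R \<and> 1 \<in> R \<and> (\<forall>a\<in>R. \<forall>b\<in>R. a + b \<in> R \<and> a * b \<in> R) \<and> (\<forall>a\<in>R. - a \<in> R)"

lemma is_subringD:
  assumes "is_subring R"
  shows "0 \<in> R" "1 \<in> R" "a \<in> R \<Longrightarrow> b \<in> R \<Longrightarrow> a + b \<in> R" "a \<in> R \<Longrightarrow> b \<in> R \<Longrightarrow> a * b \<in> R"
    "a \<in> R \<Longrightarrow> - a \<in> R" "a \<in> R \<Longrightarrow> b \<in> R \<Longrightarrow> a - b \<in> R"
  using assms unfolding is_subring_def diff_conv_add_uminus by blast+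

lemma is_subring_sum: "is_subring R \<Longrightarrow> (\<And>a. a \<in> A \<Longrightarrow> f a \<in> R) \<Longrightarrow> sum f A \<in> R"
  by (induction A rule: infinite_finite_induct) (auto simp: is_subringD)

lemma is_subring_prod: "is_subring R \<Longrightarrow> (\<And>a. a \<in> A \<Longrightarrow> f a \<in> R) \<Longrightarrow> prod f A \<in> R"
  by (induction A rule: infinite_finite_induct) (auto simp: is_subringD)

lemma is_subring_power: "is_subring R \<Longrightarrow> a \<in> R \<Longrightarrow> a ^ k \<in> R"
  by (induction k) (auto simp: is_subringD)

lemma is_subring_poly_ring: "is_subring (poly_ring V)"
  unfolding is_subring_def poly_ring_def
proof (safe, goal_cases)
  case (3 a b m x)
  then show ?case using keys_add[of a b] by blast
next
  case (4 a b m x)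
  then obtain m1 m2 where "m = m1 + m2" "m1 \<in> keys a" "m2 \<in> keys b"
    using keys_mult[of a b] by blast
  then show ?case using 4 keys_add[of m1 m2] by blast
qed auto

lemma ideal_inD:
  assumes "ideal_in R J"
  shows "J \<subseteq> R" "0 \<in> J" "a \<in> J \<Longrightarrow> b \<in> J \<Longrightarrow> a + b \<in> J" "r \<in> R \<Longrightarrow> a \<in> J \<Longrightarrow> r * a \<in> J"
    "r \<in> R \<Longrightarrow> a \<in> J \<Longrightarrow> a * r \<in> J"
  using assms unfolding ideal_in_def by (auto simp: mult.commute)

lemma ideal_in_uminus: "is_subring R \<Longrightarrow> ideal_in R J \<Longrightarrow> a \<in> J \<Longrightarrow> - a \<in> J"
  using ideal_inD(4)[of R J "- 1" a] is_subringD(2,5)[of R] by simp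

lemma ideal_in_diff: "is_subring R \<Longrightarrow> ideal_in R J \<Longrightarrow> a \<in> J \<Longrightarrow> b \<in> J \<Longrightarrow> a - b \<in> J"
  using ideal_in_uminus[of R J b] ideal_inD(3)[of R J a "- b"] by simp

lemma ideal_in_sum: "ideal_in R J \<Longrightarrow> (\<And>a. a \<in> A \<Longrightarrow> f a \<in> J) \<Longrightarrow> sum f A \<in> J"
  by (induction A rule: infinite_finite_induct) (auto simp: ideal_inD)

lemma ideal_in_self: "is_subring R \<Longrightarrow> ideal_in R R"
  by (simp add: ideal_in_def is_subringD)

lemma gen_ideal_superset: "S \<subseteq> gen_ideal R S"
  by (auto simp: gen_ideal_def)

lemma gen_ideal_least: "ideal_in R J \<Longrightarrow> S \<subseteq> J \<Longrightarrow> gen_ideal R S \<subseteq> J"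
  by (auto simp: gen_ideal_def)

lemma ideal_in_gen_ideal:
  assumes "is_subring R" "S \<subseteq> R"
  shows "ideal_in R (gen_ideal R S)"
proof -
  have "ideal_in R R" using assms(1) by (rule ideal_in_self)
  with assms(2) have "gen_ideal R S \<subseteq> R" by (intro gen_ideal_least)
  then show ?thesis unfolding ideal_in_def by (auto simp: gen_ideal_def ideal_in_def)
qed

text \<open>Coefficients are indexed by \<open>A\<close>, not by the set of generators, so that
  later each index can receive its own indeterminate even where \<open>f\<close> repeats a
  value.\<close>

lemma gen_ideal_sum_rep:
  assumes R: "is_subring R" and A: "finite A" and f: "f ` A \<subseteq> R" and x: "x \<in> gen_ideal R (f ` A)"
  obtains r where "\<And>a. a \<in> A \<Longrightarrow> r a \<in> R" "x = (\<Sum>a\<in>A. r a * f a)"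
proof -
  let ?J = "{\<Sum>a\<in>A. r a * f a | r. \<forall>a\<in>A. r a \<in> R}"
  have "ideal_in R ?J"
    unfolding ideal_in_def
  proof (intro conjI ballI)
    show "?J \<subseteq> R" using R f by (auto intro!: is_subring_sum is_subringD)
    show "0 \<in> ?J" using R by (intro CollectI exI[of _ "\<lambda>_. 0"]) (simp add: is_subringD)
  next
    fix a b assume "a \<in> ?J" "b \<in> ?J"
    then obtain r s where "a = (\<Sum>a\<in>A. r a * f a)" "b = (\<Sum>a\<in>A. s a * f a)"
      "\<forall>a\<in>A. r a \<in> R" "\<forall>a\<in>A. s a \<in> R" by blast
    then show "a + b \<in> ?J" using R
      by (intro CollectI exI[of _ "\<lambda>a. r a + s a"]) (auto simp: is_subringD distrib_right sum.distrib)
  next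
    fix t a assume "a \<in> ?J" and t: "t \<in> R"
    then obtain r where "a = (\<Sum>a\<in>A. r a * f a)" "\<forall>a\<in>A. r a \<in> R" by blast
    then show "t * a \<in> ?J" using R t
      by (intro CollectI exI[of _ "\<lambda>a. t * r a"]) (auto simp: is_subringD sum_distrib_left mult.assoc)
  qed
  moreover have "f ` A \<subseteq> ?J"
  proof safe
    fix b assume "b \<in> A"
    then show "\<exists>r. f b = (\<Sum>a\<in>A. r a * f a) \<and> (\<forall>a\<in>A. r a \<in> R)" using R A
      by (intro exI[of _ "\<lambda>a. if a = b then 1 else 0"])
         (auto simp: is_subringD if_distrib[of "\<lambda>x. x * _"] sum.delta cong: if_cong)
  qed
  ultimately have "gen_ideal R (f ` A) \<subseteq> ?J" by (rule gen_ideal_least)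
  with x that show ?thesis by blast
qed

lemma ideal_in_prod:
  assumes "is_subring R" "I \<subseteq> R" "J \<subseteq> R"
  shows "ideal_in R (ideal_prod R I J)"
  unfolding ideal_prod_def
  using assms by (intro ideal_in_gen_ideal) (auto intro: is_subringD)

lemma ideal_prodI: "a \<in> I \<Longrightarrow> b \<in> J \<Longrightarrow> a * b \<in> ideal_prod R I J"
  unfolding ideal_prod_def by (rule subsetD[OF gen_ideal_superset]) blast

lemma ideal_prod_least:
  "ideal_in R K \<Longrightarrow> (\<And>a b. a \<in> I \<Longrightarrow> b \<in> J \<Longrightarrow> a * b \<in> K) \<Longrightarrow> ideal_prod R I J \<subseteq> K"
  unfolding ideal_prod_def by (rule gen_ideal_least) auto

lemma ideal_prod_commute: "ideal_prod R I J = ideal_prod R J I"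
proof -
  have "{a * b | a b. a \<in> I \<and> b \<in> J} = {a * b | a b. a \<in> J \<and> b \<in> I}" by (metis mult.commute)
  then show ?thesis by (simp add: ideal_prod_def)
qed

lemma ideal_in_pow: "is_subring R \<Longrightarrow> I \<subseteq> R \<Longrightarrow> ideal_in R (ideal_pow R I k)"
proof (induction k)
  case (Suc k)
  then show ?case using ideal_in_prod[of R "ideal_pow R I k" I] ideal_inD(1)[of R "ideal_pow R I k"] by simp
qed (simp add: ideal_in_self)

text \<open>Different multisets of cells can share an exponent, for instance after two cells
  exchange their columns; these coincidences are the relations of the fiber ring.\<close>

definition expo :: "(nat \<times> nat) multiset \<Rightarrow> var \<Rightarrow>\<^sub>0 nat" where
  "expo M = (\<Sum>z\<in>#M. single (X (fst z)) 1 + single (Y (snd z)) 1)"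

definition cmon :: "(nat \<times> nat) multiset \<Rightarrow> ('k::comm_ring_1) mpoly" where
  "cmon M = single (expo M) 1"

lemma expo_empty [simp]: "expo {#} = 0"
  by (simp add: expo_def)

lemma expo_add_mset: "expo (add_mset z M) = single (X (fst z)) 1 + single (Y (snd z)) 1 + expo M"
  by (simp add: expo_def)

lemma expo_union: "expo (M + N) = expo M + expo N"
  by (simp add: expo_def)

lemma cmon_empty [simp]: "cmon {#} = 1"
  by (simp add: cmon_def)

lemma cmon_union: "cmon (M + N) = cmon M * cmon N"
  by (simp add: cmon_def expo_union mult_single)

lemma cmon_add_mset: "cmon (add_mset z M) = xy (fst z) (snd z) * cmon M"
  by (simp add: cmon_def expo_add_mset xy_def mult_single)

lemma cmon_single: "cmon {#z#} = xy (fst z) (snd z)"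
  by (simp add: cmon_add_mset)

lemma lookup_expo_X: "lookup (expo M) (X i) = size (filter_mset (\<lambda>z. fst z = i) M)"
  by (induction M) (auto simp: expo_add_mset lookup_add lookup_single when_def)

lemma lookup_expo_Y: "lookup (expo M) (Y j) = size (filter_mset (\<lambda>z. snd z = j) M)"
  by (induction M) (auto simp: expo_add_mset lookup_add lookup_single when_def)

definition one_wt :: "var \<Rightarrow> nat" where [simp]: "one_wt v = 1"

abbreviation tdeg :: "(var \<Rightarrow>\<^sub>0 nat) \<Rightarrow> nat" where "tdeg \<equiv> wt one_wt"

lemma wt_expo: "wt u (expo M) = (\<Sum>z\<in>#M. u (X (fst z)) + u (Y (snd z)))"
  by (induction M) (auto simp: expo_add_mset)

lemma tdeg_expo [simp]: "tdeg (expo M) = 2 * size M"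
  by (induction M) (auto simp: expo_add_mset)

lemma tdeg_eq_0: "tdeg m = 0 \<Longrightarrow> m = 0"
  by (rule poly_mapping_eqI) (auto simp: wt_def in_keys_iff)

locale ferrers =
  fixes n :: nat and lam :: "nat \<Rightarrow> nat"
  assumes n_pos: "1 \<le> n"
    and lam_pos: "\<And>i. 1 \<le> i \<Longrightarrow> i \<le> n \<Longrightarrow> 0 < lam i"
    and lam_noninc: "\<And>i j. 1 \<le> i \<Longrightarrow> i \<le> j \<Longrightarrow> j \<le> n \<Longrightarrow> lam j \<le> lam i"
begin

definition cells :: "(nat \<times> nat) set" where
  "cells = {(i, j). 1 \<le> i \<and> i \<le> n \<and> 1 \<le> j \<and> j \<le> lam i}"

lemma cellsI: "1 \<le> i \<Longrightarrow> i \<le> n \<Longrightarrow> 1 \<le> j \<Longrightarrow> j \<le> lam i \<Longrightarrow> (i, j) \<in> cells"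
  by (simp add: cells_def)

lemma cells_le:
  assumes "(i, j) \<in> cells"
  shows "1 \<le> i" "Suc 0 \<le> i" "i \<le> n" "1 \<le> j" "Suc 0 \<le> j" "j \<le> lam i" "j \<le> lam 1" "j \<le> lam (Suc 0)"
  using lam_noninc[of 1 i] assms by (auto simp: cells_def)

lemma cells_down: "(i, j) \<in> cells \<Longrightarrow> 1 \<le> i' \<Longrightarrow> i' \<le> i \<Longrightarrow> 1 \<le> j' \<Longrightarrow> j' \<le> j \<Longrightarrow> (i', j') \<in> cells"
  using lam_noninc[of i' i] by (auto simp: cells_def)

lemma finite_cells: "finite cells"
  by (rule finite_subset[of _ "{1..n} \<times> {1..lam 1}"]) (auto dest: cells_le)

definition cellmons :: "nat \<Rightarrow> (nat \<times> nat) multiset set" where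
  "cellmons k = {M. set_mset M \<subseteq> cells \<and> size M = k}"

lemma finite_cellmons: "finite (cellmons k)"
proof -
  have "cellmons k \<subseteq> mset ` {xs. set xs \<subseteq> cells \<and> length xs = k}"
  proof
    fix M assume M: "M \<in> cellmons k"
    obtain xs where "mset xs = M" using ex_mset by blast
    with M show "M \<in> mset ` {xs. set xs \<subseteq> cells \<and> length xs = k}"
      by (auto simp: cellmons_def)
  qed
  then show ?thesis by (rule finite_surj[OF finite_lists_length_eq[OF finite_cells]])
qed

lemma cellmons_0: "cellmons 0 = {{#}}"
  by (auto simp: cellmons_def)

lemma cellmons_Suc: "M \<in> cellmons (Suc k) \<longleftrightarrow> (\<exists>z N. M = add_mset z N \<and> z \<in> cells \<and> N \<in> cellmons k)"
proof
  assume M: "M \<in> cellmons (Suc k)"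
  then obtain z N where "M = add_mset z N" using size_eq_Suc_imp_eq_union[of M k] by (auto simp: cellmons_def)
  with M show "\<exists>z N. M = add_mset z N \<and> z \<in> cells \<and> N \<in> cellmons k"
    by (intro exI[of _ z] exI[of _ N]) (auto simp: cellmons_def)
qed (auto simp: cellmons_def)

abbreviation "RR \<equiv> ferrers_ring n lam"
abbreviation "II \<equiv> ferrers_ideal n lam"

lemma subring_RR: "is_subring RR"
  by (simp add: ferrers_ring_def is_subring_poly_ring)

lemma RR_iff: "p \<in> RR \<longleftrightarrow> (\<forall>m\<in>keys p. keys m \<subseteq> ferrers_vars n lam)"
  by (auto simp: ferrers_ring_def poly_ring_def)

lemma const_RR: "single 0 c \<in> RR"
  by (simp add: RR_iff)

lemma single_RR: "keys m \<subseteq> ferrers_vars n lam \<Longrightarrow> single m c \<in> RR"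
  by (auto simp: RR_iff)

lemma keys_expo: "set_mset M \<subseteq> cells \<Longrightarrow> keys (expo M) \<subseteq> ferrers_vars n lam"
proof (induction M)
  case (add z M)
  have "keys (expo (add_mset z M)) \<subseteq> {X (fst z), Y (snd z)} \<union> keys (expo M)"
    by (auto simp: in_keys_iff expo_add_mset lookup_add lookup_single when_def split: if_splits)
  moreover have "keys (expo M) \<subseteq> ferrers_vars n lam" "(fst z, snd z) \<in> cells"
    using add by auto
  then have "{X (fst z), Y (snd z)} \<union> keys (expo M) \<subseteq> ferrers_vars n lam"
    using cells_le[of "fst z" "snd z"] by (simp add: ferrers_vars_def)
  ultimately show ?case by blast
qed simp

lemma cmon_RR: "set_mset M \<subseteq> cells \<Longrightarrow> cmon M \<in> RR"
  by (simp add: cmon_def single_RR keys_expo)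

text \<open>The power \<open>I^k\<close> described term by term; \<open>ideal_pow_II\<close>
  identifies the two, after which membership is a question about exponents.\<close>

definition monom_ideal :: "nat \<Rightarrow> ('k::comm_ring_1) mpoly set" where
  "monom_ideal k = {p \<in> RR. \<forall>m\<in>keys p. \<exists>M\<in>cellmons k. \<exists>m'. m = expo M + m'}"

lemma ideal_in_monom_ideal: "ideal_in RR (monom_ideal k :: 'k::comm_ring_1 mpoly set)"
  unfolding ideal_in_def
proof (intro conjI ballI)
  show "monom_ideal k \<subseteq> RR" by (auto simp: monom_ideal_def)
  show "0 \<in> monom_ideal k" by (simp add: monom_ideal_def is_subringD subring_RR)
next
  fix a b :: "'k mpoly" assume "a \<in> monom_ideal k" "b \<in> monom_ideal k"
  then show "a + b \<in> monom_ideal k"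
    using keys_add[of a b] by (fastforce simp: monom_ideal_def subring_RR intro: is_subringD)
next
  fix r a :: "'k mpoly" assume r: "r \<in> RR" and a: "a \<in> monom_ideal k"
  have "\<exists>M\<in>cellmons k. \<exists>m'. m = expo M + m'" if "m \<in> keys (r * a)" for m
  proof -
    from that obtain m1 m2 where "m = m1 + m2" "m1 \<in> keys r" "m2 \<in> keys a"
      using keys_mult[of r a] by blast
    moreover from a this obtain M m' where "M \<in> cellmons k" "m2 = expo M + m'"
      by (auto simp: monom_ideal_def)
    ultimately show ?thesis by (intro bexI[of _ M] exI[of _ "m1 + m'"]) (auto simp: ac_simps)
  qed
  with r a show "r * a \<in> monom_ideal k"
    by (auto simp: monom_ideal_def subring_RR intro: is_subringD)
qed

lemma monom_ideal_mult: "p \<in> monom_ideal k \<Longrightarrow> q \<in> monom_ideal l \<Longrightarrow> p * q \<in> monom_ideal (k + l)"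
  unfolding monom_ideal_def
proof (safe, goal_cases)
  case 1
  then show ?case by (auto simp: subring_RR intro: is_subringD)
next
  case (2 m)
  then obtain m1 m2 where m: "m = m1 + m2" "m1 \<in> keys p" "m2 \<in> keys q"
    using keys_mult[of p q] by blast
  with 2 obtain M N a b where "M \<in> cellmons k" "N \<in> cellmons l" "m1 = expo M + a" "m2 = expo N + b"
    by metis
  with m show ?case
    by (intro bexI[of _ "M + N"] exI[of _ "a + b"]) (auto simp: ac_simps expo_union cellmons_def)
qed

lemma cmon_monom_ideal: "M \<in> cellmons k \<Longrightarrow> cmon M \<in> (monom_ideal k :: 'k::comm_ring_1 mpoly set)"
  by (auto simp: monom_ideal_def cmon_RR cellmons_def cmon_def intro: exI[of _ M] exI[of _ 0])
     (metis cmon_RR cmon_def)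

lemma monom_ideal_least:
  assumes J: "ideal_in RR (J :: 'k::comm_ring_1 mpoly set)" and "\<And>M. M \<in> cellmons k \<Longrightarrow> cmon M \<in> J"
  shows "monom_ideal k \<subseteq> J"
proof
  fix p :: "'k mpoly" assume p: "p \<in> monom_ideal k"
  have "single m (lookup p m) \<in> J" if "m \<in> keys p" for m
  proof -
    from that p obtain M m' where M: "M \<in> cellmons k" "m = expo M + m'" by (auto simp: monom_ideal_def)
    have "keys m \<subseteq> ferrers_vars n lam" using p that by (auto simp: monom_ideal_def RR_iff)
    moreover have "keys m' \<subseteq> keys m" using M by (auto simp: in_keys_iff lookup_add)
    ultimately have "single m' (lookup p m) \<in> RR" by (intro single_RR) blast
    then have "single m' (lookup p m) * cmon M \<in> J" using assms M by (auto intro: ideal_inD)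
    then show ?thesis by (simp add: cmon_def mult_single M(2) add.commute)
  qed
  then have "(\<Sum>m\<in>keys p. single m (lookup p m)) \<in> J" using J by (intro ideal_in_sum)
  then show "p \<in> J" using poly_mapping_sum_single[of p] by simp
qed

lemma II_eq: "(II :: 'k::comm_ring_1 mpoly set) = monom_ideal 1"
proof (rule antisym)
  have 1: "{xy i j |i j. 1 \<le> i \<and> i \<le> n \<and> 1 \<le> j \<and> j \<le> lam i} = (cmon ` cellmons 1 :: 'k mpoly set)" (is "?L = ?R")
  proof (intro equalityI subsetI)
    fix p :: "'k mpoly" assume "p \<in> ?L"
    then obtain i j where "p = xy i j" "(i, j) \<in> cells" by (auto simp: cells_def)
    then show "p \<in> ?R" by (intro image_eqI[of _ _ "{#(i,j)#}"]) (auto simp: cmon_single cellmons_def)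
  next
    fix p :: "'k mpoly" assume "p \<in> ?R"
    then obtain M where "p = cmon M" "M \<in> cellmons (Suc 0)" by auto
    then obtain i j where "p = cmon {#(i, j)#}" "(i, j) \<in> cells" unfolding cellmons_Suc cellmons_0 by auto
    then show "p \<in> ?L" by (auto simp: cells_def cmon_single)
  qed
  show "(II :: 'k mpoly set) \<subseteq> monom_ideal 1"
    unfolding ferrers_ideal_def 1
    by (rule gen_ideal_least[OF ideal_in_monom_ideal]) (auto intro: cmon_monom_ideal)
  have "ideal_in RR (II :: 'k mpoly set)" unfolding ferrers_ideal_def 1
    by (rule ideal_in_gen_ideal[OF subring_RR]) (auto intro: cmon_RR simp: cellmons_def)
  then show "monom_ideal 1 \<subseteq> (II :: 'k mpoly set)"
    by (rule monom_ideal_least) (use gen_ideal_superset in \<open>unfold ferrers_ideal_def 1, blast\<close>)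
qed

lemma ideal_pow_II: "ideal_pow RR II k = (monom_ideal k :: 'k::comm_ring_1 mpoly set)"
proof (induction k)
  case 0
  show ?case by (auto simp: monom_ideal_def cellmons_0)
next
  case (Suc k)
  show ?case
  proof (rule antisym)
    show "ideal_pow RR II (Suc k) \<subseteq> (monom_ideal (Suc k) :: 'k mpoly set)"
      unfolding ideal_pow.simps Suc unfolding II_eq
      using monom_ideal_mult[of _ k _ 1]
      by (intro ideal_prod_least ideal_in_monom_ideal) auto
    show "monom_ideal (Suc k) \<subseteq> (ideal_pow RR II (Suc k) :: 'k mpoly set)"
    proof (rule monom_ideal_least)
      show "ideal_in RR (ideal_pow RR II (Suc k) :: 'k mpoly set)"
        by (intro ideal_in_pow subring_RR) (simp add: II_eq ideal_inD[OF ideal_in_monom_ideal])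
      fix M assume "M \<in> cellmons (Suc k)"
      then obtain z N where "M = {#z#} + N" "z \<in> cells" "N \<in> cellmons k" by (auto simp: cellmons_Suc)
      moreover then have "cmon {#z#} \<in> (monom_ideal 1 :: 'k mpoly set)"
        by (intro cmon_monom_ideal) (auto simp: cellmons_def)
      ultimately have "cmon {#z#} * cmon N \<in> (ideal_prod RR (monom_ideal 1) (monom_ideal k) :: 'k mpoly set)"
        by (intro ideal_prodI cmon_monom_ideal) (auto simp: cellmons_def)
      then show "cmon M \<in> (ideal_pow RR II (Suc k) :: 'k mpoly set)"
        unfolding ideal_pow.simps Suc unfolding II_eq ideal_prod_commute[of _ "monom_ideal k"] \<open>M = {#z#} + N\<close> cmon_union .
    qed
  qed
qed

lemma ideal_in_II: "ideal_in RR (II :: 'k::comm_ring_1 mpoly set)"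
  by (simp add: II_eq ideal_in_monom_ideal)

text \<open>The product \<open>J I^r\<close> always lies in \<open>I^(r+1)\<close>; the converse
  inclusion can be tested on the monomials that generate \<open>I^(r+1)\<close>.\<close>

lemma reduction_step_iff:
  assumes "ideal_in RR J" "J \<subseteq> (II :: 'k::comm_ring_1 mpoly set)"
  shows "ideal_pow RR II (Suc r) = ideal_prod RR J (ideal_pow RR II r) \<longleftrightarrow>
    (\<forall>M\<in>cellmons (Suc r). cmon M \<in> ideal_prod RR J (monom_ideal r))"
proof -
  have "ideal_prod RR J (monom_ideal r) \<subseteq> (monom_ideal (Suc r) :: 'k mpoly set)"
    using assms monom_ideal_mult[of _ 1 _ r]
    by (intro ideal_prod_least ideal_in_monom_ideal) (auto simp: II_eq)
  moreover have "ideal_in RR (ideal_prod RR J (monom_ideal r))"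
    using assms by (intro ideal_in_prod subring_RR) (auto dest: ideal_inD simp: monom_ideal_def)
  ultimately show ?thesis unfolding ideal_pow_II
    using monom_ideal_least[of "ideal_prod RR J (monom_ideal r)" "Suc r"] cmon_monom_ideal by blast
qed

lemma reduction_step_mono:
  assumes J: "ideal_in RR J" "J \<subseteq> (II :: 'k::comm_ring_1 mpoly set)" and "r \<le> s"
    and "\<forall>M\<in>cellmons (Suc r). cmon M \<in> ideal_prod RR J (monom_ideal r)"
  shows "\<forall>M\<in>cellmons (Suc s). cmon M \<in> ideal_prod RR J (monom_ideal s)"
  using \<open>r \<le> s\<close>
proof (induction rule: dec_induct)
  case base
  show ?case using assms by blast
next
  case (step s)
  show ?case
  proof
    fix M assume "M \<in> cellmons (Suc (Suc s))"
    then obtain z N where M: "M = {#z#} + N" "z \<in> cells" "N \<in> cellmons (Suc s)"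
      using cellmons_Suc[of M "Suc s"] by auto
    have id: "ideal_in RR (ideal_prod RR J (monom_ideal (Suc s)))"
      using J by (intro ideal_in_prod subring_RR) (auto dest: ideal_inD simp: monom_ideal_def)
    let ?c = "cmon {#z#} :: 'k mpoly"
    have c: "?c \<in> monom_ideal 1"
      using M(2) by (intro cmon_monom_ideal) (auto simp: cellmons_def)
    \<comment> \<open>The polynomials that one more generator \<open>?c\<close> carries into
      \<open>J I^(s+1)\<close> form an ideal, so it is enough to treat the products that generate
      \<open>J I^s\<close>.\<close>
    let ?K = "{p \<in> RR. ?c * p \<in> ideal_prod RR J (monom_ideal (Suc s))}"
    have "ideal_in RR ?K"
      using id by (auto simp: ideal_in_def subring_RR distrib_left mult.left_commute intro: is_subringD)
    then have "ideal_prod RR J (monom_ideal s) \<subseteq> ?K"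
    proof (rule ideal_prod_least)
      fix a b :: "'k mpoly" assume a: "a \<in> J" and b: "b \<in> monom_ideal s"
      have "a * (?c * b) \<in> ideal_prod RR J (monom_ideal (Suc s))"
        using monom_ideal_mult[OF c b] by (intro ideal_prodI a) simp
      moreover have "a * b \<in> RR" using a b J
        by (intro is_subringD(4)[OF subring_RR]) (auto dest: ideal_inD simp: monom_ideal_def)
      ultimately show "a * b \<in> ?K" by (simp add: mult.left_commute)
    qed
    then show "cmon M \<in> ideal_prod RR J (monom_ideal (Suc s))"
      using step.IH M by (auto simp: cmon_union simp del: union_mset_add_mset_left)
  qed
qed

text \<open>The piece of degree \<open>k\<close> of the algebra K[x_i y_j]. As \<open>I\<close> is
  generated by forms of one degree, this algebra is its fiber ring; being a subalgebra of the
  polynomial ring it needs no quotient.\<close>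

definition fiber :: "nat \<Rightarrow> ('k::field) mpoly set" where
  "fiber k = mp.span (cmon ` cellmons k)"

definition mult_span :: "('k::field) mpoly set \<Rightarrow> nat \<Rightarrow> 'k mpoly set" where
  "mult_span V k = mp.span {v * cmon N | v N. v \<in> V \<and> N \<in> cellmons k}"

abbreviation bottom :: "('k::zero) mpoly \<Rightarrow> 'k mpoly" where
  "bottom \<equiv> wcomp one_wt 2"

lemma monom_ideal_ordge: "p \<in> monom_ideal k \<Longrightarrow> ordge one_wt (2 * k) p"
  by (fastforce simp: monom_ideal_def ordge_def cellmons_def)

text \<open>A term of degree \<open>2 * k\<close> in \<open>I^k\<close> leaves degree 0 for the
  cofactor of its \<open>k\<close> cells, so it is a constant times some
  \<open>cmon M\<close>.\<close>

lemma monom_ideal_wcomp: "p \<in> monom_ideal k \<Longrightarrow> wcomp one_wt (2 * k) p \<in> fiber k"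
proof -
  assume p: "p \<in> monom_ideal k"
  let ?q = "wcomp one_wt (2 * k) p"
  have "single m (lookup ?q m) \<in> fiber k" if "m \<in> keys ?q" for m
  proof -
    have m: "m \<in> keys p" "tdeg m = 2 * k" using that by (auto simp: keys_wcomp)
    then obtain M m' where M: "M \<in> cellmons k" "m = expo M + m'" using p by (auto simp: monom_ideal_def)
    with m have "tdeg m' = 0" by (auto simp: cellmons_def)
    then have "single m (lookup ?q m) = single 0 (lookup ?q m) * cmon M"
      using M tdeg_eq_0[of m'] by (simp add: cmon_def mult_single)
    then show ?thesis using M by (simp add: fiber_def mp.span_base mp.span_scale)
  qed
  then have "(\<Sum>m\<in>keys ?q. single m (lookup ?q m)) \<in> fiber k"
    unfolding fiber_def by (intro mp.span_sum)
  then show ?thesis using poly_mapping_sum_single[of ?q] by simp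
qed

lemma bottom_II: "J \<subseteq> II \<Longrightarrow> bottom ` J \<subseteq> fiber 1"
  using monom_ideal_wcomp[of _ 1] by (auto simp: II_eq)

lemma mult_span_fiber:
  assumes "v \<in> V" "q \<in> fiber k"
  shows "v * q \<in> mult_span V k"
  using assms(2) unfolding fiber_def
proof (induction rule: mp.span_induct_alt)
  case base
  show ?case by (simp add: mult_span_def mp.span_zero)
next
  case (step c x y)
  have "v * x \<in> mult_span V k" using step assms(1)
    unfolding mult_span_def by (intro mp.span_base) auto
  then have "single 0 c * (v * x) + v * y \<in> mult_span V k"
    using step unfolding mult_span_def by (intro mp.span_add mp.span_scale)
  then show ?case by (simp add: algebra_simps)
qed

text \<open>In the lowest possible degree a multiplier counts only through its constant coefficient,
  so the conditions collected in \<open>?K\<close> define an ideal.\<close>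

lemma cmon_mult_span_of_reduction:
  assumes J: "ideal_in RR J" "J \<subseteq> (II :: 'k::field mpoly set)"
    and p: "p \<in> ideal_prod RR J (monom_ideal r)"
  shows "wcomp one_wt (2 * Suc r) p \<in> mult_span (bottom ` J) r"
proof -
  let ?V = "bottom ` J"
  let ?K = "{p \<in> RR. ordge one_wt (2 * Suc r) p \<and> wcomp one_wt (2 * Suc r) p \<in> mult_span ?V r} :: 'k mpoly set"
  have "ideal_in RR ?K"
    unfolding ideal_in_def
  proof (intro conjI ballI)
    show "0 \<in> ?K" by (simp add: is_subringD subring_RR mult_span_def mp.span_zero)
  next
    fix a b assume "a \<in> ?K" "b \<in> ?K"
    then show "a + b \<in> ?K"
      by (auto simp: subring_RR wcomp_add mult_span_def intro: is_subringD ordge_add mp.span_add)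
  next
    fix a r' :: "'k mpoly" assume a: "a \<in> ?K" and r': "r' \<in> RR"
    have "ordge one_wt (0 + 2 * Suc r) (r' * a)"
      using a by (intro ordge_mult) auto
    moreover have "wcomp one_wt (0 + 2 * Suc r) (r' * a) = wcomp one_wt 0 r' * wcomp one_wt (2 * Suc r) a"
      using a by (intro wcomp_mult) auto
    moreover have "wcomp one_wt 0 r' = single 0 (lookup r' 0)"
      by (rule poly_mapping_eqI) (auto simp: lookup_wcomp lookup_single when_def dest: tdeg_eq_0)
    ultimately show "r' * a \<in> ?K" using a r'
      by (auto simp: subring_RR mult_span_def intro: is_subringD mp.span_scale)
  qed auto
  then have "ideal_prod RR J (monom_ideal r) \<subseteq> ?K"
  proof (rule ideal_prod_least)
    fix a b :: "'k mpoly" assume a: "a \<in> J" and b: "b \<in> monom_ideal r"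
    have o: "ordge one_wt 2 a" "ordge one_wt (2 * r) b"
      using a J b monom_ideal_ordge[of a 1] monom_ideal_ordge[of b r] by (auto simp: II_eq)
    have "ordge one_wt (2 + 2 * r) (a * b)" "wcomp one_wt (2 + 2 * r) (a * b) = bottom a * wcomp one_wt (2 * r) b"
      by (rule ordge_mult[OF o], rule wcomp_mult[OF o])
    moreover have "bottom a * wcomp one_wt (2 * r) b \<in> mult_span ?V r"
      using a b by (intro mult_span_fiber monom_ideal_wcomp) auto
    moreover have "a * b \<in> RR"
      using a b ideal_inD(1)[OF J(1)] ideal_inD(1)[OF ideal_in_monom_ideal] by (intro is_subringD(4)[OF subring_RR]) auto
    ultimately show "a * b \<in> ?K" by simp
  qed
  with p show ?thesis by blast
qed

lemma reduction_bottom: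
  assumes J: "ideal_in RR J" "J \<subseteq> (II :: 'k::field mpoly set)"
    and r: "ideal_pow RR II (Suc r) = ideal_prod RR J (ideal_pow RR II r)"
  shows "fiber (Suc r) \<subseteq> mult_span (bottom ` J) r"
proof -
  have "cmon M \<in> mult_span (bottom ` J) r" if M: "M \<in> cellmons (Suc r)" for M
  proof -
    have "(cmon M :: 'k mpoly) \<in> ideal_prod RR J (monom_ideal r)"
      using r[unfolded reduction_step_iff[OF J]] M by blast
    then have "wcomp one_wt (2 * Suc r) (cmon M) \<in> mult_span (bottom ` J) r"
      by (rule cmon_mult_span_of_reduction[OF J])
    moreover have "wcomp one_wt (2 * Suc r) (cmon M) = (cmon M :: 'k mpoly)"
      using M by (simp add: cmon_def wcomp_single cellmons_def)
    ultimately show ?thesis by simp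
  qed
  then show ?thesis unfolding fiber_def mult_span_def
    by (intro mp.span_minimal mp.subspace_span) auto
qed

end

section \<open>Straightening modulo the diagonals\<close>

text \<open>Constant along each diagonal, so trading a cell for another one of its diagonal does not
  change it.\<close>

definition sq_weight :: "(nat \<times> nat) multiset \<Rightarrow> int" where
  "sq_weight M = (\<Sum>z\<in>#M. (int (snd z) - int (fst z))\<^sup>2)"

definition pos_weight :: "(nat \<times> nat) multiset \<Rightarrow> nat" where
  "pos_weight M = (\<Sum>z\<in>#M. fst z + snd z)"

context ferrers
begin

definition dcells :: "int \<Rightarrow> (nat \<times> nat) set" where
  "dcells c = {z \<in> cells. int (snd z) - int (fst z) = c}"

definition diag :: "int \<Rightarrow> ('k::comm_ring_1) mpoly" where
  "diag c = (\<Sum>z\<in>dcells c. xy (fst z) (snd z))"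

definition colours :: "int set" where
  "colours = {- int (n - 1)..int (lam 1) - 1}"

text \<open>A path enters a corner from the left and leaves it upwards, so a corner can lie neither
  in the first column nor in the first row.\<close>

definition corner_sets :: "nat \<Rightarrow> (nat \<times> nat) set set" where
  "corner_sets k = {S. S \<subseteq> cells \<and> card S = k \<and> (\<forall>z\<in>S. 2 \<le> fst z \<and> 2 \<le> snd z) \<and>
     (\<forall>z\<in>S. \<forall>z'\<in>S. z \<noteq> z' \<longrightarrow> fst z < fst z' \<and> snd z' < snd z \<or> fst z' < fst z \<and> snd z < snd z')}"

lemma finite_dcells: "finite (dcells c)"
  using finite_cells by (auto simp: dcells_def)

lemma colour_of_cell: "z \<in> cells \<Longrightarrow> int (snd z) - int (fst z) \<in> colours"
  by (cases z) (use cells_le in \<open>fastforce simp: colours_def\<close>)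

lemma swap_cells:
  assumes M: "add_mset (a, b) (add_mset (a', b') N) \<in> cellmons k" (is "?M \<in> _") and ab: "a < a'" "b < b'"
  shows "add_mset (a', b) (add_mset (a, b') N) \<in> cellmons k"
    and "cmon ?M = (cmon (add_mset (a', b) (add_mset (a, b') N)) :: 'k::comm_ring_1 mpoly)"
    and "sq_weight ?M < sq_weight (add_mset (a', b) (add_mset (a, b') N))"
proof -
  have c: "(a, b) \<in> cells" "(a', b') \<in> cells" using M by (auto simp: cellmons_def)
  have "(a', b) \<in> cells" "(a, b') \<in> cells"
    using cells_down[OF c(2), of a' b] cells_down[OF c(2), of a b'] cells_le[OF c(1)] cells_le[OF c(2)] ab by auto
  then show "add_mset (a', b) (add_mset (a, b') N) \<in> cellmons k"
    using M by (auto simp: cellmons_def)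
  show "cmon ?M = (cmon (add_mset (a', b) (add_mset (a, b') N)) :: 'k mpoly)"
    by (simp add: cmon_def expo_add_mset ac_simps)
  \<comment> \<open>This product is exactly the gain of \<open>sq_weight\<close> under the
    swap.\<close>
  have "0 < 2 * ((int a' - int a) * (int b' - int b))" using ab by simp
  then show "sq_weight ?M < sq_weight (add_mset (a', b) (add_mset (a, b') N))"
    by (simp add: sq_weight_def power2_eq_square algebra_simps)
qed

text \<open>The number \<open>s\<close> is a shift of \<open>z\<close> up its diagonal. Either
  \<open>z\<close> lies in the first row or column and no such shift exists, or \<open>z\<close> is
  weakly dominated by another cell, possibly a second copy of itself. If no cell is of either kind,
  \<open>M\<close> has no repetitions and its cells form a corner set.\<close>

lemma corner_or_movable:
  assumes M: "M \<in> cellmons k" and nc: "M \<notin> mset_set ` corner_sets k"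
  obtains z N where "M = add_mset z N"
    "\<And>s. 0 < s \<Longrightarrow> s < fst z \<Longrightarrow> s < snd z \<Longrightarrow> \<exists>z'\<in>#N. fst z \<le> fst z' \<and> snd z \<le> snd z'"
proof (cases "\<exists>z\<in>#M. fst z \<le> 1 \<or> snd z \<le> 1")
  case True
  then obtain z where z: "z \<in># M" "fst z \<le> 1 \<or> snd z \<le> 1" by blast
  then show ?thesis using that[of z "M - {#z#}"] by auto
next
  case c1: False
  show ?thesis
  proof (cases "\<exists>z N. M = add_mset z N \<and> (\<exists>z'\<in>#N. fst z \<le> fst z' \<and> snd z \<le> snd z')")
    case True
    then show ?thesis using that by blast
  next
    case False
    then have F: "\<not> (fst z \<le> fst z' \<and> snd z \<le> snd z')" if "M = add_mset z N" "z' \<in># N" for z z' N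
      using that by blast
    have c: "count M z = 1" if "z \<in># M" for z
    proof (rule ccontr)
      assume "count M z \<noteq> 1"
      then have "count M z > 1" using that count_greater_zero_iff[of M z] by linarith
      then have "z \<in># M - {#z#}" by (simp add: in_diff_count)
      then show False using F[of z "M - {#z#}" z] that by simp
    qed
    have MS: "M = mset_set (set_mset M)"
    proof (rule multiset_eqI)
      fix z show "count M z = count (mset_set (set_mset M)) z"
        using c[of z] by (cases "z \<in># M") (auto simp: count_eq_zero_iff)
    qed
    have "set_mset M \<in> corner_sets k"
      unfolding corner_sets_def
    proof (intro CollectI conjI ballI impI)
      show "set_mset M \<subseteq> cells" using M by (simp add: cellmons_def)
      show "card (set_mset M) = k" using M arg_cong[OF MS, of size] by (simp add: cellmons_def)
      fix z assume "z \<in> set_mset M"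
      then show "2 \<le> fst z" "2 \<le> snd z" using c1 by force+
    next
      fix z z' assume z: "z \<in># M" "z' \<in># M" "z \<noteq> z'"
      then have "z' \<in># M - {#z#}" "z \<in># M - {#z'#}" by (simp_all add: in_diff_count)
      then have "\<not> (fst z \<le> fst z' \<and> snd z \<le> snd z')" "\<not> (fst z' \<le> fst z \<and> snd z' \<le> snd z)"
        using F[of z "M - {#z#}" z'] F[of z' "M - {#z'#}" z] z by auto
      then show "fst z < fst z' \<and> snd z' < snd z \<or> fst z' < fst z \<and> snd z < snd z'" by linarith
    qed
    then show ?thesis using nc MS by blast
  qed
qed

text \<open>Crude bounds that turn the increase of the two weights into a decreasing
  measure.\<close>

lemma weight_bounds:
  assumes "M \<in> cellmons k"
  shows "sq_weight M \<le> int k * (int (n + lam 1))\<^sup>2" "pos_weight M \<le> k * (n + lam 1)"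
proof -
  have M: "set_mset M \<subseteq> cells" "size M = k" using assms by (auto simp: cellmons_def)
  have z: "(int (snd z) - int (fst z))\<^sup>2 \<le> (int (n + lam 1))\<^sup>2 \<and> fst z + snd z \<le> n + lam 1" if "z \<in># M" for z
  proof -
    have c: "(fst z, snd z) \<in> cells" using M that by auto
    have "\<bar>int (snd z) - int (fst z)\<bar> \<le> \<bar>int (n + lam 1)\<bar>" using cells_le[OF c] by linarith
    then have "(int (snd z) - int (fst z))\<^sup>2 \<le> (int (n + lam 1))\<^sup>2" by (simp only: abs_le_square_iff)
    then show ?thesis using cells_le[OF c] by simp
  qed
  have "sq_weight M \<le> (\<Sum>z\<in>#M. (int (n + lam 1))\<^sup>2)" "pos_weight M \<le> (\<Sum>z\<in>#M. n + lam 1)"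
    unfolding sq_weight_def pos_weight_def by (intro sum_mset_mono; use z in blast)+
  then show "sq_weight M \<le> int k * (int (n + lam 1))\<^sup>2" "pos_weight M \<le> k * (n + lam 1)"
    using M(2) by simp_all
qed

text \<open>Two cells that do not form a chain are swapped, which raises
  \<open>sq_weight\<close>; otherwise some cell can only be pushed down its own diagonal, which raises
  \<open>pos_weight\<close> (a push up the diagonal creates a pair that can be swapped).\<close>

lemma cmon_straighten:
  assumes "M \<in> cellmons (Suc k)"
  shows "cmon M \<in> mp.span ({diag c * cmon N | c N. c \<in> colours \<and> N \<in> cellmons k}
     \<union> (\<lambda>S. cmon (mset_set S)) ` corner_sets (Suc k) :: 'k::field mpoly set)" (is "_ \<in> mp.span ?G")
proof -
  \<comment> \<open>\<open>a\<close> and \<open>b\<close> measure how far the two weights are below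
    their bounds; the induction is lexicographic, with \<open>sq_weight\<close> first.\<close>
  define a where "a M = nat (int (Suc k) * (int (n + lam 1))\<^sup>2 - sq_weight M)" for M
  define b where "b M = Suc k * (n + lam 1) - pos_weight M" for M
  let ?P = "\<lambda>M. M \<in> cellmons (Suc k) \<longrightarrow> (cmon M :: 'k mpoly) \<in> mp.span ?G"
  have "?P M" for M
  proof (induction M rule: wf_induct[OF wf_measures[of "[a, b]"]])
    case (1 M)
    have IHa: "cmon M' \<in> mp.span ?G" if "M' \<in> cellmons (Suc k)" "sq_weight M < sq_weight M'" for M'
    proof -
      have "a M' < a M" using that weight_bounds[OF that(1)] by (simp add: a_def)
      then show ?thesis using 1 that(1) by (auto simp: in_measures)
    qed
    have IHb: "cmon M' \<in> mp.span ?G"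
      if "M' \<in> cellmons (Suc k)" "sq_weight M = sq_weight M'" "pos_weight M < pos_weight M'" for M'
    proof -
      have "a M' = a M" "b M' < b M" using that weight_bounds[OF that(1)] by (simp_all add: a_def b_def)
      then show ?thesis using 1 that(1) by (auto simp: in_measures)
    qed
    show ?case
    proof
      assume M: "M \<in> cellmons (Suc k)"
      consider (corner) "M \<in> mset_set ` corner_sets (Suc k)"
        | (nonchain) z z' N where "M = add_mset z (add_mset z' N)" "fst z < fst z'" "snd z < snd z'"
        | (move) "M \<notin> mset_set ` corner_sets (Suc k)" by blast
      then show "(cmon M :: 'k mpoly) \<in> mp.span ?G"
      proof cases
        case corner
        then show ?thesis by (intro mp.span_base) auto
      next
        case nonchain
        obtain p q p' q' where z: "z = (p, q)" "z' = (p', q')" by (metis surj_pair)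
        note M' = M[unfolded nonchain(1) z]
        have lt: "p < p'" "q < q'" using nonchain z by auto
        note sw = swap_cells[OF M' lt]
        show ?thesis using IHa[OF sw(1)] sw(3) unfolding nonchain(1) z sw(2) by blast
      next
        case move
        obtain z N where zN: "M = add_mset z N"
          and up: "\<And>s. 0 < s \<Longrightarrow> s < fst z \<Longrightarrow> s < snd z \<Longrightarrow> \<exists>z'\<in>#N. fst z \<le> fst z' \<and> snd z \<le> snd z'"
          using corner_or_movable[OF M move] by blast
        have zc: "z \<in> cells" and N: "N \<in> cellmons k" using M zN by (auto simp: cellmons_def)
        define c where "c = int (snd z) - int (fst z)"
        have zd: "z \<in> dcells c" using zc by (simp add: dcells_def c_def)
        have "diag c * cmon N = (\<Sum>w\<in>dcells c. cmon (add_mset w N) :: 'k mpoly)"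
          by (simp add: diag_def sum_distrib_right cmon_add_mset)
        also have "\<dots> = cmon M + (\<Sum>w\<in>dcells c - {z}. cmon (add_mset w N))"
          using zd finite_dcells zN by (simp add: sum.remove)
        \<comment> \<open>Modulo the multiples of \<open>diag c\<close>, the cell \<open>z\<close>
          is exchanged for all other cells \<open>w\<close> of its diagonal.\<close>
        finally have eq: "(cmon M :: 'k mpoly) = diag c * cmon N - (\<Sum>w\<in>dcells c - {z}. cmon (add_mset w N))"
          by simp
        have "cmon (add_mset w N) \<in> mp.span ?G" if "w \<in> dcells c - {z}" for w
        proof -
          have w: "w \<in> cells" "int (snd w) - int (fst w) = c" "w \<noteq> z" using that by (auto simp: dcells_def)
          have M': "add_mset w N \<in> cellmons (Suc k)" using w N by (simp add: cellmons_def)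
          have sq: "sq_weight (add_mset w N) = sq_weight M" using w zN by (simp add: sq_weight_def c_def)
          show ?thesis
          proof (cases "fst z < fst w")
            case True
            then have "snd z < snd w" using w(2) by (simp add: c_def)
            then have "pos_weight M < pos_weight (add_mset w N)" using True zN by (simp add: pos_weight_def)
            then show ?thesis using IHb M' sq by simp
          next
            case False
            then have "fst w < fst z" using w(2,3) by (auto simp: c_def prod_eq_iff)
            then have lt: "fst w < fst z" "snd w < snd z" using w(2) by (auto simp: c_def)
            have "1 \<le> fst w" "1 \<le> snd w" using cells_le[of "fst w" "snd w"] w(1) by auto
            \<comment> \<open>\<open>w\<close> lies up the diagonal from \<open>z\<close>, hence
              strictly before \<open>z'\<close>. Swapping \<open>w\<close> with \<open>z'\<close>
              raises \<open>sq_weight\<close>, which is the same for \<open>add_mset w N\<close> as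
              for \<open>M\<close>.\<close>
            then obtain z' where z': "z' \<in># N" "fst z \<le> fst z'" "snd z \<le> snd z'"
              using up[of "fst z - fst w"] lt w(2) unfolding c_def by force
            obtain N' where N': "N = add_mset z' N'" using multi_member_split[OF z'(1)] by blast
            obtain p q p' q' where e: "w = (p, q)" "z' = (p', q')" by (metis surj_pair)
            note M'' = M'[unfolded N' e]
            have lt': "p < p'" "q < q'" using lt z' e by auto
            note sw = swap_cells[OF M'' lt']
            show ?thesis using IHa[OF sw(1)] sw(3) sq unfolding N' e sw(2) by simp
          qed
        qed
        then have "(\<Sum>w\<in>dcells c - {z}. cmon (add_mset w N)) \<in> mp.span ?G" by (rule mp.span_sum)
        moreover have "diag c * cmon N \<in> mp.span ?G"
          using colour_of_cell[OF zc] N by (intro mp.span_base) (auto simp: c_def)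
        ultimately show ?thesis unfolding eq by (intro mp.span_diff)
      qed
    qed
  qed
  then show ?thesis using assms by blast
qed

end

section \<open>Counting monomials by marked lattice paths\<close>

text \<open>Repetitions and cells in a common row or column are allowed; only the pairs that a swap
  would improve are excluded.\<close>

definition chain :: "(nat \<times> nat) multiset \<Rightarrow> bool" where
  "chain M \<longleftrightarrow> (\<forall>z\<in>#M. \<forall>z'\<in>#M. \<not> (fst z < fst z' \<and> snd z < snd z'))"

text \<open>A cell in the last row and a cell in the first column would be strictly comparable
  unless one of them is both.\<close>

lemma chain_extreme:
  assumes "chain M" "M \<noteq> {#}"
  shows "(Max (fst ` set_mset M), Min (snd ` set_mset M)) \<in># M"
proof -
  let ?a = "Max (fst ` set_mset M)" and ?b = "Min (snd ` set_mset M)"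
  have "?a \<in> fst ` set_mset M" "?b \<in> snd ` set_mset M" using assms(2) by (auto intro!: Max_in Min_in)
  then obtain z z' where z: "z \<in># M" "fst z = ?a" "z' \<in># M" "snd z' = ?b" by fastforce
  have "fst z' \<le> ?a" "?b \<le> snd z" using z by (auto intro: Max_ge Min_le)
  moreover have "\<not> (fst z' < fst z \<and> snd z' < snd z)" using assms(1) z by (auto simp: chain_def)
  ultimately have "snd z = ?b \<or> fst z' = ?a" using z by linarith
  then have "z = (?a, ?b) \<or> z' = (?a, ?b)" using z by (auto simp: prod_eq_iff)
  then show ?thesis using z by auto
qed

lemma rows_expo: "fst ` set_mset M = {i. lookup (expo M) (X i) \<noteq> 0}"
  by (induction M) (auto simp: expo_add_mset lookup_add lookup_single when_def)

lemma columns_expo: "snd ` set_mset M = {j. lookup (expo M) (Y j) \<noteq> 0}"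
  by (induction M) (auto simp: expo_add_mset lookup_add lookup_single when_def)

text \<open>The exponent shows which rows and columns occur, hence by \<open>chain_extreme\<close> a
  cell common to both chains; this cell is removed and the rest follows by induction.\<close>

lemma chain_expo_inj: "chain M \<Longrightarrow> chain N \<Longrightarrow> expo M = expo N \<Longrightarrow> M = N"
proof (induction "size M" arbitrary: M N)
  case 0
  then have "fst ` set_mset N = {}" using rows_expo[of M] rows_expo[of N] by simp
  with 0 show ?case by simp
next
  case (Suc k)
  then have "M \<noteq> {#}" by auto
  moreover then have "N \<noteq> {#}" using rows_expo[of M] rows_expo[of N] Suc.prems(3) by auto
  ultimately obtain z where z: "z \<in># M" "z \<in># N"
    using chain_extreme[of M] chain_extreme[of N] Suc.prems
    unfolding rows_expo columns_expo by metis
  have "chain (M - {#z#})" "chain (N - {#z#})"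
    using Suc.prems unfolding chain_def by (meson in_diffD)+
  moreover have "expo (M - {#z#}) = expo (N - {#z#})"
    using Suc.prems(3) expo_add_mset[of z "M - {#z#}"] expo_add_mset[of z "N - {#z#}"] z by simp
  moreover have "k = size (M - {#z#})" using Suc.hyps(2) z by (simp add: size_Diff_singleton)
  ultimately have "M - {#z#} = N - {#z#}" using Suc.hyps(1) by blast
  then show ?case using z by (metis insert_DiffM)
qed

text \<open>The row in which the north-west-most monotone path through the cells of \<open>S\<close> meets the
  diagonal \<open>c\<close>.\<close>

definition path_row :: "(nat \<times> nat) set \<Rightarrow> int \<Rightarrow> int" where
  "path_row S c = Max ({1, 1 - c} \<union> (\<lambda>z. min (int (fst z)) (int (snd z) - c)) ` S)"

definition path_cell :: "(nat \<times> nat) set \<Rightarrow> int \<Rightarrow> nat \<times> nat" where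
  "path_cell S c = (nat (path_row S c), nat (path_row S c + c))"

abbreviation colour :: "nat \<times> nat \<Rightarrow> int" where
  "colour z \<equiv> int (snd z) - int (fst z)"

context
  fixes S :: "(nat \<times> nat) set" assumes fin: "finite S"
begin

lemma path_row_le_iff:
  "path_row S c \<le> x \<longleftrightarrow> 1 \<le> x \<and> 1 - c \<le> x \<and> (\<forall>z\<in>S. min (int (fst z)) (int (snd z) - c) \<le> x)"
  unfolding path_row_def using fin by (subst Max_le_iff) auto

lemma path_row_ge:
  "1 \<le> path_row S c" "1 - c \<le> path_row S c" "\<forall>z\<in>S. min (int (fst z)) (int (snd z) - c) \<le> path_row S c"
  using path_row_le_iff[of c "path_row S c"] by auto

lemma path_row_cases:
  "path_row S c = 1 \<or> path_row S c = 1 - c \<or> (\<exists>z\<in>S. path_row S c = min (int (fst z)) (int (snd z) - c))"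
proof -
  have "path_row S c \<in> {1, 1 - c} \<union> (\<lambda>z. min (int (fst z)) (int (snd z) - c)) ` S"
    unfolding path_row_def using fin by (intro Max_in) auto
  then show ?thesis by auto
qed

lemma path_row_antimono: "c \<le> c' \<Longrightarrow> path_row S c' \<le> path_row S c"
  unfolding path_row_le_iff[of c'] using path_row_ge[of c] by fastforce

lemma path_column_mono: "c \<le> c' \<Longrightarrow> path_row S c + c \<le> path_row S c' + c'"
proof -
  assume "c \<le> c'"
  then have "path_row S c \<le> path_row S c' + (c' - c)"
    unfolding path_row_le_iff[of c] using path_row_ge[of c'] by fastforce
  then show ?thesis by simp
qed

lemma colour_path_cell [simp]: "colour (path_cell S c) = c"
  using path_row_ge[of c] by (simp add: path_cell_def)

lemma path_cells_chain: "\<not> (fst (path_cell S c) < fst (path_cell S c') \<and> snd (path_cell S c) < snd (path_cell S c'))"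
  using path_row_antimono[of c c'] path_column_mono[of c' c] path_row_ge[of c] path_row_ge[of c']
  unfolding path_cell_def by (cases "c \<le> c'") auto

text \<open>These three rows say that the path enters \<open>z\<close> from the left and leaves it
  upwards; the strict position of the other cells of \<open>S\<close> keeps them from
  interfering.\<close>

lemma path_row_corner:
  assumes strict: "\<forall>z\<in>S. \<forall>z'\<in>S. z \<noteq> z' \<longrightarrow> fst z < fst z' \<and> snd z' < snd z \<or> fst z' < fst z \<and> snd z < snd z'"
    and z: "z \<in> S" "2 \<le> fst z" "2 \<le> snd z"
  shows "path_row S (colour z) = int (fst z)" "path_row S (colour z - 1) = int (fst z)"
    "path_row S (colour z + 1) = int (fst z) - 1"
proof -
  have *: "z' = z \<or> fst z < fst z' \<and> snd z' < snd z \<or> fst z' < fst z \<and> snd z < snd z'" if "z' \<in> S" for z'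
    using strict z that by blast
  have "path_row S (colour z) \<le> int (fst z)" "path_row S (colour z - 1) \<le> int (fst z)"
    "path_row S (colour z + 1) \<le> int (fst z) - 1"
    unfolding path_row_le_iff using z(2,3) * by fastforce+
  then show "path_row S (colour z) = int (fst z)" "path_row S (colour z - 1) = int (fst z)"
    "path_row S (colour z + 1) = int (fst z) - 1"
    using path_row_ge(3)[of "colour z"] path_row_ge(3)[of "colour z - 1"] path_row_ge(3)[of "colour z + 1"] z(1)
    by (fastforce intro: antisym)+
qed

text \<open>With \<open>path_row_corner\<close> this recovers the corners from the path. The row on
  the diagonal of \<open>z\<close> is forced by some cell \<open>w\<close> of \<open>S\<close>, and
  the rows on the two neighbouring diagonals leave only \<open>w = z\<close>.\<close>

lemma corner_of_path:
  assumes "path_row S (colour z) = int (fst z)" "path_row S (colour z - 1) = int (fst z)"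
    "path_row S (colour z + 1) = int (fst z) - 1"
  shows "z \<in> S"
proof -
  have "1 \<le> int (fst z) - 1" "1 - (colour z - 1) \<le> int (fst z)"
    using path_row_ge[of "colour z + 1"] path_row_ge[of "colour z - 1"] assms by auto
  then obtain w where w: "w \<in> S" "int (fst z) = min (int (fst w)) (int (snd w) - colour z)"
    using path_row_cases[of "colour z"] assms by auto
  have "min (int (fst w)) (int (snd w) - (colour z + 1)) \<le> int (fst z) - 1"
    "min (int (fst w)) (int (snd w) - (colour z - 1)) \<le> int (fst z)"
    using path_row_ge(3)[of "colour z + 1"] path_row_ge(3)[of "colour z - 1"] w(1) assms(2,3) by fastforce+
  with w(2) have "w = z" by (auto simp: prod_eq_iff min_def split: if_splits)
  with w show ?thesis by simp
qed

text \<open>A cell of the path constrains the other diagonals only in the way the monotonicity of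
  its row and column already does, so adding such cells keeps the path.\<close>

lemma path_row_cong:
  assumes "finite T" "S \<subseteq> T" "T \<subseteq> range (path_cell S)"
  shows "path_row T c = path_row S c"
proof (rule antisym)
  show "path_row S c \<le> path_row T c"
    unfolding path_row_def by (rule Max_mono) (use assms in auto)
  show "path_row T c \<le> path_row S c"
    unfolding path_row_def[of T]
  proof (subst Max_le_iff)
    show "\<forall>x\<in>{1, 1 - c} \<union> (\<lambda>z. min (int (fst z)) (int (snd z) - c)) ` T. x \<le> path_row S c"
    proof
      fix x assume "x \<in> {1, 1 - c} \<union> (\<lambda>z. min (int (fst z)) (int (snd z) - c)) ` T"
      then consider "x = 1 \<or> x = 1 - c" | z where "z \<in> T" "x = min (int (fst z)) (int (snd z) - c)"
        by blast
      then show "x \<le> path_row S c"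
      proof cases
        case 2
        then obtain d where "z = path_cell S d" using assms(3) by blast
        then have "x = min (path_row S d) (path_row S d + d - c)"
          using 2 path_row_ge(1,2)[of d] by (simp add: path_cell_def)
        then show ?thesis using path_row_antimono[of c d] path_column_mono[of d c] by (cases "c \<le> d") auto
      qed (use path_row_ge in auto)
    qed
  qed (use assms in auto)
qed

end

lemma independent_monomials: "mp.independent ((\<lambda>m. single m (1 :: 'k::field)) ` A)"
proof -
  have sub: "keys x \<subseteq> B" if "x \<in> mp.span ((\<lambda>m. single m (1 :: 'k)) ` B)" for x and B :: "('a \<Rightarrow>\<^sub>0 nat) set"
    using that
  proof (induction rule: mp.span_induct_alt)
    case (step c x y)
    have "keys (single 0 c * x + y) \<subseteq> keys (single 0 c * x) \<union> keys y"
      by (rule keys_add)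
    with step show ?case by (auto simp: mult_single split: if_splits)
  qed simp
  show ?thesis
    unfolding mp.dependent_def
  proof safe
    fix m assume "m \<in> A"
      "single m 1 \<in> mp.span ((\<lambda>m. single m (1 :: 'k)) ` A - {single m 1})"
    moreover have "(\<lambda>m. single m (1 :: 'k)) ` A - {single m 1} \<subseteq> (\<lambda>m. single m 1) ` (A - {m})"
      by auto
    ultimately have "single m 1 \<in> mp.span ((\<lambda>m. single m (1 :: 'k)) ` (A - {m}))"
      using mp.span_mono by blast
    then have "keys (single m (1 :: 'k)) \<subseteq> A - {m}" by (rule sub)
    then show False by simp
  qed
qed

section \<open>Marked paths, the dimension of the fiber ring and the largest corner sets\<close>

context ferrers
begin

text \<open>Indices of the expected basis in degree \<open>k\<close>: the corners \<open>S\<close>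
  of a path times a monomial \<open>\<mu>\<close> in the parameters, one parameter for each
  colour.\<close>

definition marked_paths :: "nat \<Rightarrow> ((nat \<times> nat) set \<times> int multiset) set" where
  "marked_paths k = {(S, \<mu>). S \<in> corner_sets (card S) \<and> set_mset \<mu> \<subseteq> colours \<and> card S + size \<mu> = k}"

text \<open>Each parameter is replaced by the cell where the path meets its diagonal, which turns an
  index into a chain supported on the path.\<close>

definition chain_of :: "(nat \<times> nat) set \<times> int multiset \<Rightarrow> (nat \<times> nat) multiset" where
  "chain_of = (\<lambda>(S, \<mu>). mset_set S + image_mset (path_cell S) \<mu>)"

lemma corner_setsD:
  assumes "S \<in> corner_sets k"
  shows "finite S" "S \<subseteq> cells" "card S = k" "z \<in> S \<Longrightarrow> 2 \<le> fst z" "z \<in> S \<Longrightarrow> 2 \<le> snd z"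
    "\<forall>z\<in>S. \<forall>z'\<in>S. z \<noteq> z' \<longrightarrow> fst z < fst z' \<and> snd z' < snd z \<or> fst z' < fst z \<and> snd z < snd z'"
  using assms finite_subset[OF _ finite_cells, of S] by (auto simp: corner_sets_def)

lemma corner_path_cell: "S \<in> corner_sets k \<Longrightarrow> z \<in> S \<Longrightarrow> path_cell S (colour z) = z"
  using path_row_corner(1)[of S z] corner_setsD[of S k] by (simp add: path_cell_def prod_eq_iff)

lemma path_cell_in_cells:
  assumes S: "S \<in> corner_sets k" and c: "c \<in> colours"
  shows "path_cell S c \<in> cells"
proof -
  note fin = corner_setsD(1)[OF S]
  consider "path_row S c = 1" | "path_row S c = 1 - c"
    | z where "z \<in> S" "path_row S c = min (int (fst z)) (int (snd z) - c)"
    using path_row_cases[OF fin] by blast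
  then show ?thesis
  proof cases
    case 1
    then have "path_cell S c = (1, nat (1 + c))" "0 \<le> c" using path_row_ge[OF fin, of c] by (auto simp: path_cell_def)
    then show ?thesis using c n_pos by (auto simp: colours_def intro!: cellsI)
  next
    case 2
    then have "path_cell S c = (nat (1 - c), 1)" "c \<le> 0" using path_row_ge[OF fin, of c] by (auto simp: path_cell_def)
    moreover then have "1 \<le> nat (1 - c)" "nat (1 - c) \<le> n" using c n_pos by (auto simp: colours_def)
    ultimately show ?thesis using lam_pos[of "nat (1 - c)"] by (auto intro!: cellsI)
  next
    case 3
    have z: "(fst z, snd z) \<in> cells" using 3 corner_setsD[OF S] by auto
    show ?thesis unfolding path_cell_def
      by (rule cells_down[OF z]) (use 3 path_row_ge[OF fin, of c] in auto)
  qed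
qed

lemma chain_of_props:
  assumes "(S, \<mu>) \<in> marked_paths k"
  shows "chain_of (S, \<mu>) \<in> cellmons k" "set_mset (chain_of (S, \<mu>)) \<subseteq> range (path_cell S)"
    "chain (chain_of (S, \<mu>))"
proof -
  have S: "S \<in> corner_sets (card S)" and m: "set_mset \<mu> \<subseteq> colours" "card S + size \<mu> = k"
    using assms by (auto simp: marked_paths_def)
  note SD = corner_setsD[OF S]
  show "chain_of (S, \<mu>) \<in> cellmons k"
    using SD m path_cell_in_cells[OF S] by (auto simp: chain_of_def cellmons_def)
  have "S \<subseteq> range (path_cell S)" using corner_path_cell[OF S] by (metis rangeI subsetI)
  then show *: "set_mset (chain_of (S, \<mu>)) \<subseteq> range (path_cell S)"
    using SD by (auto simp: chain_of_def)
  show "chain (chain_of (S, \<mu>))"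
    unfolding chain_def using * path_cells_chain[OF SD(1)] by blast
qed

lemma path_row_chain_of:
  assumes "(S, \<mu>) \<in> marked_paths k"
  shows "path_row (set_mset (chain_of (S, \<mu>))) c = path_row S c"
proof -
  have "finite S" using assms corner_setsD(1) by (auto simp: marked_paths_def)
  then show ?thesis using chain_of_props(2)[OF assms]
    by (intro path_row_cong) (auto simp: chain_of_def)
qed

text \<open>The support of the chain has the same path as \<open>S\<close>, the path determines its
  corners, and the colours of the remaining cells give back \<open>\<mu>\<close>.\<close>

lemma inj_on_chain_of: "inj_on chain_of (marked_paths k)"
proof (rule inj_onI, clarify)
  fix S \<mu> T \<nu>
  assume S: "(S, \<mu>) \<in> marked_paths k" and T: "(T, \<nu>) \<in> marked_paths k" and eq: "chain_of (S, \<mu>) = chain_of (T, \<nu>)"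
  have S': "S \<in> corner_sets (card S)" and T': "T \<in> corner_sets (card T)" using S T by (auto simp: marked_paths_def)
  note SD = corner_setsD[OF S'] and TD = corner_setsD[OF T']
  have row: "path_row S = path_row T"
    using path_row_chain_of[OF S] path_row_chain_of[OF T] eq by auto
  have "S \<subseteq> T"
  proof
    fix z assume z: "z \<in> S"
    from path_row_corner[OF SD(1,6) z SD(4,5)[OF z]] show "z \<in> T"
      unfolding row by (rule corner_of_path[OF TD(1)])
  qed
  moreover have "T \<subseteq> S"
  proof
    fix z assume z: "z \<in> T"
    from path_row_corner[OF TD(1,6) z TD(4,5)[OF z]] show "z \<in> S"
      unfolding row[symmetric] by (rule corner_of_path[OF SD(1)])
  qed
  ultimately have ST: "S = T" by blast
  then have "image_mset (path_cell S) \<mu> = image_mset (path_cell S) \<nu>" using eq by (simp add: chain_of_def)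
  then have "image_mset colour (image_mset (path_cell S) \<mu>) = image_mset colour (image_mset (path_cell S) \<nu>)" by simp
  then have "\<mu> = \<nu>" using colour_path_cell[OF SD(1)] by (simp add: multiset.map_comp comp_def)
  with ST show "S = T \<and> \<mu> = \<nu>" by blast
qed

lemma finite_marked_paths: "finite (marked_paths k)"
  by (rule inj_on_finite[OF inj_on_chain_of _ finite_cellmons]) (use chain_of_props(1) in force)

text \<open>The lower bound for the dimension: distinct chains have distinct exponents, and distinct
  monomials are linearly independent.\<close>

lemma card_marked_paths_le:
  assumes "finite T" "fiber k \<subseteq> mp.span (T :: 'k::field mpoly set)"
  shows "card (marked_paths k) \<le> card T"
proof -
  let ?f = "\<lambda>x. cmon (chain_of x) :: 'k mpoly"
  have "inj_on ?f (marked_paths k)"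
  proof (rule inj_onI)
    fix x y assume x: "x \<in> marked_paths k" and y: "y \<in> marked_paths k" and "?f x = ?f y"
    then have "keys (?f x) = keys (?f y)" by simp
    then have "expo (chain_of x) = expo (chain_of y)" by (simp add: cmon_def)
    then have "chain_of x = chain_of y"
      using x y chain_of_props(3) by (cases x, cases y) (auto intro: chain_expo_inj)
    then show "x = y" using x y inj_on_chain_of[of k] by (auto dest: inj_onD)
  qed
  then have "card (marked_paths k) = card (?f ` marked_paths k)" by (simp add: card_image)
  moreover have "mp.independent (?f ` marked_paths k)"
    using independent_monomials[of "(expo \<circ> chain_of) ` marked_paths k"] by (simp add: cmon_def image_image)
  moreover have "?f ` marked_paths k \<subseteq> mp.span T"
    using assms(2) chain_of_props(1) unfolding fiber_def by (force intro: mp.span_base)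
  ultimately show ?thesis using mp.independent_span_bound[OF assms(1)] by simp
qed

text \<open>The subtraction is never truncated here, since \<open>2 \<le> i\<close> and
  \<open>lam i\<close> is positive.\<close>

abbreviation "red_bound \<equiv> Min (insert (n - 1) {lam i + i - 3 | i. 2 \<le> i \<and> i \<le> n})"

lemma le_red_bound_iff: "k \<le> red_bound \<longleftrightarrow> k \<le> n - 1 \<and> (\<forall>i. 2 \<le> i \<and> i \<le> n \<longrightarrow> k \<le> lam i + i - 3)"
  by (subst Min_ge_iff) auto

lemma corner_sets_nonempty:
  assumes "k \<le> red_bound"
  shows "corner_sets k \<noteq> {}"
proof -
  \<comment> \<open>An antidiagonal from row 2 to column 2; the condition on \<open>lam i\<close>
    says exactly that its cell in row \<open>i\<close> fits into the diagram.\<close>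
  let ?S = "(\<lambda>i. (i, k + 3 - i)) ` {2..k + 1}"
  have "?S \<subseteq> cells"
  proof safe
    fix i assume i: "i \<in> {2..k + 1}"
    then have "i \<le> n" "k \<le> lam i + i - 3" using assms n_pos unfolding le_red_bound_iff by auto
    moreover have "0 < lam i" using lam_pos[of i] i \<open>i \<le> n\<close> by simp
    ultimately show "(i, k + 3 - i) \<in> cells" using i by (intro cellsI) auto
  qed
  moreover have "card ?S = k" by (subst card_image) (auto simp: inj_on_def)
  ultimately have "?S \<in> corner_sets k" unfolding corner_sets_def by (auto simp: linorder_neq_iff)
  then show ?thesis by blast
qed

text \<open>Corners have distinct rows and distinct columns. Above row \<open>i\<close> they use
  rows 2 to \<open>i - 1\<close>, and from row \<open>i\<close> on they use columns 2 to
  \<open>lam i\<close>, which gives \<open>(i - 2) + (lam i - 1)\<close>.\<close>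

lemma corner_sets_empty:
  assumes "red_bound < k"
  shows "corner_sets k = {}"
proof (rule ccontr)
  assume "corner_sets k \<noteq> {}"
  then obtain S where S: "S \<in> corner_sets k" by blast
  note SD = corner_setsD[OF S]
  have inj: "inj_on fst S" "inj_on snd S" using SD(6) by (auto simp: inj_on_def) (metis fst_conv snd_conv less_irrefl)+
  have cl: "(fst z, snd z) \<in> cells" if "z \<in> S" for z using SD(2) that by auto
  have "k \<le> n - 1"
  proof -
    have "card (fst ` S) \<le> card {2..n}" using SD(4) cells_le[OF cl] by (intro card_mono) auto
    then show ?thesis using SD(3) inj by (simp add: card_image)
  qed
  moreover have "k \<le> lam i + i - 3" if i: "2 \<le> i" "i \<le> n" for i
  proof -
    let ?A = "{z \<in> S. fst z < i}" and ?B = "{z \<in> S. i \<le> fst z}"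
    have "card (fst ` ?A) \<le> card {2..<i}" using SD(4) by (intro card_mono) auto
    then have A: "card ?A \<le> i - 2" using inj_on_subset[OF inj(1), of ?A] by (simp add: card_image)
    have "snd ` ?B \<subseteq> {2..lam i}"
    proof safe
      fix a b assume "(a, b) \<in> S" "i \<le> fst (a, b)"
      then show "snd (a, b) \<in> {2..lam i}"
        using SD(5)[of "(a, b)"] cells_le[OF cl[of "(a, b)"]] lam_noninc[of i a] i by auto
    qed
    then have "card (snd ` ?B) \<le> card {2..lam i}" by (intro card_mono) auto
    then have B: "card ?B \<le> lam i - 1" using inj_on_subset[OF inj(2), of ?B] by (simp add: card_image)
    have "card S = card ?A + card ?B"
      using SD(1) by (subst card_Un_disjoint[symmetric]) (auto intro: arg_cong[of _ _ card])
    then show ?thesis using A B SD(3) i lam_pos[of i] by linarith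
  qed
  ultimately have "k \<le> red_bound" unfolding le_red_bound_iff by blast
  with assms show False by linarith
qed

lemma card_marked_paths_less:
  assumes "corner_sets k \<noteq> {}"
  shows "card {x \<in> marked_paths k. card (fst x) < k} < card (marked_paths k)"
proof (rule psubset_card_mono[OF finite_marked_paths])
  obtain S where S: "S \<in> corner_sets k" using assms by blast
  then have "card S = k" by (simp add: corner_setsD)
  then have "(S, {#}) \<in> marked_paths k" using S by (simp add: marked_paths_def)
  then show "{x \<in> marked_paths k. card (fst x) < k} \<subset> marked_paths k"
    using \<open>card S = k\<close> by force
qed

end

section \<open>Generic systems of linear forms\<close>

context vector_space
begin

text \<open>The index \<open>a\<close> is itself the eigenvalue, so distinct indices are distinct
  eigenvalues.\<close>

lemma eigenvectors_independent:
  assumes T: "Vector_Spaces.linear scale scale T" and fin: "finite A"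
    and e: "\<And>a. a \<in> A \<Longrightarrow> e a \<noteq> 0 \<and> T (e a) = a *s e a"
  shows "inj_on e A \<and> independent (e ` A)"
  using fin e
proof (induction A rule: finite_induct)
  case (insert a F)
  interpret T: Vector_Spaces.linear scale scale T by (rule T)
  have inj: "inj_on e F" and ind: "independent (e ` F)" using insert by auto
  have "e a \<notin> span (e ` F)"
  proof
    assume "e a \<in> span (e ` F)"
    then obtain w where "e a = (\<Sum>x\<in>e ` F. w x *s x)" using insert(1) by (auto simp: span_finite)
    then have ea: "e a = (\<Sum>b\<in>F. w (e b) *s e b)" using inj by (simp add: sum.reindex)
    have "T (e a) = (\<Sum>b\<in>F. w (e b) *s (b *s e b))"
      unfolding ea T.sum T.scale using insert by (intro sum.cong) auto
    moreover have "T (e a) = (\<Sum>b\<in>F. a *s (w (e b) *s e b))"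
      using insert.prems[of a] by (simp add: ea scale_sum_right)
    ultimately have "0 = (\<Sum>b\<in>F. w (e b) *s (b *s e b) - a *s (w (e b) *s e b))"
      by (simp add: sum_subtractf)
    also have "\<dots> = (\<Sum>b\<in>F. (w (e b) * (b - a)) *s e b)"
      by (intro sum.cong) (simp_all add: algebra_simps)
    also have "\<dots> = (\<Sum>x\<in>e ` F. (w x * (the_inv_into F e x - a)) *s x)"
      using inj by (simp add: sum.reindex the_inv_into_f_f)
    finally have 0: "(\<Sum>x\<in>e ` F. (w x * (the_inv_into F e x - a)) *s x) = 0" by simp
    have "w (e b) = 0" if "b \<in> F" for b
    proof -
      have "w (e b) * (the_inv_into F e (e b) - a) = 0"
        using independentD[OF ind _ subset_refl 0] insert(1) that by blast
      moreover have "b \<noteq> a" using that insert(2) by auto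
      ultimately show ?thesis using inj that by (simp add: the_inv_into_f_f)
    qed
    then have "e a = 0" by (simp add: ea)
    then show False using insert.prems by blast
  qed
  then have "e a \<notin> e ` F" "independent (insert (e a) (e ` F))"
    using independent_insertI[OF _ ind] span_superset[of "e ` F"] by auto
  then show ?case using inj by auto
qed (simp add: independent_empty)

lemma independent_card_spans:
  assumes "finite B" "independent S" "S \<subseteq> span B" "card B \<le> card S"
  shows "B \<subseteq> span S"
proof
  fix b assume b: "b \<in> B"
  show "b \<in> span S"
  proof (rule ccontr)
    assume nb: "b \<notin> span S"
    have "finite (insert b S) \<and> card (insert b S) \<le> card B"
      using assms b nb by (intro independent_span_bound independent_insertI) (auto intro: span_base)
    moreover have "b \<notin> S" using nb span_base by blast
    ultimately show False using assms(4) by auto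
  qed
qed

text \<open>A bad parameter \<open>t\<close> yields an eigenvector of a fixed linear map for the eigenvalue \<open>-1/t\<close>, so there
  are at most as many of them as the dimension.\<close>

lemma finite_non_spanning_parameters:
  assumes "finite A" and q: "q ` A \<subseteq> span (p ` A)"
  shows "finite {t. \<not> p ` A \<subseteq> span ((\<lambda>a. p a + t *s q a) ` A)}" (is "finite ?bad")
proof -
  interpret vp: vector_space_pair scale scale ..
  obtain B where B: "B \<subseteq> p ` A" "independent B" "p ` A \<subseteq> span B"
    using maximal_independent_subset by blast
  have finB: "finite B" using B(1) assms(1) finite_surj by blast
  define g where "g b = (SOME a. a \<in> A \<and> p a = b)" for b
  have g: "g b \<in> A \<and> p (g b) = b" if "b \<in> B" for b
    unfolding g_def by (rule someI_ex) (use B(1) that in blast)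
  obtain T where T: "Vector_Spaces.linear scale scale T" "\<And>b. b \<in> B \<Longrightarrow> T b = q (g b)"
    using vp.linear_independent_extend[OF B(2), of "\<lambda>b. q (g b)"] by blast
  interpret T: Vector_Spaces.linear scale scale T by (rule T)
  have spanB: "span (p ` A) \<subseteq> span B" using B(3) span_minimal by blast
  have ex: "\<exists>e. e \<in> span B \<and> e \<noteq> 0 \<and> t \<noteq> 0 \<and> T e = (- 1 / t) *s e" if "t \<in> ?bad" for t
  proof (rule ccontr)
    assume no: "\<not> ?thesis"
    \<comment> \<open>Without such an eigenvector \<open>L\<close> is injective on the span of
      \<open>B\<close>; it then maps \<open>B\<close> to another basis of it, made of perturbed
      generators.\<close>
    define L where "L x = x + t *s T x" for x
    have L: "Vector_Spaces.linear scale scale L"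
      unfolding L_def by unfold_locales (simp_all add: T.add T.scale algebra_simps)
    interpret L: Vector_Spaces.linear scale scale L by (rule L)
    have "inj_on L (span B)"
    proof (rule inj_onI)
      fix x y assume xy: "x \<in> span B" "y \<in> span B" "L x = L y"
      then have 0: "(x - y) + t *s T (x - y) = 0" unfolding L_def by (simp add: T.diff algebra_simps)
      show "x = y"
      proof (rule ccontr)
        assume ne: "x \<noteq> y"
        then have t: "t \<noteq> 0" using 0 by auto
        have 1: "t *s T (x - y) = - (x - y)" using 0 by (simp only: add_eq_0_iff)
        have "T (x - y) = (1 / t) *s (t *s T (x - y))" using t by simp
        also have "\<dots> = (- 1 / t) *s (x - y)" unfolding 1 scale_minus_right scale_minus_left[symmetric] by simp
        finally have "T (x - y) = (- 1 / t) *s (x - y)" .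
        moreover have "x - y \<in> span B" "x - y \<noteq> 0" using xy ne by (auto intro: span_diff)
        ultimately show False using no t by blast
      qed
    qed
    then have indL: "independent (L ` B)" and injL: "inj_on L B"
      using L.independent_injective_image[OF B(2)] inj_on_subset[OF _ span_superset] by blast+
    have LB: "L ` B \<subseteq> span B"
    proof safe
      fix b assume b: "b \<in> B"
      then have "q (g b) \<in> span B" using q spanB g by blast
      then show "L b \<in> span B" unfolding L_def T(2)[OF b] using b by (intro span_add span_scale) (auto intro: span_base)
    qed
    have BL: "B \<subseteq> span (L ` B)"
      by (rule independent_card_spans[OF finB indL LB]) (simp add: card_image[OF injL])
    have sub: "L ` B \<subseteq> (\<lambda>a. p a + t *s q a) ` A" 
    proof safe
      fix b assume b: "b \<in> B"
      then show "L b \<in> (\<lambda>a. p a + t *s q a) ` A"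
        using g[OF b] by (intro image_eqI[of _ _ "g b"]) (auto simp: L_def T(2))
    qed
    have "B \<subseteq> span ((\<lambda>a. p a + t *s q a) ` A)" using BL span_mono[OF sub] by (rule subset_trans)
    then have "span B \<subseteq> span ((\<lambda>a. p a + t *s q a) ` A)" by (intro span_minimal subspace_span)
    then show False using B(3) that by blast
  qed
  have bound: "card F \<le> card B" if F: "finite F" "F \<subseteq> ?bad" for F
  proof -
    define e where "e t = (SOME e. e \<in> span B \<and> e \<noteq> 0 \<and> t \<noteq> 0 \<and> T e = (- 1 / t) *s e)" for t
    have e: "e t \<in> span B \<and> e t \<noteq> 0 \<and> t \<noteq> 0 \<and> T (e t) = (- 1 / t) *s e t" if "t \<in> F" for t
      unfolding e_def by (rule someI_ex, rule ex) (use F(2) that in blast)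
    \<comment> \<open>An involution, also at 0, which allows the eigenvectors to be indexed by their
      eigenvalues.\<close>
    define h where "h t = - 1 / t" for t :: 'a
    have hh: "h (h t) = t" for t by (simp add: h_def)
    have ind: "inj_on (\<lambda>a. e (h a)) (h ` F) \<and> independent ((\<lambda>a. e (h a)) ` h ` F)"
      by (rule eigenvectors_independent[OF T(1)]) (use F(1) e hh in \<open>auto simp: h_def\<close>)
    have "inj_on e F"
    proof (rule inj_onI)
      fix x y assume "x \<in> F" "y \<in> F" "e x = e y"
      then have "h x = h y" using ind by (auto simp: hh dest!: inj_onD[of _ _ "h x" "h y"])
      then show "x = y" by (metis hh)
    qed
    moreover have "independent (e ` F)" using ind by (simp add: image_image hh)
    ultimately show ?thesis using independent_span_bound[OF finB, of "e ` F"] e by (auto simp: card_image)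
  qed
  show ?thesis
  proof (rule ccontr)
    assume "infinite ?bad"
    then obtain F where "finite F" "card F = Suc (card B)" "F \<subseteq> ?bad"
      using infinite_arbitrarily_large by blast
    then show False using bound by fastforce
  qed
qed

end

lemma mp_span_mult:
  "x \<in> mp.span S \<Longrightarrow> v * x \<in> mp.span ((*) v ` S)"
proof (induction rule: mp.span_induct_alt)
  case (step c x y)
  then have "single 0 c * (v * x) + v * y \<in> mp.span ((*) v ` S)"
    by (intro mp.span_add mp.span_scale mp.span_base[of "v * x"]) auto
  then show ?case by (simp add: algebra_simps)
qed (simp add: mp.span_zero)

lemma mp_span_mult_subset:
  "x \<in> mp.span S \<Longrightarrow> (\<And>s. s \<in> S \<Longrightarrow> v * s \<in> mp.span T) \<Longrightarrow> v * x \<in> mp.span T"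
  using mp_span_mult[of x S v] mp.span_minimal[of "(*) v ` S" "mp.span T"] by blast

lemma mp_span_trans: "S \<subseteq> mp.span T \<Longrightarrow> x \<in> mp.span S \<Longrightarrow> x \<in> mp.span T"
  using mp.span_minimal[of S "mp.span T"] by blast

context ferrers
begin

lemma fiber_mult:
  assumes "v \<in> (fiber k :: 'a::field mpoly set)" "N \<in> cellmons l"
  shows "v * cmon N \<in> fiber (k + l)"
proof -
  have "cmon N * v \<in> fiber (k + l)"
    unfolding fiber_def
  proof (rule mp_span_mult_subset[OF assms(1)[unfolded fiber_def]])
    fix s :: "'a mpoly" assume "s \<in> cmon ` cellmons k"
    then obtain M where "s = cmon M" "M \<in> cellmons k" by blast
    then show "cmon N * s \<in> mp.span (cmon ` cellmons (k + l))"
      using assms(2) by (intro mp.span_base) (auto simp: cmon_union[symmetric] cellmons_def add.commute)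
  qed
  then show ?thesis by (simp add: mult.commute)
qed

text \<open>Every monomial of the next degree is a cell times a monomial for which the claim is
  known.\<close>

lemma mult_span_step:
  assumes "fiber (Suc r) \<subseteq> mult_span V r" "r \<le> s"
  shows "fiber (Suc s) \<subseteq> mult_span V s"
  using assms(2)
proof (induction rule: dec_induct)
  case (step s)
  have "cmon M \<in> mult_span V (Suc s)" if M: "M \<in> cellmons (Suc (Suc s))" for M
  proof -
    obtain z N where zN: "M = add_mset z N" "z \<in> cells" "N \<in> cellmons (Suc s)"
      using M cellmons_Suc[of M "Suc s"] by blast
    then have "cmon N \<in> mult_span V s" using step.IH by (auto simp: fiber_def intro: mp.span_base)
    then have "xy (fst z) (snd z) * cmon N \<in> mult_span V (Suc s)"
      unfolding mult_span_def
    proof (rule mp_span_mult_subset)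
      fix p assume "p \<in> {v * cmon N |v N. v \<in> V \<and> N \<in> cellmons s}"
      then obtain v N' where p: "p = v * cmon N'" "v \<in> V" "N' \<in> cellmons s" by blast
      have "xy (fst z) (snd z) * p = v * cmon (add_mset z N')" by (simp add: p cmon_add_mset mult.left_commute)
      then show "xy (fst z) (snd z) * p \<in> mp.span {v * cmon N |v N. v \<in> V \<and> N \<in> cellmons (Suc s)}"
        using p(2,3) zN(2) by (intro mp.span_base) (auto simp: cellmons_def intro!: exI[of _ v] exI[of _ "add_mset z N'"])
    qed
    then show ?thesis using zN by (simp add: cmon_add_mset)
  qed
  then show ?case unfolding fiber_def mult_span_def
    by (intro mp.span_minimal mp.subspace_span) auto
qed (rule assms(1))

lemma diag_fiber: "diag c \<in> (fiber 1 :: 'k::field mpoly set)"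
proof -
  have "xy (fst z) (snd z) \<in> (fiber 1 :: 'k mpoly set)" if "z \<in> dcells c" for z
    using that unfolding fiber_def
    by (intro mp.span_base image_eqI[of _ _ "{#z#}"]) (auto simp: cmon_single dcells_def cellmons_def)
  then show ?thesis unfolding diag_def fiber_def by (intro mp.span_sum)
qed

lemma finite_colours: "finite colours" and card_colours: "card colours = n + lam 1 - 1"
  using n_pos lam_pos[of 1] by (auto simp: colours_def)

text \<open>Moving \<open>u\<close> along a line towards \<open>w\<close> changes the generators
  linearly in \<open>t\<close>, with a direction that stays in the fiber ring, so
  \<open>finite_non_spanning_parameters\<close> applies. The generators in \<open>B\<close> stay
  fixed; the disjoint sum keeps coinciding products apart.\<close>

lemma affine_spanning:
  fixes u w :: "int \<Rightarrow> 'k::field mpoly"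
  assumes uw: "\<And>c. c \<in> colours \<Longrightarrow> w c - u c \<in> fiber 1" and B: "finite B"
    and fib: "fiber (Suc j) \<subseteq> mp.span ({u c * cmon N | c N. c \<in> colours \<and> N \<in> cellmons j} \<union> B)"
  shows "finite {t. \<not> fiber (Suc j) \<subseteq> mp.span
    ({(u c + single 0 t * (w c - u c)) * cmon N | c N. c \<in> colours \<and> N \<in> cellmons j} \<union> B)}"
    (is "finite ?bad")
proof -
  define A where "A = Inl ` (colours \<times> cellmons j) \<union> Inr ` B"
  define p :: "(int \<times> (nat \<times> nat) multiset) + 'k mpoly \<Rightarrow> 'k mpoly"
    where "p = case_sum (\<lambda>(c, N). u c * cmon N) id"
  define q :: "(int \<times> (nat \<times> nat) multiset) + 'k mpoly \<Rightarrow> 'k mpoly"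
    where "q = case_sum (\<lambda>(c, N). (w c - u c) * cmon N) (\<lambda>_. 0)"
  have finA: "finite A" unfolding A_def using B by (auto simp: finite_colours finite_cellmons)
  have pA: "p ` A = {u c * cmon N | c N. c \<in> colours \<and> N \<in> cellmons j} \<union> B"
    unfolding A_def p_def by (auto simp: image_Un image_image)
  have pqA: "(\<lambda>a. p a + single 0 t * q a) ` A =
    {(u c + single 0 t * (w c - u c)) * cmon N | c N. c \<in> colours \<and> N \<in> cellmons j} \<union> B" for t
  proof -
    have "(\<lambda>a. p a + single 0 t * q a) ` A =
        (\<lambda>(c, N). (u c + single 0 t * (w c - u c)) * cmon N) ` (colours \<times> cellmons j) \<union> B"
      by (simp add: A_def p_def q_def image_Un image_image distrib_right mult.assoc case_prod_unfold)
    then show ?thesis by auto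
  qed
  have "q ` A \<subseteq> mp.span (p ` A)"
  proof
    fix x assume "x \<in> q ` A"
    then consider "x = 0" | c N where "x = (w c - u c) * cmon N" "c \<in> colours" "N \<in> cellmons j"
      unfolding A_def q_def by auto
    then show "x \<in> mp.span (p ` A)"
      using fiber_mult[OF uw] fib unfolding pA by cases (auto simp: mp.span_zero)
  qed
  from mp.finite_non_spanning_parameters[OF finA this]
  have "finite {t. \<not> p ` A \<subseteq> mp.span ((\<lambda>a. p a + single 0 t * q a) ` A)}" .
  moreover have "fiber (Suc j) \<subseteq> mp.span T" if "p ` A \<subseteq> mp.span T" for T
    using mp_span_trans[OF that] fib unfolding pA by blast
  ultimately show ?thesis unfolding pqA by (rule_tac finite_subset[rotated]) auto
qed

lemma finite_corner_sets: "finite (corner_sets j)"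
  by (rule finite_subset[of _ "Pow cells"]) (auto simp: corner_sets_def finite_cells)

lemma mult_span_image: "mult_span (f ` A) k = mp.span {f c * cmon N | c N. c \<in> A \<and> N \<in> cellmons k}"
  unfolding mult_span_def by (rule arg_cong[of _ _ mp.span]) blast

text \<open>A line joins the diagonals, at parameter 0, to \<open>w\<close>, at parameter 1. One
  point outside finite exceptional sets inherits two properties: from the diagonals, that marked
  paths span up to degree \<open>k\<close>; from \<open>w\<close>, that degree \<open>Suc k\<close>
  needs no new generators. But \<open>red_bound\<close> corners are possible, so marked paths with
  fewer corners are too few to span that degree.\<close>

lemma reduction_lower_bound:
  fixes w :: "int \<Rightarrow> 'k::field mpoly"
  assumes inf: "infinite (UNIV :: 'k set)"
    and w: "\<And>c. c \<in> colours \<Longrightarrow> w c \<in> fiber 1"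
    and r: "fiber (Suc r) \<subseteq> mult_span (w ` colours) r"
  shows "red_bound \<le> r"
proof (rule ccontr)
  assume "\<not> red_bound \<le> r"
  then obtain k where k: "red_bound = Suc k" "r \<le> k" by (cases red_bound) auto
  define v where "v t c = diag c + single 0 t * (w c - diag c)" for t c
  let ?cor = "\<lambda>j. (\<lambda>S. cmon (mset_set S) :: 'k mpoly) ` corner_sets j"
  define bad where "bad j = {t. \<not> fiber (Suc j) \<subseteq> mp.span ({v t c * cmon N | c N. c \<in> colours \<and> N \<in> cellmons j} \<union> ?cor (Suc j))}" for j
  define badk where "badk = {t. \<not> fiber (Suc k) \<subseteq> mult_span (v t ` colours) k}"
  have wd: "w c - diag c \<in> fiber 1" "diag c - w c \<in> fiber 1" if "c \<in> colours" for c
    using mp.span_diff w[OF that] diag_fiber[of c] unfolding fiber_def by blast+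
  have "finite (bad j)" for j
    unfolding bad_def v_def
  proof (rule affine_spanning[OF wd(1)])
    show "finite (?cor (Suc j))" using finite_corner_sets by (rule finite_imageI)
    show "fiber (Suc j) \<subseteq> mp.span ({diag c * cmon N | c N. c \<in> colours \<and> N \<in> cellmons j} \<union> ?cor (Suc j))"
      unfolding fiber_def using cmon_straighten[of _ j] by (intro mp.span_minimal mp.subspace_span) auto
  qed
  then have "finite (\<Union>j<k. bad j)" by blast
  moreover have "finite badk"
  proof -
    have "fiber (Suc k) \<subseteq> mp.span ({w c * cmon N | c N. c \<in> colours \<and> N \<in> cellmons k} \<union> {})"
      using mult_span_step[OF r k(2)] by (simp add: mult_span_image)
    from affine_spanning[OF wd(2) finite.emptyI this]
    have "finite {t. \<not> fiber (Suc k) \<subseteq> mp.span {(w c + single 0 t * (diag c - w c)) * cmon N |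
        c N. c \<in> colours \<and> N \<in> cellmons k}}" (is "finite ?B") by simp
    \<comment> \<open>The previous finiteness is for the line that starts at \<open>w\<close>, whose
      parameter is \<open>1 - t\<close>.\<close>
    moreover have "w c + single 0 (1 - t) * (diag c - w c) = v t c" for t c
      by (simp add: v_def single_diff algebra_simps)
    then have "t \<in> badk \<Longrightarrow> 1 - t \<in> ?B" for t by (simp add: badk_def mult_span_image)
    then have "badk \<subseteq> (\<lambda>t. 1 - t) ` ?B" by (intro subsetI image_eqI[of _ _ "1 - _"]) auto
    ultimately show ?thesis using finite_imageI finite_subset by blast
  qed
  ultimately have "finite ((\<Union>j<k. bad j) \<union> badk)" by blast
  then obtain t where t: "t \<notin> (\<Union>j<k. bad j) \<union> badk" using inf ex_new_if_finite by blast
  \<comment> \<open>The candidate basis element of a marked path, with the generic forms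
    \<open>v t c\<close> in place of the diagonals.\<close>
  define G where "G = (\<lambda>(S, \<mu>). cmon (mset_set S) * (\<Prod>c\<in>#\<mu>. v t c))"
  have G_mult: "v t c * G (S, \<mu>) = G (S, add_mset c \<mu>)" for c S \<mu>
    by (simp add: G_def mult.left_commute)
  have G_step: "v t c * G x \<in> G ` {x \<in> marked_paths (Suc j). card (fst x) \<le> j}"
    if "c \<in> colours" "x \<in> marked_paths j" for c x j
    using that G_mult[of c "fst x" "snd x"]
    by (intro image_eqI[of _ _ "(fst x, add_mset c (snd x))"]) (auto simp: marked_paths_def split: prod.splits)
  have gen: "fiber j \<subseteq> mp.span (G ` marked_paths j)" if "j \<le> k" for j
    using that
  proof (induction j)
    case 0
    have "({}, {#}) \<in> marked_paths 0" by (simp add: marked_paths_def corner_sets_def)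
    then have "1 \<in> G ` marked_paths 0" by (intro image_eqI[of _ _ "({}, {#})"]) (auto simp: G_def)
    then show ?case
      unfolding fiber_def cellmons_0 by (intro mp.span_minimal mp.subspace_span) (auto intro: mp.span_base)
  next
    case (Suc j)
    have sub: "{v t c * cmon N | c N. c \<in> colours \<and> N \<in> cellmons j} \<union> ?cor (Suc j) \<subseteq> mp.span (G ` marked_paths (Suc j))"
    proof safe
      fix c N assume c: "c \<in> colours" and N: "N \<in> cellmons j"
      have "cmon N \<in> mp.span (G ` marked_paths j)"
        using Suc N by (auto simp: fiber_def intro: mp.span_base)
      then show "v t c * cmon N \<in> mp.span (G ` marked_paths (Suc j))"
        by (rule mp_span_mult_subset) (use G_step[OF c] in \<open>force intro: mp.span_base\<close>)
    next
      fix S assume S: "S \<in> corner_sets (Suc j)"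
      then have "(S, {#}) \<in> marked_paths (Suc j)" using corner_setsD(3)[OF S] by (simp add: marked_paths_def)
      then show "cmon (mset_set S) \<in> mp.span (G ` marked_paths (Suc j))"
        by (intro mp.span_base image_eqI[of _ _ "(S, {#})"]) (auto simp: G_def)
    qed
    have "fiber (Suc j) \<subseteq> mp.span ({v t c * cmon N | c N. c \<in> colours \<and> N \<in> cellmons j} \<union> ?cor (Suc j))"
      using t Suc.prems by (auto simp: bad_def)
    then show ?case using mp_span_trans[OF sub] by blast
  qed
  \<comment> \<open>A product with a factor \<open>v t c\<close> has at most \<open>k\<close>
    corners, so the marked paths with \<open>Suc k\<close> corners are missing.\<close>
  let ?P = "{x \<in> marked_paths (Suc k). card (fst x) < Suc k}"
  have sub: "{u * cmon N | u N. u \<in> v t ` colours \<and> N \<in> cellmons k} \<subseteq> mp.span (G ` ?P)"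
  proof safe
    fix c N assume c: "c \<in> colours" and N: "N \<in> cellmons k"
    have "cmon N \<in> mp.span (G ` marked_paths k)"
      using gen[of k] N by (auto simp: fiber_def intro: mp.span_base)
    then show "v t c * cmon N \<in> mp.span (G ` ?P)"
      by (rule mp_span_mult_subset) (use G_step[OF c, of _ k] in \<open>force intro: mp.span_base simp: less_Suc_eq_le\<close>)
  qed
  have "fiber (Suc k) \<subseteq> mult_span (v t ` colours) k" using t by (auto simp: badk_def)
  then have "fiber (Suc k) \<subseteq> mp.span (G ` ?P)"
    using mp_span_trans[OF sub] unfolding mult_span_def by blast
  then have "card (marked_paths (Suc k)) \<le> card (G ` ?P)"
    using finite_marked_paths by (intro card_marked_paths_le) auto
  also have "\<dots> \<le> card ?P" using finite_marked_paths by (intro card_image_le) auto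
  also have "\<dots> < card (marked_paths (Suc k))"
    by (intro card_marked_paths_less corner_sets_nonempty) (simp only: k(1))
  finally show False by simp
qed

end

section \<open>Noether normalization\<close>

text \<open>A version for families: a repeated vector gives the relation with coefficients 1 and -1,
  otherwise the image is too large to be independent.\<close>

lemma (in vector_space) linear_relation_exists:
  assumes "finite T" "finite S" "p ` T \<subseteq> span S" "card S < card T"
  obtains u where "\<exists>x\<in>T. u x \<noteq> 0" "(\<Sum>x\<in>T. u x *s p x) = 0"
proof (cases "inj_on p T")
  case True
  then have "card (p ` T) = card T" by (rule card_image)
  then have "dependent (p ` T)"
    using independent_span_bound[OF assms(2) _ assms(3)] assms(4) by force
  then obtain u x where u: "x \<in> p ` T" "u x \<noteq> 0" "(\<Sum>v\<in>p ` T. u v *s v) = 0"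
    using assms(1) by (auto simp: dependent_finite)
  then show ?thesis using True by (intro that[of "\<lambda>x. u (p x)"]) (auto simp: sum.reindex)
next
  case False
  then obtain x y where xy: "x \<in> T" "y \<in> T" "x \<noteq> y" "p x = p y" by (auto simp: inj_on_def)
  define u where "u z = (if z = x then 1 else if z = y then - 1 else 0 :: 'a)" for z
  have "(\<Sum>z\<in>T. u z *s p z) = (\<Sum>z\<in>{x, y}. u z *s p z)"
    by (rule sum.mono_neutral_right) (use assms(1) xy in \<open>auto simp: u_def\<close>)
  also have "\<dots> = 0" using xy by (simp add: u_def)
  finally show ?thesis using xy by (intro that[of u]) (auto simp: u_def intro!: bexI[of _ x])
qed

text \<open>A nonzero polynomial over an infinite field has a point where it does not vanish; its
  exponents are functions told apart by their first \<open>k\<close> values. By induction some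
  coefficient with respect to the last variable can be kept nonzero, and then finitely many roots
  are avoided.\<close>

lemma nonvanishing_point:
  fixes c :: "(nat \<Rightarrow> nat) \<Rightarrow> 'k::field"
  assumes inf: "infinite (UNIV :: 'k set)"
  shows "finite T \<Longrightarrow> inj_on (\<lambda>g. restrict g {..<k}) T \<Longrightarrow> g0 \<in> T \<Longrightarrow> c g0 \<noteq> 0
    \<Longrightarrow> \<exists>\<alpha>. (\<Sum>g\<in>T. c g * (\<Prod>i<k. \<alpha> i ^ g i)) \<noteq> 0"
proof (induction k arbitrary: T)
  case 0
  have "T = {g0}" using 0 by (auto simp: inj_on_def restrict_def)
  then show ?case using 0 by simp
next
  case (Suc k)
  define T' where "T' d = {g \<in> T. g k = d}" for d
  have "inj_on (\<lambda>g. restrict g {..<k}) (T' (g0 k))"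
  proof (rule inj_onI)
    fix g h assume g: "g \<in> T' (g0 k)" and h: "h \<in> T' (g0 k)" and eq: "restrict g {..<k} = restrict h {..<k}"
    have "restrict g {..<Suc k} = restrict h {..<Suc k}"
    proof
      fix i show "restrict g {..<Suc k} i = restrict h {..<Suc k} i"
        using fun_cong[OF eq, of i] g h by (auto simp: T'_def restrict_def less_Suc_eq split: if_splits)
    qed
    then show "g = h" by (rule inj_onD[OF Suc.prems(2)]) (use g h in \<open>auto simp: T'_def\<close>)
  qed
  moreover have "finite (T' (g0 k))" "g0 \<in> T' (g0 k)" using Suc.prems by (auto simp: T'_def)
  ultimately obtain \<alpha> where \<alpha>: "(\<Sum>g\<in>T' (g0 k). c g * (\<Prod>i<k. \<alpha> i ^ g i)) \<noteq> 0"
    using Suc.IH[of "T' (g0 k)"] Suc.prems(4) by blast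
  define P where "P = (\<Sum>g\<in>T. monom (c g * (\<Prod>i<k. \<alpha> i ^ g i)) (g k))"
  have "coeff P (g0 k) = (\<Sum>g\<in>T. if g k = g0 k then c g * (\<Prod>i<k. \<alpha> i ^ g i) else 0)"
    by (simp add: P_def coeff_sum)
  also have "\<dots> = (\<Sum>g\<in>T' (g0 k). c g * (\<Prod>i<k. \<alpha> i ^ g i))"
    using Suc.prems(1) by (simp add: T'_def sum.inter_filter)
  finally have "P \<noteq> 0" using \<alpha> by auto
  then have "finite {t. poly P t = 0}" by (rule poly_roots_finite)
  then obtain t where t: "poly P t \<noteq> 0" using inf ex_new_if_finite by blast
  have "poly P t = (\<Sum>g\<in>T. c g * (\<Prod>i<Suc k. (\<alpha>(k := t)) i ^ g i))"
    by (simp add: P_def poly_sum poly_monom mult.assoc)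
  with t show ?case by metis
qed

context ferrers
begin

lemma fiber_0: "fiber 0 = range (single 0)"
  by (auto simp: fiber_def cellmons_0 mp.span_singleton)

lemma fiber_mult_fiber:
  assumes "p \<in> fiber k" "q \<in> (fiber l :: 'k::field mpoly set)"
  shows "p * q \<in> fiber (k + l)"
  using assms(2) unfolding fiber_def[of l]
  by (rule mp_span_mult_subset[where T = "cmon ` cellmons (k + l)", folded fiber_def])
     (use fiber_mult[OF assms(1)] in auto)

lemma mult_span_mult_fiber:
  assumes "x \<in> mult_span W k" "p \<in> (fiber l :: 'k::field mpoly set)"
  shows "p * x \<in> mult_span W (k + l)"
  using assms(1) unfolding mult_span_def[of W k]
proof (rule mp_span_mult_subset[where T = "{v * cmon N | v N. v \<in> W \<and> N \<in> cellmons (k + l)}", folded mult_span_def])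
  fix s assume "s \<in> {v * cmon N |v N. v \<in> W \<and> N \<in> cellmons k}"
  then obtain v N where s: "s = v * cmon N" "v \<in> W" "N \<in> cellmons k" by blast
  have "p * cmon N \<in> fiber (l + k)" using assms(2) s(3) by (rule fiber_mult)
  then have "v * (p * cmon N) \<in> mult_span W (l + k)" by (rule mult_span_fiber[OF s(2)])
  then show "p * s \<in> mult_span W (k + l)" by (simp add: s(1) mult.left_commute add.commute)
qed

lemma mult_span_mono_span:
  assumes "V \<subseteq> mp.span W"
  shows "mult_span V k \<subseteq> mult_span W k"
  unfolding mult_span_def
proof (rule mp.span_minimal[OF _ mp.subspace_span], safe)
  fix v N assume v: "v \<in> V" and N: "N \<in> cellmons k"
  have "v \<in> mp.span W" using v assms by blast
  then have "cmon N * v \<in> mp.span {v * cmon N |v N. v \<in> W \<and> N \<in> cellmons k}"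
  proof (rule mp_span_mult_subset)
    fix s assume "s \<in> W"
    then show "cmon N * s \<in> mp.span {v * cmon N |v N. v \<in> W \<and> N \<in> cellmons k}"
      using N by (intro mp.span_base CollectI exI[of _ s] exI[of _ N]) (simp add: mult.commute)
  qed
  then show "v * cmon N \<in> mp.span {v * cmon N |v N. v \<in> W \<and> N \<in> cellmons k}"
    by (simp add: mult.commute)
qed

text \<open>In degree \<open>k\<close> the exponents of the \<open>X\<close> sum to
  \<open>k\<close>, and so do those of the \<open>Y\<close>, so the exponents of \<open>X 1\<close>
  and \<open>Y 1\<close> are determined by the others. The growth exponent
  \<open>n + lam 1 - 2\<close> corresponds to dimension \<open>n + lam 1 - 1\<close>.\<close>

lemma fiber_generators_bound:
  "card (cmon ` cellmons k :: 'k::field mpoly set) \<le> Suc k ^ (n + lam 1 - 2)"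
proof -
  let ?W = "X ` {2..n} \<union> Y ` {2..lam 1}"
  have "card (cmon ` cellmons k :: 'k mpoly set) \<le> card (expo ` cellmons k)"
    using card_image_le[of "expo ` cellmons k" "\<lambda>m. single m (1 :: 'k)"] finite_cellmons
    by (simp add: cmon_def image_image)
  also have "\<dots> \<le> card (PiE ?W (\<lambda>_. {..k}))"
  proof (rule card_inj_on_le[where f = "\<lambda>m. restrict (lookup m) ?W"])
    show "(\<lambda>m. restrict (lookup m) ?W) ` expo ` cellmons k \<subseteq> PiE ?W (\<lambda>_. {..k})"
      by (auto simp del: restrict_apply simp: cellmons_def lookup_expo_X lookup_expo_Y
          intro!: restrict_PiE_iff[THEN iffD2] size_filter_mset_lesseq)
    show "inj_on (\<lambda>m. restrict (lookup m) ?W) (expo ` cellmons k)"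
    proof (rule inj_onI, safe)
      fix M N assume M: "M \<in> cellmons k" and N: "N \<in> cellmons k"
        and eq: "restrict (lookup (expo M)) ?W = restrict (lookup (expo N)) ?W"
      have eqW: "lookup (expo M) v = lookup (expo N) v" if "v \<in> ?W" for v
        using fun_cong[OF eq, of v] that by simp
      have X: "(\<Sum>i=1..n. lookup (expo M) (X i)) = k" and Y: "(\<Sum>j=1..lam 1. lookup (expo M) (Y j)) = k"
        if M: "M \<in> cellmons k" for M
      proof -
        have "(\<Sum>i=1..n. lookup (expo M) (X i)) = size M \<and> (\<Sum>j=1..lam 1. lookup (expo M) (Y j)) = size M"
          if "set_mset M \<subseteq> cells" for M
          using that
        proof (induction M)
          case (add z M)
          have "(fst z, snd z) \<in> cells" using add by auto
          then show ?case using add cells_le[of "fst z" "snd z"]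
            by (auto simp: expo_add_mset lookup_add lookup_single when_def sum.distrib)
        qed simp
        with M show "(\<Sum>i=1..n. lookup (expo M) (X i)) = k" "(\<Sum>j=1..lam 1. lookup (expo M) (Y j)) = k"
          by (auto simp: cellmons_def)
      qed
      have "lookup (expo M) (X 1) = lookup (expo N) (X 1)"
      proof -
        have "(\<Sum>i=2..n. lookup (expo M) (X i)) = (\<Sum>i=2..n. lookup (expo N) (X i))"
          by (intro sum.cong) (use eqW in auto)
        then show ?thesis using X[OF M] X[OF N] n_pos by (simp add: sum.atLeast_Suc_atMost numeral_2_eq_2)
      qed
      moreover have "lookup (expo M) (Y 1) = lookup (expo N) (Y 1)"
      proof -
        have "(\<Sum>i=2..lam 1. lookup (expo M) (Y i)) = (\<Sum>i=2..lam 1. lookup (expo N) (Y i))"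
          by (intro sum.cong) (use eqW in auto)
        then show ?thesis using Y[OF M] Y[OF N] lam_pos[of 1] n_pos
          by (simp add: sum.atLeast_Suc_atMost numeral_2_eq_2)
      qed
      moreover have "lookup (expo M) v = lookup (expo N) v" if "v \<notin> ?W" "v \<noteq> X 1" "v \<noteq> Y 1" for v
      proof -
        have "v \<notin> ferrers_vars n lam"
          using that by (auto simp: ferrers_vars_def image_iff Suc_le_eq numeral_2_eq_2 le_Suc_eq)
        moreover have "keys (expo M) \<subseteq> ferrers_vars n lam" "keys (expo N) \<subseteq> ferrers_vars n lam"
          using M N by (auto simp: cellmons_def intro!: keys_expo)
        ultimately have "v \<notin> keys (expo M)" "v \<notin> keys (expo N)" by blast+
        then show ?thesis by (simp add: in_keys_iff)
      qed
      ultimately show "expo M = expo N" using eqW by (intro poly_mapping_eqI) blast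
    qed
    show "finite (PiE ?W (\<lambda>_. {..k}))" by (intro finite_PiE) auto
  qed
  also have "\<dots> = Suc k ^ card ?W" by (subst card_PiE) auto
  also have "card ?W = (n - 1) + (lam 1 - 1)"
    by (subst card_Un_disjoint) (auto simp: card_image inj_on_def)
  also have "\<dots> = n + lam 1 - 2" using n_pos lam_pos[of 1] by simp
  finally show ?thesis .
qed

lemma noether_step:
  fixes v :: "nat \<Rightarrow> 'k::field mpoly"
  assumes inf: "infinite (UNIV :: 'k set)"
    and v: "\<And>i. i \<le> e \<Longrightarrow> v i \<in> fiber 1"
    and e: "n + lam 1 - 1 \<le> e"
    and r: "fiber (Suc r) \<subseteq> mult_span (v ` {..e}) r"
  obtains b s where "fiber (Suc s) \<subseteq> mult_span ((\<lambda>i. v i - single 0 (b i) * v e) ` {..<e}) s"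
proof -
  let ?c = "single (0 :: var \<Rightarrow>\<^sub>0 nat) :: 'k \<Rightarrow> 'k mpoly"
  define D where "D = n + lam 1 - 2"
  have D: "Suc D \<le> e" using e n_pos lam_pos[of 1] by (simp add: D_def)
  \<comment> \<open>With this \<open>q\<close> the count is
    \<open>(Suc e * Suc q) ^ D = q * Suc q ^ D < Suc q ^ Suc D\<close>, so the monomials outnumber
    the spanning set.\<close>
  define q where "q = Suc e ^ D"
  define T0 where "T0 = PiE {..<e} (\<lambda>_. {..q})"
  \<comment> \<open>The exponents below \<open>e\<close> range freely over 0 to \<open>q\<close>,
    and the last one fills up to the common degree \<open>k\<close>. It is at least 1, so the
    relation vanishes wherever the last coordinate does; this later gives
    \<open>\<alpha> e \<noteq> 0\<close>.\<close>
  define ext where "ext g = (\<lambda>i. if i < e then g i else if i = e then Suc (e * q - (\<Sum>i<e. g i)) else 0)" for g :: "nat \<Rightarrow> nat"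
  define k where "k = Suc (e * q)"
  have T0: "finite T0" "card T0 = Suc q ^ e" unfolding T0_def by (auto simp: card_PiE intro: finite_PiE)
  have deg: "(\<Sum>i\<le>e. ext g i) = k" if "g \<in> T0" for g
  proof -
    have "(\<Sum>i<e. g i) \<le> (\<Sum>i<e. q)" using that by (intro sum_mono) (auto simp: T0_def)
    moreover have "(\<Sum>i\<le>e. ext g i) = (\<Sum>i<e. g i) + Suc (e * q - (\<Sum>i<e. g i))"
      by (simp add: lessThan_Suc_atMost[symmetric] ext_def)
    ultimately show ?thesis by (simp add: k_def)
  qed
  define p where "p g = (\<Prod>i\<le>e. v i ^ ext g i)" for g
  have pow: "v i ^ j \<in> fiber j" if "i \<le> e" for i j
    by (induction j) (use fiber_mult_fiber[OF v[OF that]] in \<open>auto simp: fiber_0 intro: range_eqI[of _ _ 1]\<close>)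
  have prodf: "(\<Prod>i\<in>A. v i ^ h i) \<in> fiber (\<Sum>i\<in>A. h i)" if "finite A" "A \<subseteq> {..e}" for A h
    using that
  proof (induction A)
    case (insert x F)
    then show ?case using fiber_mult_fiber[OF pow[of x "h x"], of "\<Prod>i\<in>F. v i ^ h i"] by simp
  qed (auto simp: fiber_0 intro: range_eqI[of _ _ 1])
  have "p ` T0 \<subseteq> mp.span (cmon ` cellmons k)"
    using prodf[of "{..e}"] deg unfolding p_def fiber_def by fastforce
  moreover have "card (cmon ` cellmons k :: 'k mpoly set) < card T0"
  proof -
    have "card (cmon ` cellmons k :: 'k mpoly set) \<le> Suc k ^ D"
      unfolding D_def by (rule fiber_generators_bound)
    also have "\<dots> \<le> (Suc e * Suc q) ^ D" using D by (intro power_mono) (auto simp: k_def)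
    also have "\<dots> = q * Suc q ^ D" by (simp only: power_mult_distrib q_def)
    also have "\<dots> < Suc q ^ Suc D" by simp
    also have "\<dots> \<le> Suc q ^ e" using D by (intro power_increasing) auto
    finally show ?thesis using T0 by simp
  qed
  ultimately obtain u where u: "\<exists>g\<in>T0. u g \<noteq> 0" "(\<Sum>g\<in>T0. ?c (u g) * p g) = 0"
    using mp.linear_relation_exists[of T0 "cmon ` cellmons k" p] T0 finite_cellmons by blast
  have ext_restrict: "restrict (ext g) {..<e} = g" if "g \<in> T0" for g
    using that by (intro ext) (auto simp: ext_def T0_def PiE_def extensional_def restrict_def)
  have inj_ext: "inj_on ext T0" 
    by (rule inj_on_inverseI[where g = "\<lambda>h. restrict h {..<e}"]) (rule ext_restrict)
  have "inj_on (\<lambda>h. restrict h {..<Suc e}) (ext ` T0)"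
  proof (rule inj_onI, safe)
    fix g h assume g: "g \<in> T0" and h: "h \<in> T0" and eq: "restrict (ext g) {..<Suc e} = restrict (ext h) {..<Suc e}"
    have "restrict (restrict (ext g) {..<Suc e}) {..<e} = restrict (restrict (ext h) {..<Suc e}) {..<e}"
      unfolding eq ..
    moreover have "{..<Suc e} \<inter> {..<e} = {..<e}" by auto
    ultimately have "g = h" using ext_restrict[OF g] ext_restrict[OF h] by (simp add: Int_commute)
    then show "ext g = ext h" by simp
  qed
  then obtain \<alpha> where "(\<Sum>h\<in>ext ` T0. u (restrict h {..<e}) * (\<Prod>i<Suc e. \<alpha> i ^ h i)) \<noteq> 0"
    using nonvanishing_point[OF inf, of "ext ` T0" "Suc e" _ "\<lambda>h. u (restrict h {..<e})"] T0(1) u(1) ext_restrict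
    by fastforce
  then have \<alpha>: "(\<Sum>g\<in>T0. u g * (\<Prod>i\<le>e. \<alpha> i ^ ext g i)) \<noteq> 0"
    using inj_ext ext_restrict by (simp add: sum.reindex lessThan_Suc_atMost)
  have \<alpha>e: "\<alpha> e \<noteq> 0"
  proof
    assume "\<alpha> e = 0"
    then have z: "(\<Prod>i\<le>e. \<alpha> i ^ ext g i) = 0" for g
      by (intro prod_zero bexI[of _ e]) (auto simp: ext_def)
    show False using \<alpha> unfolding z by simp
  qed
  \<comment> \<open>The point is rescaled so that its last coordinate becomes 1; by homogeneity the
    value stays nonzero.\<close>
  define b where "b i = \<alpha> i / \<alpha> e" for i
  define \<kappa> where "\<kappa> = (\<Sum>g\<in>T0. u g * (\<Prod>i\<le>e. b i ^ ext g i))"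
  have "(\<Prod>i\<le>e. b i ^ ext g i) = (\<Prod>i\<le>e. \<alpha> i ^ ext g i) / \<alpha> e ^ k" if "g \<in> T0" for g
    using deg[OF that] by (simp add: b_def power_divide prod_dividef power_sum[symmetric])
  then have "\<kappa> = (\<Sum>g\<in>T0. u g * (\<Prod>i\<le>e. \<alpha> i ^ ext g i)) / \<alpha> e ^ k"
    by (simp add: \<kappa>_def sum_divide_distrib)
  then have \<kappa>: "\<kappa> \<noteq> 0" using \<alpha> \<alpha>e by simp
  define w where "w i = v i - ?c (b i) * v e" for i
  \<comment> \<open>The part of degree \<open>j\<close> of the ideal generated by the forms
    \<open>w i\<close>; degree 0 is separate because \<open>mult_span\<close> raises the degree by
    one.\<close>
  define Wsp where "Wsp j = (case j of 0 \<Rightarrow> {0} | Suc l \<Rightarrow> mult_span (w ` {..<e}) l)" for j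
  have Wsub: "mp.subspace (Wsp j)" for j
    by (cases j) (simp_all add: Wsp_def mult_span_def mp.subspace_single_0)
  have Wmult: "y * x \<in> Wsp (j + l)" if "x \<in> Wsp j" "y \<in> fiber l" for x y j l
    using that mp.subspace_0[OF Wsub] mult_span_mult_fiber[of x "w ` {..<e}" _ y l]
    by (cases j) (auto simp: Wsp_def split: nat.split)
  \<comment> \<open>\<open>P\<close> of degree \<open>j\<close> is congruent to \<open>a\<close>
    times a power of \<open>v e\<close> modulo the \<open>w i\<close>; this is
    multiplicative.\<close>
  define Q where "Q P a j \<longleftrightarrow> P \<in> fiber j \<and> P - ?c a * v e ^ j \<in> Wsp j" for P a j
  have Qmult: "Q (P * P') (a * a') (j + j')" if Q: "Q P a j" "Q P' a' j'" for P a j P' a' j'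
  proof -
    have 1: "P * (P' - ?c a' * v e ^ j') \<in> Wsp (j' + j)" "?c a' * v e ^ j' * (P - ?c a * v e ^ j) \<in> Wsp (j + j')"
      using Q pow[of e j'] unfolding Q_def fiber_def by (auto intro!: Wmult mp.span_scale simp: fiber_def)
    have "P * P' - ?c (a * a') * v e ^ (j + j')
        = P * (P' - ?c a' * v e ^ j') + ?c a' * v e ^ j' * (P - ?c a * v e ^ j)"
      by (simp add: power_add algebra_simps mult_single[of 0 a 0 a', simplified, symmetric])
    moreover have "P * P' \<in> fiber (j + j')" using Q by (auto simp: Q_def intro: fiber_mult_fiber)
    moreover have "P * (P' - ?c a' * v e ^ j') + ?c a' * v e ^ j' * (P - ?c a * v e ^ j) \<in> Wsp (j + j')"
      using 1 by (intro mp.subspace_add[OF Wsub]) (simp_all add: add.commute)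
    ultimately show ?thesis unfolding Q_def by simp
  qed
  have Q1: "Q 1 1 0" by (auto simp: Q_def fiber_0 Wsp_def intro: range_eqI[of _ _ 1])
  have Qv: "Q (v i) (b i) 1" if "i \<le> e" for i
  proof (cases "i = e")
    case True
    then show ?thesis using v \<alpha>e mp.subspace_0[OF Wsub[of 1]] by (simp add: Q_def b_def)
  next
    case False
    then have "w i * cmon {#} \<in> mult_span (w ` {..<e}) 0"
      using that unfolding mult_span_def by (intro mp.span_base) (auto simp: cellmons_0)
    then show ?thesis using v[OF that] by (simp add: Q_def Wsp_def w_def)
  qed
  have Qpow: "Q (v i ^ l) (b i ^ l) l" if "i \<le> e" for i l
    by (induction l) (use Q1 Qmult[OF Qv[OF that]] in auto)
  have "Q (\<Prod>i\<in>A. v i ^ h i) (\<Prod>i\<in>A. b i ^ h i) (\<Sum>i\<in>A. h i)" if "finite A" "A \<subseteq> {..e}" for A h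
    using that by (induction A) (use Q1 Qpow Qmult in auto)
  then have Qp: "Q (p g) (\<Prod>i\<le>e. b i ^ ext g i) k" if "g \<in> T0" for g
    using deg[OF that] by (metis finite_atMost order_refl p_def)
  have "(\<Sum>g\<in>T0. ?c (u g) * (p g - ?c (\<Prod>i\<le>e. b i ^ ext g i) * v e ^ k)) \<in> Wsp k"
    by (intro mp.subspace_sum[OF Wsub] mp.subspace_scale[OF Wsub]) (use Qp in \<open>simp add: Q_def\<close>)
  also have "(\<Sum>g\<in>T0. ?c (u g) * (p g - ?c (\<Prod>i\<le>e. b i ^ ext g i) * v e ^ k)) = - (?c \<kappa> * v e ^ k)"
  proof -
    have c_sum: "?c (sum f A) = (\<Sum>a\<in>A. ?c (f a))" for f :: "(nat \<Rightarrow> nat) \<Rightarrow> 'k" and A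
      by (induction A rule: infinite_finite_induct) (auto simp: single_add)
    show ?thesis using u(2)
      by (simp add: right_diff_distrib sum_subtractf \<kappa>_def c_sum sum_distrib_right mult.assoc[symmetric] mult_single)
  qed
  finally have "?c (- inverse \<kappa>) * - (?c \<kappa> * v e ^ k) \<in> Wsp k"
    by (rule mp.subspace_scale[OF Wsub])
  also have "?c (- inverse \<kappa>) * - (?c \<kappa> * v e ^ k) = (?c (inverse \<kappa>) * ?c \<kappa>) * v e ^ k"
    by (simp add: single_uminus mult.assoc)
  also have "?c (inverse \<kappa>) * ?c \<kappa> = 1" using \<kappa> by (simp add: mult_single)
  finally have ve: "v e ^ k \<in> Wsp k" by simp
  \<comment> \<open>Repeated use of the hypothesis splits off \<open>j\<close> factors
    \<open>v i\<close>, whose product satisfies \<open>Q\<close>.\<close>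
  have gen: "fiber (j + r) \<subseteq> mp.span {P * y | P y. (\<exists>a. Q P a j) \<and> y \<in> fiber r}" for j
  proof (induction j)
    case 0
    show ?case
    proof
      fix y :: "'k mpoly" assume "y \<in> fiber (0 + r)"
      then show "y \<in> mp.span {P * y | P y. (\<exists>a. Q P a 0) \<and> y \<in> fiber r}"
        using Q1 by (intro mp.span_base CollectI exI[of _ 1] exI[of _ y]) auto
    qed
  next
    case (Suc j)
    let ?G = "\<lambda>j. {P * y | P y. (\<exists>a. Q P a j) \<and> y \<in> fiber r}"
    have sub: "{x * cmon N |x N. x \<in> v ` {..e} \<and> N \<in> cellmons (j + r)} \<subseteq> mp.span (?G (Suc j))"
    proof safe
      fix i N assume i: "i \<le> e" and N: "N \<in> cellmons (j + r)"
      have "cmon N \<in> mp.span (?G j)" using Suc N by (auto simp: fiber_def intro: mp.span_base)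
      then show "v i * cmon N \<in> mp.span (?G (Suc j))"
      proof (rule mp_span_mult_subset)
        fix s assume "s \<in> ?G j"
        then obtain P y a where s: "s = P * y" "Q P a j" "y \<in> fiber r" by blast
        have "Q (v i * P) (b i * a) (Suc j)" using Qmult[OF Qv[OF i] s(2)] by simp
        then show "v i * s \<in> mp.span (?G (Suc j))"
          using s by (intro mp.span_base) (auto simp: mult.assoc[symmetric])
      qed
    qed
    have "fiber (Suc j + r) \<subseteq> mult_span (v ` {..e}) (j + r)"
      using mult_span_step[OF r, of "j + r"] by simp
    then show ?case using mp_span_trans[OF sub] unfolding mult_span_def by blast
  qed
  have "{P * y | P y. (\<exists>a. Q P a k) \<and> y \<in> fiber r} \<subseteq> Wsp (k + r)"
  proof safe
    fix P y :: "'k mpoly" and a assume Q: "Q P a k" and y: "y \<in> fiber r"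
    have "(P - ?c a * v e ^ k) + ?c a * v e ^ k \<in> Wsp k"
      using Q ve unfolding Q_def by (intro mp.subspace_add[OF Wsub] mp.subspace_scale[OF Wsub]) auto
    then have "P \<in> Wsp k" by simp
    from Wmult[OF this y] show "P * y \<in> Wsp (k + r)" by (simp add: mult.commute)
  qed
  then have "mp.span {P * y | P y. (\<exists>a. Q P a k) \<and> y \<in> fiber r} \<subseteq> Wsp (k + r)"
    by (rule mp.span_minimal[OF _ Wsub])
  then have "fiber (Suc (e * q + r)) \<subseteq> mult_span (w ` {..<e}) (e * q + r)"
    using gen[of k] by (simp add: Wsp_def k_def)
  then show ?thesis unfolding w_def by (rule that)
qed

text \<open>Forms are eliminated one at a time until \<open>n + lam 1 - 1\<close> are left, or zeros
  are added if there are fewer. As \<open>V\<close> is a subspace, the new forms remain degree two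
  parts of elements of the reduction.\<close>

lemma noether_normalization:
  fixes v :: "nat \<Rightarrow> 'k::field mpoly"
  assumes inf: "infinite (UNIV :: 'k set)" and V: "mp.subspace V" "V \<subseteq> fiber 1"
  shows "(\<And>i. i < e \<Longrightarrow> v i \<in> V) \<Longrightarrow> fiber (Suc r) \<subseteq> mult_span (v ` {..<e}) r \<Longrightarrow>
    \<exists>w s. (\<forall>i<n + lam 1 - 1. w i \<in> V) \<and> fiber (Suc s) \<subseteq> mult_span (w ` {..<n + lam 1 - 1}) s"
proof (induction e arbitrary: v r)
  case 0
  let ?w = "\<lambda>i :: nat. 0 :: 'k mpoly"
  have "mult_span (v ` {..<0}) r \<subseteq> mult_span (?w ` {..<n + lam 1 - 1}) r"
    by (rule mult_span_mono_span) simp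
  with 0 show ?case using mp.subspace_0[OF V(1)] by (intro exI[of _ ?w] exI[of _ r]) auto
next
  case (Suc e)
  show ?case
  proof (cases "n + lam 1 - 1 \<le> e")
    case True
    have 1: "v i \<in> fiber 1" if "i \<le> e" for i using Suc.prems(1)[of i] V(2) that by auto
    have 2: "fiber (Suc r) \<subseteq> mult_span (v ` {..e}) r" using Suc.prems(2) by (simp add: lessThan_Suc_atMost)
    obtain b s where "fiber (Suc s) \<subseteq> mult_span ((\<lambda>i. v i - single 0 (b i) * v e) ` {..<e}) s"
      by (rule noether_step[OF inf 1 True 2])
    moreover have "v i - single 0 (b i) * v e \<in> V" if "i < e" for i
      using Suc.prems(1) that by (intro mp.subspace_diff[OF V(1)] mp.subspace_scale[OF V(1)]) auto
    ultimately show ?thesis using Suc.IH[of "\<lambda>i. v i - single 0 (b i) * v e" s] by blast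
  next
    case False
    let ?w = "\<lambda>i. if i < Suc e then v i else 0"
    have "v ` {..<Suc e} \<subseteq> mp.span (?w ` {..<n + lam 1 - 1})"
      using False by (auto intro!: mp.span_base image_eqI[where x = "_ :: nat"])
    then have "fiber (Suc r) \<subseteq> mult_span (?w ` {..<n + lam 1 - 1}) r"
      using Suc.prems(2) mult_span_mono_span by blast
    then show ?thesis using Suc.prems(1) mp.subspace_0[OF V(1)]
      by (intro exI[of _ ?w] exI[of _ r]) auto
  qed
qed

section \<open>Minimal reductions\<close>

lemma bottom_const_mult:
  assumes "ordge one_wt 2 (a :: 'k::comm_ring_1 mpoly)"
  shows "bottom (r * a) = single 0 (lookup r 0) * bottom a"
proof -
  have "wcomp one_wt 0 r = single 0 (lookup r 0)"
    by (rule poly_mapping_eqI) (auto simp: lookup_wcomp lookup_single when_def dest: tdeg_eq_0)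
  then show ?thesis using wcomp_mult[OF ordge_0[of one_wt r] assms] by (simp only: add_0)
qed

lemma subspace_ideal:
  assumes "ideal_in RR (J :: 'k::field mpoly set)"
  shows "mp.subspace J"
  unfolding mp.subspace_def by (intro conjI ballI allI ideal_inD[OF assms] const_RR)

lemma ordge_II: "a \<in> II \<Longrightarrow> ordge one_wt 2 (a :: 'k::comm_ring_1 mpoly)"
  using monom_ideal_ordge[of a 1] by (simp add: II_eq)

lemma subspace_bottom:
  assumes J: "ideal_in RR J" "J \<subseteq> (II :: 'k::field mpoly set)"
  shows "mp.subspace (bottom ` J)"
  unfolding mp.subspace_def
proof (intro conjI ballI allI)
  show "0 \<in> bottom ` J" using ideal_inD(2)[OF J(1)] by (intro image_eqI[of _ _ 0]) auto
next
  fix x y assume "x \<in> bottom ` J" "y \<in> bottom ` J"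
  then show "x + y \<in> bottom ` J"
    using ideal_inD(3)[OF J(1)] by (auto simp: wcomp_add[symmetric])
next
  fix c x assume "x \<in> bottom ` J"
  then obtain a where a: "x = bottom a" "a \<in> J" by blast
  then have "bottom (single 0 c * a) = single 0 c * x"
    using bottom_const_mult[OF ordge_II, of a "single 0 c"] J(2) by auto
  moreover have "single 0 c * a \<in> J" by (rule ideal_inD(4)[OF J(1) const_RR a(2)])
  ultimately show "single 0 c * x \<in> bottom ` J" by (metis imageI)
qed

text \<open>The degree two parts of a reduction contain a reduction of the fiber ring with at most
  \<open>n + lam 1 - 1\<close> generators; lifting it and adding the multiples of \<open>J\<close> without constant
  coefficient gives a reduction inside \<open>J\<close>, so a minimal \<open>J\<close> has no further degree two parts.\<close>

lemma minimal_reduction_lower_bound: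
  fixes J :: "'k::field mpoly set"
  assumes inf: "infinite (UNIV :: 'k set)" and min: "minimal_reduction RR J II"
  shows "red_bound \<le> red_num_wrt RR J II"
proof -
  have J: "ideal_in RR J" "J \<subseteq> II" and ex: "\<exists>r. ideal_pow RR II (Suc r) = ideal_prod RR J (ideal_pow RR II r)"
    using min by (auto simp: minimal_reduction_def is_reduction_def)
  define r where "r = red_num_wrt RR J II"
  have r: "ideal_pow RR II (Suc r) = ideal_prod RR J (ideal_pow RR II r)"
    using ex unfolding r_def red_num_wrt_def by (rule LeastI_ex)
  define V where "V = bottom ` J"
  have V: "mp.subspace V" "V \<subseteq> fiber 1"
    unfolding V_def using subspace_bottom[OF J] bottom_II[OF J(2)] by auto
  have fr: "fiber (Suc r) \<subseteq> mult_span V r" unfolding V_def by (rule reduction_bottom[OF J r])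
  obtain B where B: "B \<subseteq> V" "mp.independent B" "V \<subseteq> mp.span B"
    using mp.maximal_independent_subset[of V] by blast
  have "finite B"
    using mp.independent_span_bound[of "cmon ` cellmons 1" B] B(1,2) V(2) finite_cellmons
    by (auto simp: fiber_def)
  then obtain v e where v: "v ` {..<e :: nat} = B" using finite_imp_nat_seg_image_inj_on[of B] by (metis lessThan_def)
  have "fiber (Suc r) \<subseteq> mult_span (v ` {..<e}) r"
    using fr mult_span_mono_span[of V B r] B(3) v by auto
  moreover have "v i \<in> V" if "i < e" for i using v B(1) that by auto
  ultimately obtain w s0 where w: "\<And>i. i < n + lam 1 - 1 \<Longrightarrow> w i \<in> V"
    and s0: "fiber (Suc s0) \<subseteq> mult_span (w ` {..<n + lam 1 - 1}) s0"
    using noether_normalization[OF inf V] by metis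
  let ?d = "n + lam 1 - 1"
  \<comment> \<open>From degree \<open>s\<close> on both \<open>J\<close> and the chosen forms
    \<open>w i\<close> generate the next degree.\<close>
  define s where "s = max r s0"
  have s: "fiber (Suc s) \<subseteq> mult_span (w ` {..<?d}) s"
    using mult_span_step[OF s0] by (simp add: s_def)
  have "\<exists>f\<in>J. bottom f = w i" if "i < ?d" for i using w[OF that] by (auto simp: V_def)
  then obtain f where f: "\<And>i. i < ?d \<Longrightarrow> f i \<in> J \<and> bottom (f i) = w i" by metis
  \<comment> \<open>The second set is \<open>m J\<close> for the ideal \<open>m\<close> of
    polynomials without constant coefficient: it takes care of all terms of higher degree and
    contributes nothing in degree two.\<close>
  define G where "G = f ` {..<?d} \<union> {p * g | p g. p \<in> RR \<and> lookup p 0 = 0 \<and> g \<in> J}"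
  define J' where "J' = gen_ideal RR G"
  have GJ: "G \<subseteq> J" using f J(1) by (auto simp: G_def intro: ideal_inD)
  have JR: "J \<subseteq> RR" using J(1) by (rule ideal_inD)
  have J': "ideal_in RR J'" "J' \<subseteq> J" "G \<subseteq> J'"
    unfolding J'_def
    by (rule ideal_in_gen_ideal[OF subring_RR subset_trans[OF GJ JR]], rule gen_ideal_least[OF J(1) GJ],
        rule gen_ideal_superset)
  define K where "K = ideal_prod RR J' (monom_ideal s)"
  have K: "ideal_in RR K" unfolding K_def
    using J' JR by (intro ideal_in_prod subring_RR) (auto simp: monom_ideal_def)
  have JI: "cmon M \<in> ideal_prod RR J (monom_ideal s)" if "M \<in> cellmons (Suc s)" for M
    using reduction_step_mono[OF J _ r[unfolded reduction_step_iff[OF J]], of s] that by (auto simp: s_def)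
  have mult_K: "p * x \<in> K" if p: "p \<in> RR" "lookup p 0 = 0" and x: "x \<in> ideal_prod RR J (monom_ideal s)" for p x
  proof -
    let ?L = "{x \<in> RR. p * x \<in> K}"
    have "ideal_in RR ?L" using K
      by (auto simp: ideal_in_def subring_RR distrib_left mult.left_commute[of p] intro: is_subringD)
    then have "ideal_prod RR J (monom_ideal s) \<subseteq> ?L"
    proof (rule ideal_prod_least)
      fix a b :: "'k mpoly" assume a: "a \<in> J" and b: "b \<in> monom_ideal s"
      have "p * a \<in> G" using p a by (auto simp: G_def)
      then have "p * a * b \<in> K" using J'(3) b unfolding K_def by (intro ideal_prodI) auto
      moreover have "a * b \<in> RR" using a b JR by (intro is_subringD(4)[OF subring_RR]) (auto simp: monom_ideal_def)
      ultimately show "a * b \<in> ?L" by (simp add: mult.assoc)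
    qed
    with x show ?thesis by blast
  qed
  \<comment> \<open>A term of \<open>h\<close> is a cell times a nontrivial monomial
    \<open>m'\<close>. The cell times \<open>cmon N\<close> lies in \<open>J I^s\<close>, and the
    factor \<open>m'\<close> moves it into \<open>K\<close> by \<open>mult_K\<close>.\<close>
  have tail: "h * cmon N \<in> K" if h: "h \<in> II" "bottom h = 0" and N: "N \<in> cellmons s" for h N
  proof -
    have "single m (lookup h m) * cmon N \<in> K" if m: "m \<in> keys h" for m
    proof -
      obtain M m' where M: "M \<in> cellmons 1" "m = expo M + m'" using h(1) m by (auto simp: II_eq monom_ideal_def)
      have "m' \<noteq> 0"
      proof
        assume "m' = 0"
        then have "lookup (bottom h) m = lookup h m" using M by (simp add: lookup_wcomp cellmons_def)
        then show False using m h(2) by (simp add: in_keys_iff)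
      qed
      then have "lookup (single m' (lookup h m)) 0 = 0" by (simp add: lookup_single when_def)
      moreover have "keys m \<subseteq> ferrers_vars n lam" using m h(1) by (auto simp: II_eq monom_ideal_def RR_iff)
      then have "single m' (lookup h m) \<in> RR"
        using M(2) by (intro single_RR) (auto simp: in_keys_iff lookup_add)
      moreover have "cmon (M + N) \<in> ideal_prod RR J (monom_ideal s)"
        using M(1) N by (intro JI) (auto simp: cellmons_def)
      ultimately have "single m' (lookup h m) * cmon (M + N) \<in> K" by (intro mult_K)
      then show ?thesis by (simp add: cmon_union cmon_def mult_single M(2) expo_union ac_simps)
    qed
    then have "(\<Sum>m\<in>keys h. single m (lookup h m) * cmon N) \<in> K" by (rule ideal_in_sum[OF K])
    then show ?thesis using poly_mapping_sum_single[of h] by (simp add: sum_distrib_right[symmetric])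
  qed
  have "mult_span (w ` {..<?d}) s \<subseteq> K"
    unfolding mult_span_def
  proof (rule mp.span_minimal)
    show "mp.subspace K" by (rule subspace_ideal[OF K])
    show "{v * cmon N |v N. v \<in> w ` {..<?d} \<and> N \<in> cellmons s} \<subseteq> K"
    proof safe
      fix i N assume i: "i < ?d" and N: "N \<in> cellmons s"
      have fi: "f i \<in> II" "bottom (f i) = w i" using f[OF i] J(2) by auto
      have wI: "w i \<in> II"
      proof -
        have "w i \<in> fiber 1" using w[OF i] V(2) by blast
        moreover have "mp.subspace (II :: 'k mpoly set)" by (rule subspace_ideal[OF ideal_in_II])
        ultimately show ?thesis unfolding fiber_def
          using mp.span_minimal[of "cmon ` cellmons 1" II] cmon_monom_ideal[of _ 1] by (auto simp: II_eq)
      qed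
      have "bottom (w i) = w i" unfolding fi(2)[symmetric]
        by (rule poly_mapping_eqI) (simp add: lookup_wcomp when_def)
      then have "bottom (f i - w i) = 0"
        using fi(2) wcomp_add[of one_wt 2 "f i" "- w i"] by (simp add: wcomp_uminus)
      then have "(f i - w i) * cmon N \<in> K"
        using fi(1) wI N by (intro tail ideal_in_diff[OF subring_RR ideal_in_II])
      moreover have "f i * cmon N \<in> K" unfolding K_def
        using i J'(3) N by (intro ideal_prodI cmon_monom_ideal) (auto simp: G_def)
      ultimately have "f i * cmon N - (f i - w i) * cmon N \<in> K" by (intro ideal_in_diff[OF subring_RR K])
      then show "w i * cmon N \<in> K" by (simp add: algebra_simps)
    qed
  qed
  then have "fiber (Suc s) \<subseteq> K" using s by blast
  then have "\<forall>M\<in>cellmons (Suc s). cmon M \<in> K"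
    unfolding fiber_def using mp.span_superset by blast
  then have "ideal_pow RR II (Suc s) = ideal_prod RR J' (ideal_pow RR II s)"
    unfolding K_def using reduction_step_iff[OF J'(1), of s] J'(2) J(2) by blast
  then have "is_reduction RR J' II"
    unfolding is_reduction_def using J' J(2) by blast
  then have "J' = J" using min J'(2) by (auto simp: minimal_reduction_def)
  \<comment> \<open>Since \<open>J' = J\<close>, bounding the degree two parts of the generators
    \<open>G\<close> bounds those of \<open>J\<close>.\<close>
  have "J' \<subseteq> {a \<in> J. bottom a \<in> mp.span (w ` {..<?d})}"
    unfolding J'_def
  proof (rule gen_ideal_least)
    have "bottom (p * a) \<in> mp.span (w ` {..<?d})" if "a \<in> J" "bottom a \<in> mp.span (w ` {..<?d})" for a p
    proof -
      have "a \<in> II" using that(1) J(2) by blast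
      from bottom_const_mult[OF ordge_II[OF this]] show ?thesis
        using mp.span_scale[OF that(2)] by simp
    qed
    then show "ideal_in RR {a \<in> J. bottom a \<in> mp.span (w ` {..<?d})}"
      using J(1) by (auto simp: ideal_in_def wcomp_add intro: mp.span_add mp.span_zero)
    show "G \<subseteq> {a \<in> J. bottom a \<in> mp.span (w ` {..<?d})}"
    proof
      fix x assume x: "x \<in> G"
      then consider i where "i < ?d" "x = f i" | p g where "x = p * g" "lookup p 0 = 0" "g \<in> J"
        by (auto simp: G_def)
      then have "bottom x \<in> mp.span (w ` {..<?d})"
      proof cases
        case 1
        then show ?thesis using f by (auto intro: mp.span_base)
      next
        case 2
        have "g \<in> II" using 2(3) J(2) by blast
        from bottom_const_mult[OF ordge_II[OF this], of p] show ?thesis using 2 by (simp add: mp.span_zero)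
      qed
      then show "x \<in> {a \<in> J. bottom a \<in> mp.span (w ` {..<?d})}" using x GJ by blast
    qed
  qed
  then have "V \<subseteq> mp.span (w ` {..<?d})" using \<open>J' = J\<close> by (auto simp: V_def)
  then have fin: "fiber (Suc r) \<subseteq> mult_span (w ` {..<?d}) r" using fr mult_span_mono_span by blast
  \<comment> \<open>The forms are indexed by \<open>colours\<close> because
    \<open>reduction_lower_bound\<close> joins each of them to a diagonal.\<close>
  obtain h where h: "bij_betw h colours {..<?d}"
    using finite_same_card_bij[OF finite_colours, of "{..<?d}"] card_colours by auto
  have "red_bound \<le> r"
  proof (rule reduction_lower_bound[OF inf, of "w \<circ> h"])
    fix c assume "c \<in> colours"
    then have "h c < ?d" using h by (auto simp: bij_betw_def)
    then show "(w \<circ> h) c \<in> fiber 1" using w V(2) by auto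
  next
    have "(w \<circ> h) ` colours = w ` {..<?d}" 
      using bij_betw_imp_surj_on[OF h] by (simp only: image_comp[symmetric])
    then show "fiber (Suc r) \<subseteq> mult_span ((w \<circ> h) ` colours) r" using fin by simp
  qed
  then show ?thesis by (simp add: r_def)
qed

section \<open>The diagonals generate a reduction\<close>

lemma diag_upper_eq: "diag_upper n lam k = diag (int k)"
proof -
  have "dcells (int k) = (\<lambda>i. (i, k + i)) ` {i. 1 \<le> i \<and> i \<le> n \<and> k + i \<le> lam i}"
    by (auto simp: dcells_def cells_def image_iff)
  then show ?thesis by (simp add: diag_upper_def diag_def sum.reindex inj_on_def)
qed

lemma diag_lower_eq: "diag_lower n lam k = diag (- int k)"
proof -
  have "dcells (- int k) = (\<lambda>i. (k + i, i)) ` {i. 1 \<le> i \<and> k + i \<le> n \<and> i \<le> lam (k + i)}"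
  proof (intro equalityI subsetI)
    fix z assume "z \<in> dcells (- int k)"
    then have "(fst z, snd z) \<in> cells" "fst z = k + snd z" by (auto simp: dcells_def)
    then show "z \<in> (\<lambda>i. (k + i, i)) ` {i. 1 \<le> i \<and> k + i \<le> n \<and> i \<le> lam (k + i)}"
      by (intro image_eqI[of _ _ "snd z"]) (auto simp: cells_def prod_eq_iff)
  qed (auto simp: dcells_def cells_def)
  then show ?thesis by (simp add: diag_lower_def diag_def sum.reindex inj_on_def)
qed

lemma diag_reduction_eq: "diag_reduction n lam = gen_ideal RR (diag ` colours)"
proof -
  have "{diag_upper n lam k | k. k < lam 1} \<union> {diag_lower n lam k | k. 1 \<le> k \<and> k \<le> n - 1} = diag ` colours"
  proof (intro equalityI subsetI)
    fix x assume "x \<in> diag ` colours"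
    then obtain c where c: "x = diag c" "c \<in> colours" by blast
    show "x \<in> {diag_upper n lam k | k. k < lam 1} \<union> {diag_lower n lam k | k. 1 \<le> k \<and> k \<le> n - 1}"
    proof (cases "0 \<le> c")
      case True
      then show ?thesis using c by (auto simp: diag_upper_eq colours_def intro!: exI[of _ "nat c"])
    next
      case False
      then show ?thesis using c by (auto simp: diag_lower_eq colours_def intro!: exI[of _ "nat (- c)"])
    qed
  qed (auto simp: diag_upper_eq diag_lower_eq colours_def)
  then show ?thesis unfolding diag_reduction_def by (rule arg_cong)
qed

lemma diag_II: "diag c \<in> (II :: 'k::comm_ring_1 mpoly set)"
proof -
  have "xy (fst z) (snd z) \<in> (II :: 'k mpoly set)" if "z \<in> dcells c" for z
    using cmon_monom_ideal[of "{#z#}" 1] that by (simp add: II_eq cmon_single cellmons_def dcells_def)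
  then show ?thesis unfolding diag_def by (rule ideal_in_sum[OF ideal_in_II])
qed

lemma ideal_in_diag: "ideal_in RR (diag_reduction n lam :: 'k::comm_ring_1 mpoly set)"
  unfolding diag_reduction_eq
  by (rule ideal_in_gen_ideal[OF subring_RR]) (use diag_II ideal_inD(1)[OF ideal_in_II] in blast)

lemma diag_reduction_II: "diag_reduction n lam \<subseteq> (II :: 'k::comm_ring_1 mpoly set)"
  unfolding diag_reduction_eq by (rule gen_ideal_least[OF ideal_in_II]) (use diag_II in blast)

lemma diag_mem: "c \<in> colours \<Longrightarrow> diag c \<in> (diag_reduction n lam :: 'k::comm_ring_1 mpoly set)"
  unfolding diag_reduction_eq by (rule subsetD[OF gen_ideal_superset]) (rule imageI)

text \<open>There are no corner sets of size \<open>Suc red_bound\<close>, so straightening in this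
  degree leaves only multiples of the diagonals.\<close>

lemma diag_reduction_step:
  "ideal_pow RR II (Suc red_bound) = ideal_prod RR (diag_reduction n lam) (ideal_pow RR II red_bound :: 'k::field mpoly set)"
proof (subst reduction_step_iff[OF ideal_in_diag diag_reduction_II], rule ballI)
  fix M assume M: "M \<in> cellmons (Suc red_bound)"
  let ?K = "ideal_prod RR (diag_reduction n lam) (monom_ideal red_bound) :: 'k mpoly set"
  have K: "ideal_in RR ?K"
    by (intro ideal_in_prod subring_RR ideal_inD(1)[OF ideal_in_diag] ideal_inD(1)[OF ideal_in_monom_ideal])
  have "(cmon M :: 'k mpoly) \<in> mp.span {diag c * cmon N | c N. c \<in> colours \<and> N \<in> cellmons red_bound}"
    using cmon_straighten[OF M] corner_sets_empty[of "Suc red_bound"] by simp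
  also have "mp.span {diag c * cmon N | c N. c \<in> colours \<and> N \<in> cellmons red_bound} \<subseteq> ?K"
  proof (rule mp.span_minimal)
    show "{diag c * cmon N |c N. c \<in> colours \<and> N \<in> cellmons red_bound} \<subseteq> ?K"
      by (auto intro!: ideal_prodI diag_mem cmon_monom_ideal)
    show "mp.subspace ?K" by (rule subspace_ideal[OF K])
  qed
  finally show "cmon M \<in> ?K" .
qed

lemma is_reduction_diag: "is_reduction RR (diag_reduction n lam) (II :: 'k::field mpoly set)"
  unfolding is_reduction_def using ideal_in_diag diag_reduction_II diag_reduction_step by blast

lemma red_num_diag_le: "red_num_wrt RR (diag_reduction n lam) (II :: 'k::field mpoly set) \<le> red_bound"
  unfolding red_num_wrt_def by (rule Least_le) (rule diag_reduction_step)

end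

section \<open>Prime ideals, saturation and determinants\<close>

text \<open>Zorn's lemma: a finite generating set contained in the union of a chain already lies in
  one member, so the union stays proper.\<close>

lemma maximal_proper_subideal:
  assumes R: "is_subring R" and A: "finite A" "A \<subseteq> R" and J: "J = gen_ideal R A"
    and J': "ideal_in R J'" "J' \<subseteq> J" "J' \<noteq> J"
  obtains L where "ideal_in R L" "J' \<subseteq> L" "L \<subseteq> J" "L \<noteq> J"
    "\<And>K. ideal_in R K \<Longrightarrow> L \<subseteq> K \<Longrightarrow> K \<subseteq> J \<Longrightarrow> K = L \<or> K = J"
proof -
  let ?S = "{L. ideal_in R L \<and> J' \<subseteq> L \<and> L \<subseteq> J \<and> L \<noteq> J}"
  have "\<exists>L\<in>?S. \<forall>K\<in>?S. L \<subseteq> K \<longrightarrow> K = L"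
  proof (rule subset_Zorn_nonempty)
    show "?S \<noteq> {}" using J' by blast
    fix \<C> assume ne: "\<C> \<noteq> {}" and ch: "subset.chain ?S \<C>"
    have CS: "\<C> \<subseteq> ?S" using ch by (auto simp: subset.chain_def)
    have tot: "X \<subseteq> Y \<or> Y \<subseteq> X" if "X \<in> \<C>" "Y \<in> \<C>" for X Y
      using ch that by (auto simp: subset.chain_def)
    have "ideal_in R (\<Union>\<C>)"
      unfolding ideal_in_def
    proof (intro conjI ballI)
      show "\<Union>\<C> \<subseteq> R" "0 \<in> \<Union>\<C>" using CS ne ideal_inD(1,2)[of R] by blast+
      fix a b assume "a \<in> \<Union>\<C>" "b \<in> \<Union>\<C>"
      then obtain X Y where XY: "X \<in> \<C>" "Y \<in> \<C>" "a \<in> X" "b \<in> Y" by blast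
      then obtain Z where "Z \<in> \<C>" "a \<in> Z" "b \<in> Z" using tot[of X Y] by blast
      moreover then have "a + b \<in> Z" using CS ideal_inD(3)[of R Z a b] by blast
      ultimately show "a + b \<in> \<Union>\<C>" by blast
    next
      fix r a assume "r \<in> R" "a \<in> \<Union>\<C>"
      then show "r * a \<in> \<Union>\<C>" using CS ideal_inD(4)[of R _ r a] by blast
    qed
    moreover have "\<Union>\<C> \<noteq> J"
    proof
      assume UJ: "\<Union>\<C> = J"
      have "A \<subseteq> \<Union>\<C>" unfolding UJ J by (rule gen_ideal_superset)
      then obtain X where X: "X \<in> \<C>" "A \<subseteq> X"
        by (rule finite_subset_Union_chain[OF A(1) _ ne ch])
      have XS: "ideal_in R X" "X \<subseteq> J" "X \<noteq> J" using CS X(1) by auto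
      have "gen_ideal R A \<subseteq> X" by (rule gen_ideal_least[OF XS(1) X(2)])
      with XS show False unfolding J by blast
    qed
    moreover obtain X where "X \<in> \<C>" using ne by blast
    then have "J' \<subseteq> \<Union>\<C>" using CS by (intro Sup_upper2[of X]) auto
    moreover have "\<Union>\<C> \<subseteq> J" using CS by (intro Union_least) auto
    ultimately show "\<Union>\<C> \<in> ?S" by simp
  qed
  then obtain L where L: "ideal_in R L" "J' \<subseteq> L" "L \<subseteq> J" "L \<noteq> J"
    and max: "\<forall>K\<in>?S. L \<subseteq> K \<longrightarrow> K = L" by auto
  show ?thesis
  proof (rule that[OF L])
    fix K assume K: "ideal_in R K" "L \<subseteq> K" "K \<subseteq> J"
    show "K = L \<or> K = J"
    proof (cases "K = J")
      case False
      then have "K \<in> ?S" using K L(2) by simp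
      then show ?thesis using max K(2) by simp
    qed simp
  qed
qed

definition prime_in :: "'a::comm_ring_1 set \<Rightarrow> 'a set \<Rightarrow> bool" where
  "prime_in R P \<longleftrightarrow> ideal_in R P \<and> 1 \<notin> P \<and> (\<forall>a\<in>R. \<forall>b\<in>R. a * b \<in> P \<longrightarrow> a \<in> P \<or> b \<in> P)"

lemma prime_inD:
  assumes "prime_in R P"
  shows "ideal_in R P" "1 \<notin> P" "a \<in> R \<Longrightarrow> b \<in> R \<Longrightarrow> a * b \<in> P \<Longrightarrow> a \<in> P \<or> b \<in> P"
  using assms by (auto simp: prime_in_def)

lemma prime_in_prod:
  assumes R: "is_subring R" and P: "prime_in R P" and "finite A"
  shows "(\<And>a. a \<in> A \<Longrightarrow> f a \<in> R) \<Longrightarrow> (\<And>a. a \<in> A \<Longrightarrow> f a \<notin> P) \<Longrightarrow> prod f A \<notin> P"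
  using \<open>finite A\<close>
proof (induction A)
  case (insert x F)
  then have "prod f F \<in> R" by (intro is_subring_prod[OF R]) auto
  then show ?case using insert prime_inD(3)[OF P, of "f x" "prod f F"] by auto
qed (simp add: prime_inD(2)[OF P])

lemma prime_in_power:
  assumes R: "is_subring R" and P: "prime_in R P" and a: "a \<in> R" "a ^ k \<in> P"
  shows "a \<in> P"
  using prime_in_prod[OF R P, of "{..<k}" "\<lambda>_. a"] a by auto

text \<open>The point is that \<open>J / L\<close> is a simple module generated by \<open>g\<close>.\<close>

lemma colon_prime:
  assumes R: "is_subring R" and J: "ideal_in R J" and L: "ideal_in R L" "L \<subseteq> J" "L \<noteq> J"
    and max: "\<And>K. ideal_in R K \<Longrightarrow> L \<subseteq> K \<Longrightarrow> K \<subseteq> J \<Longrightarrow> K = L \<or> K = J"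
    and g: "g \<in> J" "g \<notin> L"
  defines "P \<equiv> {a \<in> R. \<forall>x\<in>J. a * x \<in> L}"
  shows "prime_in R P"
    and "\<And>x. x \<in> J \<Longrightarrow> \<exists>a\<in>R. x - a * g \<in> L"
    and "\<And>u. u \<in> R \<Longrightarrow> u * g \<in> L \<Longrightarrow> u \<in> P"
proof -
  have JR: "J \<subseteq> R" using J by (rule ideal_inD)
  let ?K = "{x \<in> J. \<exists>a\<in>R. x - a * g \<in> L}"
  have "ideal_in R ?K"
    unfolding ideal_in_def
  proof (intro conjI ballI)
    show "?K \<subseteq> R" using JR by blast
    show "0 \<in> ?K" using ideal_inD(2)[OF J] ideal_inD(2)[OF L(1)] is_subringD(1)[OF R]
      by (auto intro!: bexI[of _ 0])
    fix x y assume "x \<in> ?K" "y \<in> ?K"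
    then obtain a b where ab: "a \<in> R" "b \<in> R" "x \<in> J" "y \<in> J" "x - a * g \<in> L" "y - b * g \<in> L" by blast
    then have "(x - a * g) + (y - b * g) \<in> L" by (intro ideal_inD(3)[OF L(1)])
    then have "x + y - (a + b) * g \<in> L" by (simp add: algebra_simps)
    then show "x + y \<in> ?K" using ab is_subringD(3)[OF R] ideal_inD(3)[OF J] by blast
  next
    fix r x assume r: "r \<in> R" and "x \<in> ?K"
    then obtain a where a: "a \<in> R" "x \<in> J" "x - a * g \<in> L" by blast
    then have "r * (x - a * g) \<in> L" by (intro ideal_inD(4)[OF L(1) r])
    then have "r * x - (r * a) * g \<in> L" by (simp add: algebra_simps)
    then show "r * x \<in> ?K" using a r is_subringD(4)[OF R] ideal_inD(4)[OF J] by blast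
  qed
  moreover have "L \<subseteq> ?K" using L(2) is_subringD(1)[OF R] by (auto intro!: bexI[of _ 0])
  moreover have "g \<in> ?K" using g ideal_inD(2)[OF L(1)] is_subringD(2)[OF R] by (auto intro!: bexI[of _ 1])
  ultimately have "?K = J" using max[of ?K] g by blast
  then show gen: "\<exists>a\<in>R. x - a * g \<in> L" if "x \<in> J" for x using that by blast
  show gP: "u \<in> P" if u: "u \<in> R" "u * g \<in> L" for u
  proof -
    have "u * x \<in> L" if x: "x \<in> J" for x
    proof -
      obtain a where a: "a \<in> R" "x - a * g \<in> L" using gen[OF x] by blast
      have "u * (x - a * g) + a * (u * g) \<in> L"
        by (rule ideal_inD(3)[OF L(1) ideal_inD(4)[OF L(1) u(1) a(2)] ideal_inD(4)[OF L(1) a(1) u(2)]])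
      then show ?thesis by (simp add: algebra_simps)
    qed
    then show ?thesis using u by (simp add: P_def)
  qed
  show "prime_in R P"
    unfolding prime_in_def
  proof (intro conjI ballI impI)
    show "ideal_in R P"
      unfolding ideal_in_def P_def
      using ideal_inD[OF L(1)] is_subringD[OF R]
      by (auto simp: distrib_right mult.assoc)
    show "1 \<notin> P" using g by (auto simp: P_def)
  next
    fix a b assume a: "a \<in> R" and b: "b \<in> R" and ab: "a * b \<in> P"
    show "a \<in> P \<or> b \<in> P"
    proof (cases "b * g \<in> L")
      case True
      then show ?thesis using gP b by blast
    next
      case False
      have bg: "b * g \<in> J" using b g ideal_inD(4)[OF J] by blast
      have "ideal_in R {x \<in> J. a * x \<in> L}"
        unfolding ideal_in_def using ideal_inD[OF L(1)] ideal_inD[OF J] JR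
        by (auto simp: distrib_left mult.left_commute[of a])
      moreover have "L \<subseteq> {x \<in> J. a * x \<in> L}" using L(2) ideal_inD(4)[OF L(1) a] by blast
      moreover have "b * g \<in> {x \<in> J. a * x \<in> L}"
        using bg ab g by (auto simp: P_def mult.assoc)
      ultimately have "{x \<in> J. a * x \<in> L} = J" using max[of "{x \<in> J. a * x \<in> L}"] False by blast
      then have "a \<in> P" using a by (auto simp: P_def)
      then show ?thesis ..
    qed
  qed
qed

text \<open>The contraction to \<open>R\<close> of the localization of \<open>L\<close> at
  \<open>P\<close>; it lets local statements be made inside the ring.\<close>

definition saturation :: "'a::comm_ring_1 set \<Rightarrow> 'a set \<Rightarrow> 'a set \<Rightarrow> 'a set" where
  "saturation R P L = {f \<in> R. \<exists>u\<in>R. u \<notin> P \<and> u * f \<in> L}"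

lemma ideal_in_saturation:
  assumes R: "is_subring R" and P: "prime_in R P" and L: "ideal_in R L"
  shows "ideal_in R (saturation R P L)"
  unfolding ideal_in_def
proof (intro conjI ballI)
  show "saturation R P L \<subseteq> R" by (auto simp: saturation_def)
  show "0 \<in> saturation R P L"
    using is_subringD(1,2)[OF R] prime_inD(2)[OF P] ideal_inD(2)[OF L] by (auto simp: saturation_def)
  fix f h assume "f \<in> saturation R P L" "h \<in> saturation R P L"
  then obtain u w where uw: "f \<in> R" "h \<in> R" "u \<in> R" "w \<in> R" "u \<notin> P" "w \<notin> P" "u * f \<in> L" "w * h \<in> L"
    by (auto simp: saturation_def)
  have "w * (u * f) + u * (w * h) \<in> L"
    by (rule ideal_inD(3)[OF L ideal_inD(4)[OF L uw(4,7)] ideal_inD(4)[OF L uw(3,8)]])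
  then have "(u * w) * (f + h) \<in> L" by (simp add: algebra_simps)
  moreover have "u * w \<notin> P" using uw prime_inD(3)[OF P] by blast
  ultimately show "f + h \<in> saturation R P L" using uw is_subringD(3,4)[OF R] by (auto simp: saturation_def)
next
  fix r f assume "r \<in> R" "f \<in> saturation R P L"
  then show "r * f \<in> saturation R P L"
    using is_subringD(4)[OF R] ideal_inD(4)[OF L] by (auto simp: saturation_def mult.left_commute[of _ r])
qed

lemma saturation_saturated:
  assumes R: "is_subring R" and P: "prime_in R P"
    and u: "u \<in> R" "u \<notin> P" and f: "f \<in> R" "u * f \<in> saturation R P L"
  shows "f \<in> saturation R P L"
proof -
  obtain w where "w \<in> R" "w \<notin> P" "w * (u * f) \<in> L" using f by (auto simp: saturation_def)
  then show ?thesis using u f is_subringD(4)[OF R, of w u] prime_inD(3)[OF P, of w u]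
    by (auto simp: saturation_def mult.assoc intro!: bexI[of _ "w * u"])
qed

text \<open>Eliminating the last unknown keeps the system upper triangular modulo \<open>P\<close>.\<close>

lemma triangular_system:
  assumes R: "is_subring R" and P: "prime_in R P" and L: "ideal_in R L"
    and sat: "\<And>u f. u \<in> R \<Longrightarrow> u \<notin> P \<Longrightarrow> f \<in> R \<Longrightarrow> u * f \<in> L \<Longrightarrow> f \<in> L"
  shows "(\<And>i j. i < (s :: nat) \<Longrightarrow> j < s \<Longrightarrow> a i j \<in> R) \<Longrightarrow> (\<And>i. i < s \<Longrightarrow> q i \<in> R) \<Longrightarrow> (\<And>i. i < s \<Longrightarrow> a i i \<notin> P)
    \<Longrightarrow> (\<And>i j. i < s \<Longrightarrow> j < i \<Longrightarrow> a i j \<in> P) \<Longrightarrow> (\<And>i. i < s \<Longrightarrow> (\<Sum>j<s. a i j * q j) \<in> L) \<Longrightarrow> i < s \<Longrightarrow> q i \<in> L"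
proof (induction s arbitrary: a i)
  case (Suc s)
  note PI = prime_inD(1)[OF P]
  define a' where "a' i j = a s s * a i j - a i s * a s j" for i j
  have first: "q j \<in> L" if "j < s" for j
  proof (rule Suc.IH[of a'])
    fix i j assume ij: "i < s" "j < s"
    then show "a' i j \<in> R" unfolding a'_def using Suc.prems(1) is_subringD(4,6)[OF R] by simp
  next
    fix i assume i: "i < s"
    then show "q i \<in> R" using Suc.prems(2) by simp
    have "a s i \<in> P" "a i s \<in> R" "a s s \<notin> P" "a i i \<notin> P" "a s s \<in> R" "a i i \<in> R"
      using Suc.prems(1,3,4) i by auto
    then have "a i s * a s i \<in> P" "a s s * a i i \<notin> P" using ideal_inD(4)[OF PI] prime_inD(3)[OF P] by blast+
    then show "a' i i \<notin> P" unfolding a'_def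
      using ideal_inD(3)[OF PI, of "a s s * a i i - a i s * a s i" "a i s * a s i"] by auto
    have "a s s * (\<Sum>j<Suc s. a i j * q j) - a i s * (\<Sum>j<Suc s. a s j * q j) \<in> L"
      using Suc.prems(1,5) i by (intro ideal_in_diff[OF R L] ideal_inD(4)[OF L]) auto
    also have "a s s * (\<Sum>j<Suc s. a i j * q j) - a i s * (\<Sum>j<Suc s. a s j * q j) = (\<Sum>j<s. a' i j * q j)"
      by (simp add: a'_def sum_distrib_left sum_subtractf[symmetric] algebra_simps)
    finally show "(\<Sum>j<s. a' i j * q j) \<in> L" .
  next
    fix i j assume "i < s" "j < i"
    then have "a i j \<in> P" "a s j \<in> P" "a s s \<in> R" "a i s \<in> R" using Suc.prems(1,4) by auto
    then show "a' i j \<in> P" unfolding a'_def by (intro ideal_in_diff[OF R PI] ideal_inD(4)[OF PI])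
  qed (rule that)
  show ?case
  proof (cases "i = s")
    case True
    have "(\<Sum>j<s. a s j * q j) \<in> L"
      using first Suc.prems(1) by (intro ideal_in_sum[OF L] ideal_inD(4)[OF L]) auto
    then have "(\<Sum>j<Suc s. a s j * q j) - (\<Sum>j<s. a s j * q j) \<in> L"
      using Suc.prems(5)[of s] by (intro ideal_in_diff[OF R L]) auto
    then have "a s s * q s \<in> L" by simp
    then show ?thesis using sat[of "a s s" "q s"] Suc.prems(1,2,3) True by auto
  next
    case False
    then show ?thesis using first Suc.prems(6) by simp
  qed
qed simp

text \<open>Every permutation other than the identity uses an entry off the diagonal, so modulo
  \<open>P\<close> the determinant is the product of the diagonal entries.\<close>

lemma det_notin_prime:
  assumes R: "is_subring R" and P: "prime_in R P" and A: "A \<in> carrier_mat d d"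
    and AR: "\<And>i j. i < d \<Longrightarrow> j < d \<Longrightarrow> A $$ (i, j) \<in> R"
    and diag: "\<And>i. i < d \<Longrightarrow> A $$ (i, i) \<notin> P"
    and off: "\<And>i j. i < d \<Longrightarrow> j < d \<Longrightarrow> i \<noteq> j \<Longrightarrow> A $$ (i, j) \<in> P"
  shows "det A \<notin> P"
proof
  assume det: "det A \<in> P"
  note PI = prime_inD(1)[OF P]
  let ?t = "\<lambda>p. signof p * (\<Prod>i = 0..<d. A $$ (i, p i))"
  let ?S = "{p. p permutes {0..<d}}"
  have "(\<Sum>p\<in>?S - {id}. ?t p) \<in> P"
  proof (rule ideal_in_sum[OF PI])
    fix p assume p: "p \<in> ?S - {id}"
    then obtain i where i: "p i \<noteq> i" by (auto simp: fun_eq_iff)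
    then have id: "i < d" "p i < d" using p permutes_in_image[of p "{0..<d}" i] by (auto simp: permutes_def)
    have lt: "p j < d" if "j < d" for j using p permutes_in_image[of p "{0..<d}" j] that by auto
    have "(\<Prod>j = 0..<d. A $$ (j, p j)) = (\<Prod>j \<in> {0..<d} - {i}. A $$ (j, p j)) * A $$ (i, p i)"
      using id by (subst prod.remove[of _ i]) (auto simp: mult.commute)
    also have "\<dots> \<in> P" using off[OF id] i lt
      by (intro ideal_inD(4)[OF PI] is_subring_prod[OF R]) (auto intro: AR)
    finally show "?t p \<in> P"
      using ideal_in_uminus[OF R PI] by (cases "sign p = 1") (auto simp: sign_def)
  qed
  then have "det A - (\<Sum>p\<in>?S - {id}. ?t p) \<in> P" using det by (intro ideal_in_diff[OF R PI])
  moreover have "det A = ?t id + (\<Sum>p\<in>?S - {id}. ?t p)"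
    unfolding det_def'[OF A] by (rule sum.remove) (auto simp: finite_permutations permutes_id)
  ultimately have "(\<Prod>i = 0..<d. A $$ (i, i)) \<in> P" by simp
  then show False using prime_in_prod[OF R P, of "{0..<d}" "\<lambda>i. A $$ (i, i)"] AR diag by auto
qed

section \<open>Substitution of monomials and vanishing determinants\<close>

lemma subst_monom_subst:
  fixes t :: "'v \<Rightarrow> ('x, 'k::comm_ring_1) mvpoly"
  shows "subst s (monom_subst t m) = monom_subst (\<lambda>v. subst s (t v)) m"
proof -
  have "subst s (prod f A) = (\<Prod>a\<in>A. subst s (f a))" for f :: "'v \<Rightarrow> ('x, 'k) mvpoly" and A
    by (induction A rule: infinite_finite_induct) (auto simp: subst_mult)
  then show ?thesis by (simp add: monom_subst_def subst_power)
qed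

lemma subst_subst: "subst s (subst t p) = subst (\<lambda>v. subst s (t v)) p"
  unfolding subst_def[of t p] subst_sum subst_mult subst_const subst_monom_subst
  by (simp add: subst_def)

definition pvar :: "'v \<Rightarrow> ('v, 'k::comm_ring_1) mvpoly" where
  "pvar v = single (single v 1) 1"

lemma subst_pvar [simp]: "subst s (pvar v) = s v"
  by (simp add: pvar_def subst_single)

text \<open>The exponent to which a monomial is sent when each \<open>x\<close> is replaced by the
  monomial \<open>\<kappa> x\<close>; the inner sum is the natural multiple of
  \<open>\<kappa> x\<close>.\<close>

definition msum :: "('x \<Rightarrow> 'v \<Rightarrow>\<^sub>0 nat) \<Rightarrow> ('x \<Rightarrow>\<^sub>0 nat) \<Rightarrow> ('v \<Rightarrow>\<^sub>0 nat)" where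
  "msum \<kappa> m = (\<Sum>x\<in>keys m. \<Sum>_<lookup m x. \<kappa> x)"

lemma lookup_msum:
  assumes "finite A" "keys m \<subseteq> A"
  shows "lookup (msum \<kappa> m) y = (\<Sum>x\<in>A. lookup m x * lookup (\<kappa> x) y)"
proof -
  have "lookup (msum \<kappa> m) y = (\<Sum>x\<in>keys m. lookup m x * lookup (\<kappa> x) y)"
    by (simp add: msum_def lookup_sum)
  also have "\<dots> = (\<Sum>x\<in>A. lookup m x * lookup (\<kappa> x) y)"
    using assms by (intro sum.mono_neutral_left) (auto simp: in_keys_iff)
  finally show ?thesis .
qed

lemma monom_subst_monomials:
  assumes "\<And>x. x \<in> keys m \<Longrightarrow> s x = single (\<kappa> x) (1 :: 'k::comm_ring_1)"
  shows "monom_subst s m = single (msum \<kappa> m) 1"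
proof -
  have pw: "single a (1 :: 'k) ^ k = single (\<Sum>_<k. a) 1" for a :: "'b \<Rightarrow>\<^sub>0 nat" and k
    by (induction k) (auto simp: mult_single add.commute)
  have pr: "(\<Prod>x\<in>A. single (f x) (1 :: 'k)) = single (sum f A) 1"
    for f :: "'a \<Rightarrow> 'b \<Rightarrow>\<^sub>0 nat" and A
    by (induction A rule: infinite_finite_induct) (auto simp: mult_single)
  have "monom_subst s m = (\<Prod>x\<in>keys m. single (\<Sum>_<lookup m x. \<kappa> x) 1)"
    unfolding monom_subst_def by (intro prod.cong) (auto simp: assms pw)
  then show ?thesis by (simp add: pr msum_def)
qed

text \<open>Distinct terms are sent to distinct monomials, so nothing can cancel.\<close>

lemma subst_monomials_eq_0:
  assumes s: "\<And>m x. m \<in> keys p \<Longrightarrow> x \<in> keys m \<Longrightarrow> s x = single (\<kappa> x) (1 :: 'k::comm_ring_1)"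
    and inj: "inj_on (msum \<kappa>) (keys p)" and 0: "subst s p = 0"
  shows "p = 0"
proof (rule ccontr)
  assume "p \<noteq> 0"
  then obtain m where m: "m \<in> keys p" by fastforce
  have "subst s p = (\<Sum>m\<in>keys p. single (msum \<kappa> m) (lookup p m))"
    unfolding subst_def
    by (intro sum.cong refl) (use s in \<open>simp add: monom_subst_monomials mult_single\<close>)
  then have "lookup (subst s p) (msum \<kappa> m) = (\<Sum>m'\<in>keys p. lookup p m' when msum \<kappa> m' = msum \<kappa> m)"
    by (simp add: lookup_sum lookup_single)
  also have "\<dots> = (\<Sum>m'\<in>keys p. if m' = m then lookup p m' else 0)"
    using inj m by (intro sum.cong) (auto simp: when_def dest: inj_onD)
  also have "\<dots> = lookup p m" using m by simp
  finally show False using 0 m by (simp add: in_keys_iff)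
qed

lemma single_mult_eq_0:
  assumes "single a (1 :: 'k::comm_ring_1) * p = (0 :: ('v, 'k) mvpoly)"
  shows "p = 0"
proof (rule ccontr)
  assume "p \<noteq> 0"
  then obtain m where m: "m \<in> keys p" by fastforce
  have "single a 1 * p = (\<Sum>m\<in>keys p. single (a + m) (lookup p m))"
    by (subst poly_mapping_sum_single[of p]) (simp add: sum_distrib_left mult_single)
  then have "lookup (single a 1 * p) (a + m) = (\<Sum>m'\<in>keys p. if m' = m then lookup p m' else 0)"
    by (simp add: lookup_sum lookup_single when_def)
  then show False using assms m by (simp add: in_keys_iff)
qed

text \<open>The adjugate turns the kernel vector into \<open>det A\<close> times its first entry,
  and multiplication by a monomial is injective.\<close>

lemma det_eq_0_of_kernel:
  fixes A :: "('v, 'k::comm_ring_1) mvpoly mat"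
  assumes A: "A \<in> carrier_mat d d" and d: "0 < d"
    and ker: "\<And>i. i < d \<Longrightarrow> (\<Sum>j = 0..<d. A $$ (i, j) * single (e j) 1) = 0"
  shows "det A = 0"
proof -
  define x where "x = vec d (\<lambda>j. single (e j) (1 :: 'k))"
  have x: "x \<in> carrier_vec d" by (simp add: x_def)
  have "A *\<^sub>v x = 0\<^sub>v d"
    using A ker by (intro eq_vecI) (auto simp: x_def scalar_prod_def)
  then have "adj_mat A *\<^sub>v (A *\<^sub>v x) = 0\<^sub>v d"
    using adj_mat(1)[OF A] by (intro eq_vecI) (auto simp: scalar_prod_def)
  then have "(det A \<cdot>\<^sub>m 1\<^sub>m d) *\<^sub>v x = 0\<^sub>v d"
    using adj_mat[OF A] A x by (metis assoc_mult_mat_vec)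
  then have "((det A \<cdot>\<^sub>m 1\<^sub>m d) *\<^sub>v x) $ 0 = 0" using d by simp
  moreover have "((det A \<cdot>\<^sub>m 1\<^sub>m d) *\<^sub>v x) $ 0 = det A * x $ 0"
  proof -
    have "((det A \<cdot>\<^sub>m 1\<^sub>m d) *\<^sub>v x) $ 0 = (\<Sum>i = 0..<d. (if i = 0 then det A else 0) * x $ i)"
      using d x by (auto simp: scalar_prod_def intro!: sum.cong)
    also have "\<dots> = (\<Sum>i = 0..<d. if i = 0 then det A * x $ i else 0)" by (intro sum.cong) auto
    also have "\<dots> = det A * x $ 0" using d by (simp add: sum.delta)
    finally show ?thesis .
  qed
  ultimately have "single (e 0) 1 * det A = 0" using d by (simp add: x_def mult.commute)
  then show ?thesis by (rule single_mult_eq_0)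
qed

lemma comm_ring_hom_subst: "comm_ring_hom (subst s)"
  by unfold_locales (simp_all add: subst_add subst_mult)

section \<open>The ideal of the diagonals at a prime\<close>

lemma xy_pvar: "xy i j = pvar (X i) * pvar (Y j)"
  by (simp add: xy_def pvar_def mult_single)

lemma subst_pvar_id: "subst pvar p = p"
proof -
  have "monom_subst pvar m = single m (1 :: 'b)" for m :: "'a \<Rightarrow>\<^sub>0 nat"
  proof -
    have "msum (\<lambda>v. single v 1) m = m"
    proof (rule poly_mapping_eqI)
      fix k
      have "lookup (msum (\<lambda>v. single v 1) m) k = (\<Sum>x\<in>keys m. if x = k then lookup m x else 0)"
        unfolding lookup_msum[OF finite_keys subset_refl]
        by (intro sum.cong) (auto simp: lookup_single when_def)
      then show "lookup (msum (\<lambda>v. single v 1) m) k = lookup m k"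
        by (simp add: in_keys_iff)
    qed
    then show ?thesis using monom_subst_monomials[of m pvar "\<lambda>v. single v 1"]
      by (simp add: pvar_def)
  qed
  then show ?thesis
    unfolding subst_def by (subst (3) poly_mapping_sum_single) (simp add: mult_single)
qed

locale ferrers_prime = ferrers +
  fixes P :: "('k::field) mpoly set"
  assumes P: "prime_in RR P" and II_P: "II \<subseteq> P"
begin

text \<open>\<open>X i0\<close> and \<open>Y j0\<close> are the first variables outside
  \<open>P\<close>, that is, units at \<open>P\<close>; the index is one past the end if there is
  none. \<open>i1\<close> counts the rows that reach column \<open>j0\<close> and \<open>j1\<close>
  the columns that reach row \<open>i0\<close>; their variables turn out to lie in the local
  ideal.\<close>

definition "i0 = (LEAST i. 1 \<le> i \<and> (i \<le> n \<longrightarrow> pvar (X i) \<notin> P))"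
definition "j0 = (LEAST j. 1 \<le> j \<and> (j \<le> lam 1 \<longrightarrow> pvar (Y j) \<notin> P))"
definition "i1 = Max (insert 0 {i. 1 \<le> i \<and> i \<le> n \<and> j0 \<le> lam i})"
definition "j1 = (if i0 \<le> n then lam i0 else 0)"

lemma PI: "ideal_in RR P"
  by (rule prime_inD(1)[OF P])

lemma i0: "1 \<le> i0" "i0 \<le> n \<Longrightarrow> pvar (X i0) \<notin> P"
  and i0_less: "1 \<le> i \<Longrightarrow> i < i0 \<Longrightarrow> i \<le> n \<and> pvar (X i) \<in> P"
proof -
  have "1 \<le> i0 \<and> (i0 \<le> n \<longrightarrow> pvar (X i0) \<notin> P)"
    unfolding i0_def by (rule LeastI[of _ "n + 1"]) simp
  then show "1 \<le> i0" "i0 \<le> n \<Longrightarrow> pvar (X i0) \<notin> P" by auto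
  show "i \<le> n \<and> pvar (X i) \<in> P" if "1 \<le> i" "i < i0"
    using not_less_Least[OF that(2)[unfolded i0_def]] that(1) by auto
qed

lemma j0: "1 \<le> j0" "j0 \<le> lam 1 \<Longrightarrow> pvar (Y j0) \<notin> P"
  and j0_less: "1 \<le> j \<Longrightarrow> j < j0 \<Longrightarrow> j \<le> lam 1 \<and> pvar (Y j) \<in> P"
proof -
  have "1 \<le> j0 \<and> (j0 \<le> lam 1 \<longrightarrow> pvar (Y j0) \<notin> P)"
    unfolding j0_def by (rule LeastI[of _ "lam 1 + 1"]) simp
  then show "1 \<le> j0" "j0 \<le> lam 1 \<Longrightarrow> pvar (Y j0) \<notin> P" by auto
  show "j \<le> lam 1 \<and> pvar (Y j) \<in> P" if "1 \<le> j" "j < j0"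
    using not_less_Least[OF that(2)[unfolded j0_def]] that(1) by auto
qed

lemma le_i1_iff: "1 \<le> i \<Longrightarrow> i \<le> i1 \<longleftrightarrow> i \<le> n \<and> j0 \<le> lam i"
proof -
  assume i: "1 \<le> i"
  let ?S = "{i. 1 \<le> i \<and> i \<le> n \<and> j0 \<le> lam i}"
  have "finite ?S" by simp
  then have "i1 = 0 \<or> i1 \<in> ?S" "i \<in> ?S \<Longrightarrow> i \<le> i1"
    using Max_in[of "insert 0 ?S"] unfolding i1_def by (auto intro: Max_ge)
  then show ?thesis using i lam_noninc[of i i1] by auto
qed

lemma le_j1_iff: "1 \<le> j \<Longrightarrow> j \<le> j1 \<longleftrightarrow> i0 \<le> n \<and> j \<le> lam i0"
  by (auto simp: j1_def)

lemma pvar_RR: "v \<in> ferrers_vars n lam \<Longrightarrow> pvar v \<in> (RR :: 'k mpoly set)"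
  unfolding pvar_def by (rule single_RR) simp

lemma cell_vars: "(i, j) \<in> cells \<Longrightarrow> X i \<in> ferrers_vars n lam \<and> Y j \<in> ferrers_vars n lam"
  by (auto simp: ferrers_vars_def dest: cells_le)

lemma cell_in_P: "(i, j) \<in> cells \<Longrightarrow> pvar (X i) \<in> P \<or> pvar (Y j) \<in> P"
proof -
  assume c: "(i, j) \<in> cells"
  have "xy i j \<in> (II :: 'k mpoly set)"
    using cmon_monom_ideal[of "{#(i, j)#}" 1] c by (simp add: II_eq cmon_single cellmons_def)
  then have "pvar (X i) * pvar (Y j) \<in> P" using II_P by (auto simp: xy_pvar)
  then show ?thesis using prime_inD(3)[OF P] pvar_RR cell_vars[OF c] by blast
qed

text \<open>Otherwise \<open>(i0, j0)\<close> would be a cell, and its generator would lie in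
  \<open>P\<close> without either factor doing so.\<close>

lemma i1_less_i0: "i1 < i0"
proof (rule ccontr)
  assume "\<not> i1 < i0"
  then have a: "i0 \<le> n" "j0 \<le> lam i0" using i0(1) le_i1_iff[of i0] by auto
  then have c: "(i0, j0) \<in> cells" using i0(1) j0(1) by (intro cellsI)
  have "pvar (X i0) \<notin> P" "pvar (Y j0) \<notin> P" using i0(2) j0(2) a cells_le[OF c] by auto
  then show False using cell_in_P[OF c] by blast
qed

lemma j1_less_j0: "j1 < j0"
proof (rule ccontr)
  assume "\<not> j1 < j0"
  then have "i0 \<le> n" "j0 \<le> lam i0" using j0(1) le_j1_iff[of j0] by auto
  then show False using le_i1_iff[OF i0(1)] i1_less_i0 by auto
qed

lemma cell_column_less: "(i, j) \<in> cells \<Longrightarrow> i1 < i \<Longrightarrow> j < j0"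
  using le_i1_iff[of i] cells_le[of i j] by force

lemma cell_row_less: "(i, j) \<in> cells \<Longrightarrow> j1 < j \<Longrightarrow> i < i0"
  using lam_noninc[of i0 i] i0(1) cells_le[of i j] unfolding j1_def by (force split: if_splits)

abbreviation "DD \<equiv> diag_reduction n lam :: 'k mpoly set"
abbreviation "LL \<equiv> saturation RR P DD"

lemma ideal_LL: "ideal_in RR LL"
  by (rule ideal_in_saturation[OF subring_RR P ideal_in_diag])

lemma LL_saturated: "u \<in> RR \<Longrightarrow> u \<notin> P \<Longrightarrow> f \<in> RR \<Longrightarrow> u * f \<in> LL \<Longrightarrow> f \<in> LL"
  by (rule saturation_saturated[OF subring_RR P])

lemma diag_DD: "diag c \<in> DD"
proof (cases "dcells c = {}")
  case True
  then show ?thesis using ideal_inD(2)[OF ideal_in_diag] by (simp add: diag_def)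
next
  case False
  then obtain z where "z \<in> cells" "colour z = c" by (auto simp: dcells_def)
  then show ?thesis using colour_of_cell[of z] by (auto intro: diag_mem)
qed

lemma diag_LL: "diag c \<in> LL"
  using diag_DD[of c] ideal_inD(1)[OF ideal_in_diag] is_subringD(2)[OF subring_RR] prime_inD(2)[OF P]
  by (auto simp: saturation_def intro!: bexI[of _ 1])

text \<open>The diagonals through column \<open>j0\<close> in rows 1 to \<open>i1\<close> meet no
  later rows, so they are linear in \<open>X 1\<close> to \<open>X i1\<close>. The coefficient of
  \<open>X i\<close> on the diagonal through \<open>(i, j0)\<close> is \<open>Y j0\<close>, outside
  \<open>P\<close>; the coefficients of earlier rows are variables \<open>Y j\<close> with
  \<open>j < j0\<close>, in \<open>P\<close>. Hence the system is triangular modulo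
  \<open>P\<close>.\<close>

lemma X_LL:
  assumes "1 \<le> i" "i \<le> i1"
  shows "pvar (X i) \<in> LL"
proof -
  \<comment> \<open>A truncated difference gives column 0, which is not a cell, so the entry is 0 as
    it should be.\<close>
  define a where "a k l = (if (Suc l, l + j0 - k) \<in> cells then pvar (Y (l + j0 - k)) else 0 :: 'k mpoly)" for k l
  have "pvar (X (Suc (i - 1))) \<in> LL"
  proof (rule triangular_system[OF subring_RR P ideal_LL, where s = i1 and a = a and q = "\<lambda>k. pvar (X (Suc k))"])
    fix u f assume "u \<in> RR" "u \<notin> P" "f \<in> RR" "u * f \<in> LL"
    then show "f \<in> LL" by (rule LL_saturated)
  next
    fix k l
    show "a k l \<in> RR" using cell_vars pvar_RR is_subringD(1)[OF subring_RR] by (auto simp: a_def)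
  next
    fix k assume k: "k < i1"
    then show "pvar (X (Suc k)) \<in> (RR :: 'k mpoly set)"
      using le_i1_iff[of "Suc k"] by (intro pvar_RR) (auto simp: ferrers_vars_def)
    have c: "(Suc k, j0) \<in> cells" using k le_i1_iff[of "Suc k"] j0(1) by (intro cellsI) auto
    then show "a k k \<notin> P" using j0(2) cells_le[OF c] by (simp add: a_def)
    have "dcells (int j0 - int (Suc k)) = (\<lambda>l. (Suc l, l + j0 - k)) ` {l \<in> {..<i1}. (Suc l, l + j0 - k) \<in> cells}"
    proof (intro equalityI subsetI)
      fix z assume "z \<in> dcells (int j0 - int (Suc k))"
      then have z: "(fst z, snd z) \<in> cells" "colour z = int j0 - int (Suc k)" by (auto simp: dcells_def)
      note zl = cells_le[OF z(1)]
      have "fst z \<le> i1"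
      proof (cases "fst z \<le> k")
        case False
        then have "j0 \<le> snd z" using z(2) by linarith
        then show ?thesis using zl le_i1_iff[of "fst z"] by linarith
      qed (use k in simp)
      moreover have "z = (Suc (fst z - 1), fst z - 1 + j0 - k)" using z(2) zl by (simp add: prod_eq_iff)
      ultimately show "z \<in> (\<lambda>l. (Suc l, l + j0 - k)) ` {l \<in> {..<i1}. (Suc l, l + j0 - k) \<in> cells}"
        using z(1) zl by (intro image_eqI[of _ _ "fst z - 1"]) auto
    next
      fix z assume "z \<in> (\<lambda>l. (Suc l, l + j0 - k)) ` {l \<in> {..<i1}. (Suc l, l + j0 - k) \<in> cells}"
      then obtain l where l: "z = (Suc l, l + j0 - k)" "(Suc l, l + j0 - k) \<in> cells" by blast
      then have "1 \<le> l + j0 - k" using cells_le by blast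
      then show "z \<in> dcells (int j0 - int (Suc k))" using l by (simp add: dcells_def)
    qed
    then have "diag (int j0 - int (Suc k)) = (\<Sum>l\<in>{l \<in> {..<i1}. (Suc l, l + j0 - k) \<in> cells}. xy (Suc l) (l + j0 - k) :: 'k mpoly)"
      by (simp add: diag_def sum.reindex inj_on_def)
    also have "\<dots> = (\<Sum>l<i1. a k l * pvar (X (Suc l)))"
      by (subst sum.inter_filter) (auto simp: a_def xy_pvar mult.commute intro!: sum.cong)
    finally show "(\<Sum>l<i1. a k l * pvar (X (Suc l))) \<in> LL" using diag_LL by metis
  next
    fix k l assume kl: "k < i1" "l < k"
    show "a k l \<in> P"
    proof (cases "(Suc l, l + j0 - k) \<in> cells")
      case True
      then show ?thesis using cells_le[OF True] j0_less[of "l + j0 - k"] kl by (auto simp: a_def)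
    qed (simp add: a_def ideal_inD(2)[OF PI])
  qed (use assms in auto)
  then show ?thesis using assms by simp
qed

text \<open>The transpose of \<open>X_LL\<close>, using the diagonals through row
  \<open>i0\<close>.\<close>

lemma Y_LL:
  assumes "1 \<le> j" "j \<le> j1"
  shows "pvar (Y j) \<in> LL"
proof -
  define a where "a k l = (if (l + i0 - k, Suc l) \<in> cells then pvar (X (l + i0 - k)) else 0 :: 'k mpoly)" for k l
  have "pvar (Y (Suc (j - 1))) \<in> LL"
  proof (rule triangular_system[OF subring_RR P ideal_LL, where s = j1 and a = a and q = "\<lambda>k. pvar (Y (Suc k))"])
    fix u f assume "u \<in> RR" "u \<notin> P" "f \<in> RR" "u * f \<in> LL"
    then show "f \<in> LL" by (rule LL_saturated)
  next
    fix k l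
    show "a k l \<in> RR" using cell_vars pvar_RR is_subringD(1)[OF subring_RR] by (auto simp: a_def)
  next
    fix k assume k: "k < j1"
    then have c: "(i0, Suc k) \<in> cells" using le_j1_iff[of "Suc k"] i0(1) by (intro cellsI) auto
    then show "pvar (Y (Suc k)) \<in> (RR :: 'k mpoly set)" using cell_vars by (intro pvar_RR) auto
    show "a k k \<notin> P" using c i0(2) cells_le[OF c] by (simp add: a_def)
    have "dcells (int (Suc k) - int i0) = (\<lambda>l. (l + i0 - k, Suc l)) ` {l \<in> {..<j1}. (l + i0 - k, Suc l) \<in> cells}"
    proof (intro equalityI subsetI)
      fix z assume "z \<in> dcells (int (Suc k) - int i0)"
      then have z: "(fst z, snd z) \<in> cells" "colour z = int (Suc k) - int i0" by (auto simp: dcells_def)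
      note zl = cells_le[OF z(1)]
      have "snd z \<le> j1"
      proof (rule ccontr)
        assume "\<not> snd z \<le> j1"
        then have "fst z < i0" "k < snd z" using cell_row_less[OF z(1)] k by auto
        then show False using z(2) by linarith
      qed
      moreover have "z = (snd z - 1 + i0 - k, Suc (snd z - 1))" using z(2) zl by (simp add: prod_eq_iff)
      ultimately show "z \<in> (\<lambda>l. (l + i0 - k, Suc l)) ` {l \<in> {..<j1}. (l + i0 - k, Suc l) \<in> cells}"
        using z(1) zl by (intro image_eqI[of _ _ "snd z - 1"]) auto
    next
      fix z assume "z \<in> (\<lambda>l. (l + i0 - k, Suc l)) ` {l \<in> {..<j1}. (l + i0 - k, Suc l) \<in> cells}"
      then obtain l where l: "z = (l + i0 - k, Suc l)" "(l + i0 - k, Suc l) \<in> cells" by blast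
      then have "1 \<le> l + i0 - k" using cells_le by blast
      then show "z \<in> dcells (int (Suc k) - int i0)" using l by (simp add: dcells_def)
    qed
    then have "diag (int (Suc k) - int i0) = (\<Sum>l\<in>{l \<in> {..<j1}. (l + i0 - k, Suc l) \<in> cells}. xy (l + i0 - k) (Suc l) :: 'k mpoly)"
      by (simp add: diag_def sum.reindex inj_on_def)
    also have "\<dots> = (\<Sum>l<j1. a k l * pvar (Y (Suc l)))"
      by (subst sum.inter_filter) (auto simp: a_def xy_pvar intro!: sum.cong)
    finally show "(\<Sum>l<j1. a k l * pvar (Y (Suc l))) \<in> LL" using diag_LL by metis
  next
    fix k l assume kl: "k < j1" "l < k"
    show "a k l \<in> P"
    proof (cases "(l + i0 - k, Suc l) \<in> cells")
      case True
      then show ?thesis using cells_le[OF True] i0_less[of "l + i0 - k"] kl by (auto simp: a_def)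
    qed (simp add: a_def ideal_inD(2)[OF PI])
  qed (use assms in auto)
  then show ?thesis using assms by simp
qed

text \<open>Locally at \<open>P\<close>, the ideal of the diagonals is generated by the variables of the first \<open>i1\<close>
  rows and \<open>j1\<close> columns together with the diagonals of the remaining Ferrers diagram. These local
  generators are indexed by the variables in \<open>gens\<close>: a variable past row \<open>i1\<close> or column \<open>j1\<close> stands
  for the diagonal through its cell in the hook of the remaining diagram.\<close>

definition inner_diag :: "int \<Rightarrow> 'k mpoly" where
  "inner_diag c = (\<Sum>z\<in>{z \<in> dcells c. i1 < fst z \<and> j1 < snd z}. xy (fst z) (snd z))"

definition gens :: "var set" where
  "gens = {X i | i. 1 \<le> i \<and> i \<le> i1 \<or> i1 + 2 \<le> i \<and> (i, j1 + 1) \<in> cells}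
     \<union> {Y j | j. 1 \<le> j \<and> j \<le> j1 \<or> j1 + 1 \<le> j \<and> (i1 + 1, j) \<in> cells}"

definition local_gen :: "var \<Rightarrow> 'k mpoly" where
  "local_gen v = (case v of
     X i \<Rightarrow> if i \<le> i1 then pvar (X i) else inner_diag (colour (i, j1 + 1))
   | Y j \<Rightarrow> if j \<le> j1 then pvar (Y j) else inner_diag (colour (i1 + 1, j)))"

text \<open>The initial term of a local generator: the variable itself, or the cell in which the
  diagonal enters the remaining diagram.\<close>

definition init_expo :: "var \<Rightarrow> var \<Rightarrow>\<^sub>0 nat" where
  "init_expo v = (case v of
     X i \<Rightarrow> if i \<le> i1 then single (X i) 1 else expo {#(i, j1 + 1)#}
   | Y j \<Rightarrow> if j \<le> j1 then single (Y j) 1 else expo {#(i1 + 1, j)#})"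

lemma gens_vars: "gens \<subseteq> ferrers_vars n lam"
  using le_i1_iff le_j1_iff lam_noninc[of 1 i0] i0(1) cell_vars
  by (fastforce simp: gens_def ferrers_vars_def)

lemma finite_gens: "finite gens"
  by (rule finite_subset[OF gens_vars], rule finite_subset[of _ "X ` {1..n} \<union> Y ` {1..lam 1}"])
     (auto simp: ferrers_vars_def)

lemma xy_LL: "(i, j) \<in> cells \<Longrightarrow> i \<le> i1 \<or> j \<le> j1 \<Longrightarrow> xy i j \<in> LL"
  using X_LL[of i] Y_LL[of j] cells_le[of i j] cell_vars[of i j] pvar_RR
  unfolding xy_pvar by (auto intro: ideal_inD(4,5)[OF ideal_LL])

lemma inner_diag_LL: "inner_diag c \<in> LL"
proof -
  let ?A = "{z \<in> dcells c. i1 < fst z \<and> j1 < snd z}"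
  have "xy (fst z) (snd z) \<in> LL" if "z \<in> dcells c - ?A" for z
    using that by (intro xy_LL) (auto simp: dcells_def)
  then have "diag c - (\<Sum>z\<in>dcells c - ?A. xy (fst z) (snd z)) \<in> LL"
    by (intro ideal_in_diff[OF subring_RR ideal_LL] diag_LL ideal_in_sum[OF ideal_LL])
  moreover have "diag c = (\<Sum>z\<in>dcells c - ?A. xy (fst z) (snd z)) + inner_diag c"
    unfolding diag_def inner_diag_def by (rule sum.subset_diff) (auto simp: finite_dcells)
  ultimately show ?thesis by simp
qed

lemma local_gen_LL: "v \<in> gens \<Longrightarrow> local_gen v \<in> LL"
  using X_LL Y_LL inner_diag_LL by (auto simp: gens_def local_gen_def)

lemma local_gen_RR: "v \<in> gens \<Longrightarrow> local_gen v \<in> RR"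
  using local_gen_LL ideal_inD(1)[OF ideal_LL] by blast

text \<open>The diagonal is followed upwards to row \<open>i1 + 1\<close> or column
  \<open>j1 + 1\<close>. The corner of the hook, where both happen, is named by
  \<open>Y (j1 + 1)\<close>, which is why the hook rows in \<open>gens\<close> start at
  \<open>i1 + 2\<close>.\<close>

lemma hook_of_diagonal:
  assumes z: "z \<in> dcells c" "i1 < fst z" "j1 < snd z"
  shows "\<exists>v\<in>gens. local_gen v = inner_diag c"
proof -
  have zc: "(fst z, snd z) \<in> cells" "colour z = c" using z(1) by (auto simp: dcells_def)
  show ?thesis
  proof (cases "fst z - i1 \<le> snd z - j1")
    case True
    define j where "j = snd z - (fst z - (i1 + 1))"
    have j: "j1 + 1 \<le> j" "colour (i1 + 1, j) = c" "(i1 + 1, j) \<in> cells"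
      unfolding j_def using True z zc(2) by (auto intro!: cells_down[OF zc(1)])
    have "Y j \<in> gens" "local_gen (Y j) = inner_diag c"
      using j(1,3) j(2)[symmetric] by (auto simp: gens_def local_gen_def)
    then show ?thesis by blast
  next
    case False
    define i where "i = fst z - (snd z - (j1 + 1))"
    have i: "i1 + 2 \<le> i" "colour (i, j1 + 1) = c" "(i, j1 + 1) \<in> cells"
      unfolding i_def using False z zc(2) by (auto intro!: cells_down[OF zc(1)])
    have "X i \<in> gens" "local_gen (X i) = inner_diag c"
      using i(1,3) i(2)[symmetric] by (auto simp: gens_def local_gen_def)
    then show ?thesis by blast
  qed
qed

text \<open>A cell outside the remaining diagram contains one of the variables in
  \<open>gens\<close>, so a diagonal is a combination of these plus its inner part.\<close>

lemma DD_local_gens: "DD \<subseteq> gen_ideal RR (local_gen ` gens)"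
proof -
  let ?G = "gen_ideal RR (local_gen ` gens)"
  have G: "ideal_in RR ?G" by (rule ideal_in_gen_ideal[OF subring_RR]) (use local_gen_RR in blast)
  have mem: "local_gen v \<in> ?G" if "v \<in> gens" for v using that gen_ideal_superset by blast
  have xyG: "xy i j \<in> ?G" if c: "(i, j) \<in> cells" and ij: "i \<le> i1 \<or> j \<le> j1" for i j
  proof (cases "i \<le> i1")
    case True
    then have "pvar (X i) \<in> ?G" using mem[of "X i"] cells_le[OF c] by (auto simp: gens_def local_gen_def)
    then show ?thesis unfolding xy_pvar using cell_vars[OF c] pvar_RR by (intro ideal_inD(5)[OF G]) auto
  next
    case False
    then have "pvar (Y j) \<in> ?G" using mem[of "Y j"] cells_le[OF c] ij by (auto simp: gens_def local_gen_def)
    then show ?thesis unfolding xy_pvar using cell_vars[OF c] pvar_RR by (intro ideal_inD(4)[OF G]) auto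
  qed
  have "diag c \<in> ?G" for c
  proof -
    let ?A = "{z \<in> dcells c. i1 < fst z \<and> j1 < snd z}"
    have 1: "(\<Sum>z\<in>dcells c - ?A. xy (fst z) (snd z)) \<in> ?G"
      by (rule ideal_in_sum[OF G], rule xyG) (auto simp: dcells_def)
    have 2: "inner_diag c \<in> ?G"
    proof (cases "?A = {}")
      case True
      then show ?thesis unfolding inner_diag_def True using ideal_inD(2)[OF G] by simp
    next
      case False
      then obtain z where "z \<in> dcells c" "i1 < fst z" "j1 < snd z" by blast
      then obtain v where v: "v \<in> gens" "local_gen v = inner_diag c" using hook_of_diagonal by blast
      show ?thesis using mem[OF v(1)] v(2) by simp
    qed
    have "diag c = (\<Sum>z\<in>dcells c - ?A. xy (fst z) (snd z)) + inner_diag c"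
      unfolding diag_def inner_diag_def by (rule sum.subset_diff) (auto simp: finite_dcells)
    then show ?thesis using ideal_inD(3)[OF G 1 2] by simp
  qed
  then show ?thesis unfolding diag_reduction_eq by (intro gen_ideal_least[OF G]) auto
qed

section \<open>Analytic independence\<close>

text \<open>Chosen so that every local generator has weight \<open>2 * M\<close> up to an error
  independent of \<open>M\<close>, while a variable of positive weight weighs at least
  \<open>M\<close> and lies in \<open>P\<close>. The squares make the hook cell the lightest of its
  diagonal.\<close>

definition weight :: "nat \<Rightarrow> var \<Rightarrow> nat" where
  "weight M v = (case v of
     X i \<Rightarrow> if i \<le> i1 then 2 * M else if i < i0 then M + (i - i1)\<^sup>2 else 0
   | Y j \<Rightarrow> if j \<le> j1 then 2 * M else if j < j0 then M + (j - j1)\<^sup>2 else 0)"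

lemma weight_pos_P: "v \<in> ferrers_vars n lam \<Longrightarrow> 0 < weight M v \<Longrightarrow> pvar v \<in> P"
  using i0_less j0_less i1_less_i0 j1_less_j0
  by (auto simp: ferrers_vars_def weight_def split: if_splits)

lemma weight_pos_ge: "0 < weight M v \<Longrightarrow> M \<le> weight M v"
  by (auto simp: weight_def split: var.splits if_splits)

lemma inner_cell_weight:
  assumes "(i, j) \<in> cells" "i1 < i" "j1 < j"
  shows "weight M (X i) + weight M (Y j) = 2 * M + (i - i1)\<^sup>2 + (j - j1)\<^sup>2"
  using assms cell_row_less[of i j] cell_column_less[of i j] by (simp add: weight_def)

text \<open>Along a diagonal both coordinates grow together, so every other inner cell has both
  squares larger than the hook cell.\<close>

lemma inner_diag_initial:
  fixes a b M :: nat
  assumes h: "(a, b) \<in> cells" "i1 < a" "j1 < b" "a = i1 + 1 \<or> b = j1 + 1"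
  defines "d \<equiv> weight M (X a) + weight M (Y b)"
  shows "ordge (weight M) d (inner_diag (colour (a, b)))"
    and "wcomp (weight M) d (inner_diag (colour (a, b))) = single (expo {#(a, b)#}) 1"
proof -
  let ?A = "{z \<in> dcells (colour (a, b)). i1 < fst z \<and> j1 < snd z}"
  have d: "d = 2 * M + (a - i1)\<^sup>2 + (b - j1)\<^sup>2" unfolding d_def by (rule inner_cell_weight[OF h(1-3)])
  have xy: "xy i j = (single (expo {#(i, j)#}) 1 :: 'k mpoly)" for i j
    by (simp add: xy_def expo_add_mset)
  have ge: "d < weight M (X (fst z)) + weight M (Y (snd z))" if z: "z \<in> ?A" "z \<noteq> (a, b)" for z
  proof -
    have zc: "(fst z, snd z) \<in> cells" "colour z = colour (a, b)" "i1 < fst z" "j1 < snd z"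
      using z(1) by (auto simp: dcells_def)
    have "a < fst z" "b < snd z" using zc(2,3,4) z(2) h(4) by (auto simp: prod_eq_iff)
    then have "(a - i1)\<^sup>2 < (fst z - i1)\<^sup>2" "(b - j1)\<^sup>2 < (snd z - j1)\<^sup>2"
      using h(2,3) by (auto intro!: power_strict_mono)
    then show ?thesis unfolding d inner_cell_weight[OF zc(1,3,4)] by simp
  qed
  have ab: "(a, b) \<in> ?A" using h by (simp add: dcells_def)
  have fin: "finite ?A" using finite_dcells by simp
  have "ordge (weight M) d (xy (fst z) (snd z) :: 'k mpoly)" if "z \<in> ?A" for z
    using ge[OF that] d_def by (cases "z = (a, b)") (auto simp: xy ordge_def wt_expo)
  then show "ordge (weight M) d (inner_diag (colour (a, b)))"
    unfolding inner_diag_def by (rule ordge_sum)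
  have "wcomp (weight M) d (inner_diag (colour (a, b)))
      = (\<Sum>z\<in>?A. if z = (a, b) then single (expo {#(a, b)#}) 1 else 0)"
    unfolding inner_diag_def wcomp_sum
    by (intro sum.cong refl) (use ge d_def in \<open>force simp: xy wcomp_single wt_expo\<close>)
  also have "\<dots> = single (expo {#(a, b)#}) 1" using ab fin by (simp add: sum.delta)
  finally show "wcomp (weight M) d (inner_diag (colour (a, b))) = single (expo {#(a, b)#}) 1" .
qed

lemma gens_cases:
  assumes "v \<in> gens"
  obtains (var_row) i where "v = X i" "1 \<le> i" "i \<le> i1" | (var_col) j where "v = Y j" "1 \<le> j" "j \<le> j1"
  | (hook_row) i where "v = X i" "i1 + 2 \<le> i" "i < i0" "j1 + 1 < j0" "(i, j1 + 1) \<in> cells"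
  | (hook_col) j where "v = Y j" "j1 + 1 \<le> j" "j < j0" "i1 + 1 < i0" "(i1 + 1, j) \<in> cells"
  using assms cell_row_less cell_column_less unfolding gens_def by fastforce

lemma local_gen_initial:
  assumes "v \<in> gens"
  shows "ordge (weight M) (wt (weight M) (init_expo v)) (local_gen v)"
    and "wcomp (weight M) (wt (weight M) (init_expo v)) (local_gen v) = single (init_expo v) 1"
proof -
  have "ordge (weight M) (wt (weight M) (init_expo v)) (local_gen v)
    \<and> wcomp (weight M) (wt (weight M) (init_expo v)) (local_gen v) = single (init_expo v) 1"
    using assms
  proof (cases rule: gens_cases)
    case (hook_row i)
    then show ?thesis using inner_diag_initial[of i "j1 + 1" M]
      by (simp add: local_gen_def init_expo_def wt_expo)
  next
    case (hook_col j)
    then show ?thesis using inner_diag_initial[of "i1 + 1" j M]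
      by (simp add: local_gen_def init_expo_def wt_expo)
  qed (auto simp: local_gen_def init_expo_def pvar_def ordge_def wcomp_single)
  then show "ordge (weight M) (wt (weight M) (init_expo v)) (local_gen v)"
    and "wcomp (weight M) (wt (weight M) (init_expo v)) (local_gen v) = single (init_expo v) 1"
    by auto
qed

lemma init_expo_weight:
  assumes "v \<in> gens"
  shows "2 * M \<le> wt (weight M) (init_expo v)" "wt (weight M) (init_expo v) \<le> 2 * M + 2 * (n + lam 1)\<^sup>2"
proof -
  have hook: "2 * M + (i - i1)\<^sup>2 + (j - j1)\<^sup>2 \<le> 2 * M + 2 * (n + lam 1)\<^sup>2" if "(i, j) \<in> cells" for i j
  proof -
    have "(i - i1)\<^sup>2 \<le> (n + lam 1)\<^sup>2" "(j - j1)\<^sup>2 \<le> (n + lam 1)\<^sup>2"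
      using cells_le[OF that] by (auto intro!: power_mono)
    then show ?thesis by linarith
  qed
  have "2 * M \<le> wt (weight M) (init_expo v) \<and> wt (weight M) (init_expo v) \<le> 2 * M + 2 * (n + lam 1)\<^sup>2"
    using assms
  proof (cases rule: gens_cases)
    case (hook_row i)
    then show ?thesis using hook[of i "j1 + 1"] inner_cell_weight[of i "j1 + 1" M]
      by (simp add: init_expo_def wt_expo)
  next
    case (hook_col j)
    then show ?thesis using hook[of "i1 + 1" j] inner_cell_weight[of "i1 + 1" j M]
      by (simp add: init_expo_def wt_expo)
  qed (auto simp: init_expo_def weight_def)
  then show "2 * M \<le> wt (weight M) (init_expo v)" "wt (weight M) (init_expo v) \<le> 2 * M + 2 * (n + lam 1)\<^sup>2"
    by auto
qed

abbreviation "init_sum \<equiv> case_sum (\<lambda>v. single v 1) init_expo"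

text \<open>Ring variables of weight 0; they are the only ones that can occur in coefficients of the
  part of lowest weight.\<close>

definition free_vars :: "var set" where
  "free_vars = {X i | i. i0 \<le> i} \<union> {Y j | j. j0 \<le> j}"

lemma gens_free_vars: "v \<in> gens \<Longrightarrow> v \<notin> free_vars"
  using i1_less_i0 j1_less_j0 by (erule_tac gens_cases) (auto simp: free_vars_def)

text \<open>Initial monomials overlap only along the hook: its row cells share
  \<open>Y (j1 + 1)\<close>, and its column cells share \<open>X (i1 + 1)\<close>.\<close>

lemma lookup_init_expo_other:
  assumes "w \<in> gens" "v \<noteq> w" "lookup (init_expo w) v \<noteq> 0"
  shows "v = Y (j1 + 1) \<and> j1 + 1 < j0 \<or> v = X (i1 + 1) \<and> i1 + 1 < i0"
  using assms(1)
  by (cases rule: gens_cases)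
     (use assms(2,3) in \<open>auto simp: init_expo_def expo_add_mset lookup_add lookup_single when_def split: if_splits\<close>)

text \<open>Every variable other than \<open>Y (j1 + 1)\<close> reads off the exponent of a single generator.\<close>

lemma init_sum_inj:
  "inj_on (msum init_sum) {m. keys m \<subseteq> Inl ` free_vars \<union> Inr ` gens}"
proof (rule inj_onI, safe)
  fix m m' :: "(var + var) \<Rightarrow>\<^sub>0 nat"
  assume m: "keys m \<subseteq> Inl ` free_vars \<union> Inr ` gens" and m': "keys m' \<subseteq> Inl ` free_vars \<union> Inr ` gens"
    and eq: "msum init_sum m = msum init_sum m'"
  define A where "A = keys m \<union> keys m'"
  have A: "finite A" "keys m \<subseteq> A" "keys m' \<subseteq> A" "A \<subseteq> Inl ` free_vars \<union> Inr ` gens"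
    using m m' by (auto simp: A_def)
  have sums: "(\<Sum>x\<in>A. lookup m x * lookup (init_sum x) y) = (\<Sum>x\<in>A. lookup m' x * lookup (init_sum x) y)" for y
    by (simp only: lookup_msum[OF A(1,2), symmetric] lookup_msum[OF A(1,3), symmetric] eq)
  \<comment> \<open>The variable whose exponent detects \<open>x\<close>: the ring variable itself,
    or the variable naming the generator.\<close>
  let ?y = "case_sum id id :: var + var \<Rightarrow> var"
  have self: "lookup (init_sum x) (?y x) = 1" if "x \<in> A" for x
    using that A(4) by (auto simp: init_expo_def expo_add_mset lookup_add lookup_single gens_def split: var.splits)
  have other: "lookup (init_sum x') (?y x) = 0" if x: "x \<in> A" "x \<noteq> Inr (Y (j1 + 1))" and x': "x' \<in> A" "x' \<noteq> x" for x x'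
  proof -
    \<comment> \<open>\<open>X (i1 + 1)\<close> is shared by several initial monomials as well, but
      it names no generator.\<close>
    have nX: "X (i1 + 1) \<notin> gens" by (auto simp: gens_def)
    consider (l) v where "x = Inl v" "v \<in> free_vars" | (r) v where "x = Inr v" "v \<in> gens" "v \<noteq> Y (j1 + 1)"
      using x A(4) by blast
    then show ?thesis
    proof cases
      case l
      consider w where "x' = Inl w" "w \<noteq> v" | w where "x' = Inr w" "w \<in> gens" "w \<noteq> v"
        using x' A(4) l gens_free_vars by blast
      then show ?thesis
      proof cases
        case 2
        have "lookup (init_expo w) v = 0"
          by (rule ccontr) (use lookup_init_expo_other[of w v] 2 l in \<open>auto simp: free_vars_def\<close>)
        then show ?thesis using l 2 by simp
      qed (use l in \<open>simp add: lookup_single when_def\<close>)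
    next
      case r
      consider w where "x' = Inl w" "w \<noteq> v" | w where "x' = Inr w" "w \<in> gens" "w \<noteq> v"
        using x' A(4) r gens_free_vars by blast
      then show ?thesis
      proof cases
        case 2
        have "lookup (init_expo w) v = 0"
          by (rule ccontr) (use lookup_init_expo_other[of w v] 2 r nX in auto)
        then show ?thesis using r 2 by simp
      qed (use r in \<open>simp add: lookup_single when_def\<close>)
    qed
  qed
  have step: "lookup m x = lookup m' x" if x: "x \<in> A" "x \<noteq> Inr (Y (j1 + 1))" for x
  proof -
    have "(\<Sum>x'\<in>A. lookup p x' * lookup (init_sum x') (?y x)) = lookup p x" for p :: "(var + var) \<Rightarrow>\<^sub>0 nat"
    proof -
      have "(\<Sum>x'\<in>A. lookup p x' * lookup (init_sum x') (?y x)) = (\<Sum>x'\<in>A. if x' = x then lookup p x' else 0)"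
        by (intro sum.cong refl) (use self[OF x(1)] other[OF x] in auto)
      then show ?thesis using A(1) x(1) by simp
    qed
    then show ?thesis using sums[of "?y x"] by simp
  qed
  \<comment> \<open>\<open>Y (j1 + 1)\<close> also divides the initial monomials of all hook rows,
    so this exponent is recovered last, after subtracting the others.\<close>
  let ?x = "Inr (Y (j1 + 1)) :: var + var"
  have last: "lookup m ?x = lookup m' ?x" if x: "?x \<in> A"
  proof -
    have "(\<Sum>x\<in>A - {?x}. lookup m x * lookup (init_sum x) (?y ?x)) = (\<Sum>x\<in>A - {?x}. lookup m' x * lookup (init_sum x) (?y ?x))"
      by (intro sum.cong) (use step in auto)
    then show ?thesis using sums[of "?y ?x"] self[OF x] x A(1)
      by (simp add: sum.remove)
  qed
  show "m = m'"
  proof (rule poly_mapping_eqI)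
    fix x show "lookup m x = lookup m' x"
    proof (cases "x \<in> A")
      case True
      then show ?thesis using step last by blast
    next
      case False
      then have "x \<notin> keys m" "x \<notin> keys m'" using A(2,3) by blast+
      then show ?thesis by (simp add: in_keys_iff)
    qed
  qed
qed

definition form_expos :: "nat \<Rightarrow> ((var + var) \<Rightarrow>\<^sub>0 nat) set" where
  "form_expos d = {m. keys m \<subseteq> Inl ` ferrers_vars n lam \<union> Inr ` gens \<and> wt (case_sum (\<lambda>_. 0) (\<lambda>_. 1)) m = d}"

text \<open>\<open>Inl\<close> tags the ring variables and \<open>Inr\<close> the indeterminates of a form. If some coefficient is not in
  \<open>P\<close>, then for large \<open>M\<close> the part of \<open>\<Psi>\<close> of lowest weight has coefficients free of the variables of
  positive weight, and substituting the initial monomials kills it.\<close>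

lemma analytic_independence:
  fixes \<Psi> :: "(var + var, 'k) mvpoly"
  assumes keys: "keys \<Psi> \<subseteq> form_expos d" and 0: "subst (case_sum pvar local_gen) \<Psi> = 0"
    and \<tau>: "\<And>v. v \<in> gens \<Longrightarrow> \<tau> v \<in> RR"
  shows "subst (case_sum pvar \<tau>) \<Psi> \<in> P"
proof (rule ccontr)
  assume nP: "subst (case_sum pvar \<tau>) \<Psi> \<notin> P"
  \<comment> \<open>A single variable of positive weight costs at least \<open>M\<close>, more than
    the whole spread of the weights of \<open>d\<close> generators.\<close>
  define M where "M = Suc (d * (2 * (n + lam 1)\<^sup>2))"
  define w where "w = case_sum (weight M) (\<lambda>v. wt (weight M) (init_expo v))"
  let ?s = "case_sum pvar \<tau> :: var + var \<Rightarrow> 'k mpoly"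
  have sR: "?s x ^ k \<in> RR" if "m \<in> keys \<Psi>" "x \<in> keys m" for m x k
  proof -
    have "x \<in> Inl ` ferrers_vars n lam \<union> Inr ` gens" using that keys by (auto simp: form_expos_def)
    then show ?thesis using \<tau> pvar_RR by (intro is_subring_power[OF subring_RR]) auto
  qed
  \<comment> \<open>Otherwise each term contains a ring variable lying in \<open>P\<close>, and the
    value at \<open>\<tau>\<close> would lie in \<open>P\<close>.\<close>
  have "\<exists>m\<in>keys \<Psi>. \<forall>v. Inl v \<in> keys m \<longrightarrow> weight M v = 0"
  proof (rule ccontr)
    assume no: "\<not> ?thesis"
    have "single 0 (lookup \<Psi> m) * monom_subst ?s m \<in> P" if m: "m \<in> keys \<Psi>" for m
    proof -
      obtain v where v: "Inl v \<in> keys m" "weight M v \<noteq> 0" using no m by blast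
      have "v \<in> ferrers_vars n lam" using v(1) m keys by (auto simp: form_expos_def)
      then have vP: "pvar v \<in> P" "(pvar v :: 'k mpoly) \<in> RR" using v(2) weight_pos_P pvar_RR by auto
      have "monom_subst ?s m = ?s (Inl v) ^ lookup m (Inl v) * (\<Prod>x\<in>keys m - {Inl v}. ?s x ^ lookup m x)"
        unfolding monom_subst_def using v(1) by (intro prod.remove) auto
      moreover have "?s (Inl v) ^ lookup m (Inl v) \<in> P"
      proof -
        obtain k where "lookup m (Inl v) = Suc k" using v(1) by (cases "lookup m (Inl v)") (auto simp: in_keys_iff)
        then show ?thesis using vP is_subring_power[OF subring_RR] by (auto intro: ideal_inD(5)[OF PI])
      qed
      moreover have "(\<Prod>x\<in>keys m - {Inl v}. ?s x ^ lookup m x) \<in> RR"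
        using sR m by (intro is_subring_prod[OF subring_RR]) auto
      ultimately show ?thesis by (auto intro: ideal_inD(4,5)[OF PI] const_RR)
    qed
    then have "subst ?s \<Psi> \<in> P" unfolding subst_def by (rule ideal_in_sum[OF PI])
    with nP show False ..
  qed
  then obtain m0 where m0: "m0 \<in> keys \<Psi>" "\<And>v. Inl v \<in> keys m0 \<Longrightarrow> weight M v = 0" by blast
  define e where "e = Min (wt w ` keys \<Psi>)"
  have e_le: "e \<le> wt w m" if "m \<in> keys \<Psi>" for m unfolding e_def using that by (intro Min_le) auto
  define \<Phi> where "\<Phi> = wcomp w e \<Psi>"
  have deg: "wt (case_sum (\<lambda>_. 0) (\<lambda>_. 1)) m = d" if "m \<in> keys \<Psi>" for m
    using that keys by (auto simp: form_expos_def)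
  have "wt w m0 \<le> (\<Sum>x\<in>keys m0. (2 * M + 2 * (n + lam 1)\<^sup>2) * (case_sum (\<lambda>_. 0) (\<lambda>_. 1) x * lookup m0 x))"
    unfolding wt_def
  proof (rule sum_mono)
    fix x assume x: "x \<in> keys m0"
    then have "x \<in> Inl ` ferrers_vars n lam \<union> Inr ` gens" using m0(1) keys by (auto simp: form_expos_def)
    then show "w x * lookup m0 x \<le> (2 * M + 2 * (n + lam 1)\<^sup>2) * (case_sum (\<lambda>_. 0) (\<lambda>_. 1) x * lookup m0 x)"
      using m0(2) x init_expo_weight(2)[of _ M] by (auto simp: w_def simp del: One_nat_def)
  qed
  also have "\<dots> = (2 * M + 2 * (n + lam 1)\<^sup>2) * d"
    by (simp only: sum_distrib_left[symmetric] wt_def[symmetric] deg[OF m0(1)])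
  also have "\<dots> < 2 * M * d + M" by (simp add: M_def algebra_simps)
  finally have e_less: "e < 2 * M * d + M" using e_le[OF m0(1)] by simp
  have \<Phi>_keys: "keys m \<subseteq> Inl ` free_vars \<union> Inr ` gens" if m: "m \<in> keys \<Phi>" for m
  proof
    fix x assume x: "x \<in> keys m"
    have mk: "m \<in> keys \<Psi>" "wt w m = e" using m by (auto simp: \<Phi>_def keys_wcomp)
    then have sub: "keys m \<subseteq> Inl ` ferrers_vars n lam \<union> Inr ` gens" using keys by (auto simp: form_expos_def)
    show "x \<in> Inl ` free_vars \<union> Inr ` gens"
    proof (cases x)
      case (Inr v)
      then show ?thesis using sub x by auto
    next
      case (Inl v)
      have v: "v \<in> ferrers_vars n lam" using sub x Inl by auto
      have "weight M v = 0"
      proof (rule ccontr)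
        assume pos: "weight M v \<noteq> 0"
        \<comment> \<open>With a variable of positive weight besides its \<open>d\<close>
          generators, the term would weigh at least this much, above the minimum
          \<open>e\<close>.\<close>
        have "2 * M * d + M = (\<Sum>y\<in>keys m. 2 * M * (case_sum (\<lambda>_. 0) (\<lambda>_. 1) y * lookup m y)) + (\<Sum>y\<in>keys m. if y = x then M else 0)"
          using x by (simp add: sum_distrib_left[symmetric] deg[OF mk(1), unfolded wt_def])
        also have "\<dots> = (\<Sum>y\<in>keys m. 2 * M * (case_sum (\<lambda>_. 0) (\<lambda>_. 1) y * lookup m y) + (if y = x then M else 0))"
          by (simp add: sum.distrib)
        also have "\<dots> \<le> wt w m"
          unfolding wt_def
        proof (rule sum_mono)
          fix y assume y: "y \<in> keys m"
          show "2 * M * (case_sum (\<lambda>_. 0) (\<lambda>_. 1) y * lookup m y) + (if y = x then M else 0) \<le> w y * lookup m y"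
          proof (cases y)
            case (Inl u)
            have "M \<le> weight M v * lookup m x"
              using weight_pos_ge[of M v] pos x by (cases "lookup m x") (auto simp: in_keys_iff)
            then show ?thesis using Inl \<open>x = Inl v\<close> by (auto simp: w_def)
          next
            case (Inr u)
            then show ?thesis using init_expo_weight(1)[of u M] sub y \<open>x = Inl v\<close> by (auto simp: w_def)
          qed
        qed
        finally show False using e_less mk(2) by simp
      qed
      then have "v \<in> free_vars" using M_def
        by (cases v) (auto simp: weight_def free_vars_def split: if_splits)
      then show ?thesis using Inl by blast
    qed
  qed
  have "wcomp (weight M) e (subst (case_sum pvar local_gen) \<Psi>)
      = subst (\<lambda>x. wcomp (weight M) (w x) (case_sum pvar local_gen x)) \<Phi>"
    unfolding \<Phi>_def
  proof (rule subst_initial)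
    show "ordge w e \<Psi>" using e_le by (auto simp: ordge_def)
    fix m x assume "m \<in> keys \<Psi>" "x \<in> keys m"
    then have "x \<in> Inl ` ferrers_vars n lam \<union> Inr ` gens" using keys by (auto simp: form_expos_def)
    then show "ordge (weight M) (w x) (case_sum pvar local_gen x)"
      using local_gen_initial(1) by (auto simp: w_def pvar_def ordge_def)
  qed
  then have sub0: "subst (\<lambda>x. wcomp (weight M) (w x) (case_sum pvar local_gen x)) \<Phi> = 0" using 0 by simp
  have ini: "wcomp (weight M) (w x) (case_sum pvar local_gen x) = single (init_sum x) 1"
    if "m \<in> keys \<Phi>" "x \<in> keys m" for m x
    using \<Phi>_keys[OF that(1)] that(2) local_gen_initial(2) by (auto simp: w_def pvar_def wcomp_single)
  have inj: "inj_on (msum init_sum) (keys \<Phi>)"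
    by (rule inj_on_subset[OF init_sum_inj]) (use \<Phi>_keys in blast)
  have "\<Phi> = 0" by (rule subst_monomials_eq_0[OF ini inj sub0])
  have "e \<in> wt w ` keys \<Psi>" unfolding e_def using m0(1) by (intro Min_in) auto
  then obtain m1 where "m1 \<in> keys \<Psi>" "wt w m1 = e" by blast
  then have "m1 \<in> keys \<Phi>" by (simp add: \<Phi>_def keys_wcomp)
  with \<open>\<Phi> = 0\<close> show False by simp
qed

section \<open>Minimality of the diagonals\<close>

definition forms :: "nat \<Rightarrow> (var + var, 'k) mvpoly set" where
  "forms d = {p. keys p \<subseteq> form_expos d}"

lemma forms_zero: "0 \<in> forms d"
  by (simp add: forms_def)

lemma forms_add: "p \<in> forms d \<Longrightarrow> q \<in> forms d \<Longrightarrow> p + q \<in> forms d"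
  using keys_add[of p q] by (auto simp: forms_def)

lemma forms_uminus: "p \<in> forms d \<Longrightarrow> - p \<in> forms d"
  by (simp add: forms_def)

lemma forms_sum: "(\<And>a. a \<in> A \<Longrightarrow> f a \<in> forms d) \<Longrightarrow> sum f A \<in> forms d"
  by (induction A rule: infinite_finite_induct) (auto simp: forms_zero forms_add)

lemma forms_mult: "p \<in> forms d \<Longrightarrow> q \<in> forms e \<Longrightarrow> p * q \<in> forms (d + e)"
proof -
  assume p: "p \<in> forms d" and q: "q \<in> forms e"
  have "m + m' \<in> form_expos (d + e)" if "m \<in> form_expos d" "m' \<in> form_expos e" for m m'
    using that keys_add[of m m'] by (auto simp: form_expos_def)
  then show ?thesis using p q keys_mult[of p q] unfolding forms_def by blast
qed

lemma forms_const: "single 0 c \<in> forms 0"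
  by (auto simp: forms_def form_expos_def)

lemma forms_one: "1 \<in> forms 0"
  using forms_const[of 1] by simp

lemma forms_prod: "finite A \<Longrightarrow> (\<And>a. a \<in> A \<Longrightarrow> f a \<in> forms (d a)) \<Longrightarrow> prod f A \<in> forms (sum d A)"
  by (induction A rule: finite_induct) (auto simp: forms_one forms_mult)

lemma forms_var: "v \<in> ferrers_vars n lam \<Longrightarrow> pvar (Inl v) \<in> forms 0"
  and forms_gen: "v \<in> gens \<Longrightarrow> pvar (Inr v) \<in> forms 1"
  by (auto simp: forms_def form_expos_def pvar_def)

lemma forms_lift: "p \<in> RR \<Longrightarrow> subst (\<lambda>v. pvar (Inl v)) p \<in> forms 0"
proof -
  assume p: "p \<in> RR"
  have pw: "q ^ k \<in> forms 0" if "q \<in> forms 0" for q k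
    by (induction k) (use forms_mult[OF that, of _ 0] forms_one in auto)
  have "single 0 (lookup p m) * monom_subst (\<lambda>v. pvar (Inl v)) m \<in> forms 0" if m: "m \<in> keys p" for m
  proof -
    have "keys m \<subseteq> ferrers_vars n lam" using p m by (auto simp: RR_iff)
    then have "monom_subst (\<lambda>v. pvar (Inl v)) m \<in> forms (sum (\<lambda>_. 0) (keys m))"
      unfolding monom_subst_def by (intro forms_prod pw forms_var) auto
    then show ?thesis using forms_mult[OF forms_const, of _ 0] by simp
  qed
  then show ?thesis unfolding subst_def by (rule forms_sum)
qed

text \<open>A formal lift of a combination of local generators: each generator becomes an
  indeterminate, so that the same form can be evaluated at \<open>local_gen\<close> and at
  \<open>\<tau>\<close>.\<close>

definition linear_form :: "(var \<Rightarrow> 'k mpoly) \<Rightarrow> (var + var, 'k) mvpoly" where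
  "linear_form h = (\<Sum>v\<in>gens. subst (\<lambda>v. pvar (Inl v)) (h v) * pvar (Inr v))"

lemma forms_linear_form: "(\<And>v. v \<in> gens \<Longrightarrow> h v \<in> RR) \<Longrightarrow> linear_form h \<in> forms 1"
  unfolding linear_form_def
proof (rule forms_sum)
  fix v assume "\<And>v. v \<in> gens \<Longrightarrow> h v \<in> RR" "v \<in> gens"
  then show "subst (\<lambda>v. pvar (Inl v)) (h v) * pvar (Inr v) \<in> forms 1"
    using forms_mult[OF forms_lift forms_gen, of "h v" v] by simp
qed

lemma subst_linear_form: "subst (case_sum pvar s) (linear_form h) = (\<Sum>v\<in>gens. h v * s v)"
  by (simp add: linear_form_def subst_sum subst_mult subst_subst subst_pvar_id)

lemma forms_det:
  assumes A: "A \<in> carrier_mat d d" and lin: "\<And>i j. i < d \<Longrightarrow> j < d \<Longrightarrow> A $$ (i, j) \<in> forms 1"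
  shows "det A \<in> forms d"
  unfolding det_def'[OF A]
proof (rule forms_sum)
  fix p assume "p \<in> {p. p permutes {0..<d}}"
  then have "p i < d" if "i < d" for i using permutes_in_image[of p "{0..<d}" i] that by auto
  then have "(\<Prod>i = 0..<d. A $$ (i, p i)) \<in> forms (sum (\<lambda>_. 1) {0..<d})" by (intro forms_prod lin) auto
  then show "signof p * (\<Prod>i = 0..<d. A $$ (i, p i)) \<in> forms d"
    by (cases "sign p = 1") (auto simp: sign_def intro: forms_uminus)
qed

end

context ferrers
begin

text \<open>The coefficients of the generators of \<open>I^r\<close> are absorbed into
  \<open>J\<close>; this yields the matrix of the determinant trick.\<close>

lemma ideal_prod_monom_rep:
  fixes J :: "'k::comm_ring_1 mpoly set"
  assumes J: "ideal_in RR J" and p: "p \<in> ideal_prod RR J (monom_ideal r)"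
  obtains c where "\<And>M. M \<in> cellmons r \<Longrightarrow> c M \<in> J" "p = (\<Sum>M\<in>cellmons r. c M * cmon M)"
proof -
  let ?K = "{\<Sum>M\<in>cellmons r. c M * cmon M | c. \<forall>M\<in>cellmons r. c M \<in> J} :: 'k mpoly set"
  have cR: "cmon ` cellmons r \<subseteq> RR" by (auto simp: cellmons_def intro: cmon_RR)
  have K: "ideal_in RR ?K"
    unfolding ideal_in_def
  proof (intro conjI ballI)
    show "?K \<subseteq> RR" using cR ideal_inD(1)[OF J]
      by (auto intro!: is_subring_sum[OF subring_RR] is_subringD(4)[OF subring_RR])
    show "0 \<in> ?K" using ideal_inD(2)[OF J] by (intro CollectI exI[of _ "\<lambda>_. 0"]) simp
    fix a b assume "a \<in> ?K" "b \<in> ?K"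
    then obtain c c' where "a = (\<Sum>M\<in>cellmons r. c M * cmon M)" "b = (\<Sum>M\<in>cellmons r. c' M * cmon M)"
      "\<forall>M\<in>cellmons r. c M \<in> J" "\<forall>M\<in>cellmons r. c' M \<in> J" by blast
    then show "a + b \<in> ?K" using ideal_inD(3)[OF J]
      by (intro CollectI exI[of _ "\<lambda>M. c M + c' M"]) (auto simp: distrib_right sum.distrib)
  next
    fix t a :: "'k mpoly" assume t: "t \<in> RR" and "a \<in> ?K"
    then obtain c where "a = (\<Sum>M\<in>cellmons r. c M * cmon M)" "\<forall>M\<in>cellmons r. c M \<in> J" by blast
    then show "t * a \<in> ?K" using ideal_inD(4)[OF J t]
      by (intro CollectI exI[of _ "\<lambda>M. t * c M"]) (auto simp: sum_distrib_left mult.assoc)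
  qed
  have "ideal_prod RR J (monom_ideal r) \<subseteq> ?K"
  proof (rule ideal_prod_least[OF K])
    fix a b :: "'k mpoly" assume a: "a \<in> J" and b: "b \<in> monom_ideal r"
    have "monom_ideal r \<subseteq> gen_ideal RR (cmon ` cellmons r :: 'k mpoly set)"
      using gen_ideal_superset[of "cmon ` cellmons r" RR]
      by (intro monom_ideal_least ideal_in_gen_ideal[OF subring_RR cR]) auto
    then obtain s where s: "\<And>M. M \<in> cellmons r \<Longrightarrow> s M \<in> RR" "b = (\<Sum>M\<in>cellmons r. s M * cmon M)"
      using gen_ideal_sum_rep[OF subring_RR finite_cellmons cR] b by blast
    then show "a * b \<in> ?K" using ideal_inD(5)[OF J _ a]
      by (intro CollectI exI[of _ "\<lambda>M. a * s M"]) (auto simp: sum_distrib_left mult.assoc)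
  qed
  with p that show ?thesis by blast
qed

lemma II_le_prime:
  assumes P: "prime_in RR P" and r: "ideal_pow RR II (Suc r) \<subseteq> (P :: 'k::field mpoly set)"
  shows "II \<subseteq> P"
  unfolding II_eq
proof (rule monom_ideal_least[OF prime_inD(1)[OF P]])
  fix M assume "M \<in> cellmons 1"
  then obtain z where z: "M = {#z#}" "z \<in> cells" using cellmons_Suc[of M 0] by (auto simp: cellmons_0)
  have pw: "cmon M ^ k = (cmon (replicate_mset k z) :: 'k mpoly)" for k
    by (induction k) (simp_all add: z cmon_add_mset cmon_single)
  have "cmon (replicate_mset (Suc r) z) \<in> (monom_ideal (Suc r) :: 'k mpoly set)"
    using z(2) by (intro cmon_monom_ideal) (auto simp: cellmons_def)
  then have "cmon M ^ Suc r \<in> P" using r unfolding ideal_pow_II pw by blast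
  then show "cmon M \<in> P" 
    by (rule prime_in_power[OF subring_RR P, rotated]) (use z in \<open>simp add: cmon_RR\<close>)
qed

text \<open>If \<open>J\<close> were a proper reduction inside the ideal of the diagonals, then so would be a maximal
  proper subideal \<open>L\<close>; let \<open>P\<close> be its colon ideal. An element \<open>g\<close> outside \<open>L\<close> is integral over \<open>L\<close>
  by the determinant trick; lifted to forms in the local generators, the determinant contradicts
  analytic independence when it is evaluated at the coordinates \<open>\<tau>\<close> of the functional with kernel \<open>L\<close>.\<close>

lemma diag_reduction_minimal:
  fixes J :: "'k::field mpoly set"
  assumes red: "is_reduction RR J II" and sub: "J \<subseteq> diag_reduction n lam"
  shows "J = diag_reduction n lam"
proof (rule ccontr)
  let ?D = "diag_reduction n lam :: 'k mpoly set"
  assume ne: "J \<noteq> ?D"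
  have J: "ideal_in RR J" and "\<exists>r. ideal_pow RR II (Suc r) = ideal_prod RR J (ideal_pow RR II r)"
    using red by (auto simp: is_reduction_def)
  then obtain r where r: "ideal_pow RR II (Suc r) = ideal_prod RR J (ideal_pow RR II r)" by blast
  have "finite (diag ` colours :: 'k mpoly set)" using finite_colours by simp
  moreover have "diag ` colours \<subseteq> (RR :: 'k mpoly set)" using diag_II ideal_inD(1)[OF ideal_in_II] by blast
  ultimately obtain L where L: "ideal_in RR L" "J \<subseteq> L" "L \<subseteq> ?D" "L \<noteq> ?D"
    and max: "\<And>K. ideal_in RR K \<Longrightarrow> L \<subseteq> K \<Longrightarrow> K \<subseteq> ?D \<Longrightarrow> K = L \<or> K = ?D"
    using maximal_proper_subideal[OF subring_RR _ _ diag_reduction_eq J sub ne] by blast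
  obtain g where g: "g \<in> ?D" "g \<notin> L" using L(3,4) by blast
  define P where "P = {a \<in> RR. \<forall>x\<in>?D. a * x \<in> L}"
  have colon: "prime_in RR P" "\<And>x. x \<in> ?D \<Longrightarrow> \<exists>a\<in>RR. x - a * g \<in> L" "\<And>u. u \<in> RR \<Longrightarrow> u * g \<in> L \<Longrightarrow> u \<in> P"
    unfolding P_def
    by (rule colon_prime[OF subring_RR ideal_in_diag L(1,3,4) _ g]; (rule max)?; assumption)+
  have DR: "?D \<subseteq> RR" by (rule ideal_inD(1)[OF ideal_in_diag])
  have LP: "a * g \<in> L" if "a \<in> P" for a using that g(1) by (auto simp: P_def)
  \<comment> \<open>\<open>I^(r+1) = J I^r\<close> lies in \<open>J\<close>, hence in
    \<open>L\<close>, and \<open>L\<close> multiplies every element of the ring into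
    \<open>L\<close>.\<close>
  have "ideal_pow RR II (Suc r) \<subseteq> P"
  proof -
    have "ideal_pow RR II (Suc r) \<subseteq> J"
      unfolding r
      by (rule ideal_prod_least[OF J]) (auto intro: ideal_inD(5)[OF J] simp: ideal_pow_II monom_ideal_def)
    moreover have "L \<subseteq> P" using DR L(1,3) by (auto simp: P_def intro: ideal_inD(5)[OF L(1)])
    ultimately show ?thesis using L(2) by blast
  qed
  then have "II \<subseteq> P" by (rule II_le_prime[OF colon(1)])
  interpret ferrers_prime n lam P
    by unfold_locales (fact colon(1), fact)
  have "\<exists>u\<in>RR. u \<notin> P \<and> u * local_gen v \<in> ?D" if "v \<in> gens" for v
    using local_gen_LL[OF that] by (simp add: saturation_def)
  then obtain u where u: "\<And>v. v \<in> gens \<Longrightarrow> u v \<in> RR \<and> u v \<notin> P \<and> u v * local_gen v \<in> ?D" by metis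
  then have "\<exists>a\<in>RR. u v * local_gen v - a * g \<in> L" if "v \<in> gens" for v using colon(2) that by blast
  then obtain a where a: "\<And>v. v \<in> gens \<Longrightarrow> a v \<in> RR \<and> u v * local_gen v - a v * g \<in> L" by metis
  define U where "U = prod u gens"
  have U: "U \<in> RR" "U \<notin> P"
    unfolding U_def
    by (rule is_subring_prod[OF subring_RR], use u in blast)
      (rule prime_in_prod[OF subring_RR P finite_gens]; use u in blast)
  \<comment> \<open>Clearing the denominators \<open>u v\<close> by their product \<open>U\<close>
    makes \<open>\<tau> v\<close> the coordinate of \<open>U * local_gen v\<close> along
    \<open>g\<close> modulo \<open>L\<close>.\<close>
  define \<tau> where "\<tau> v = prod u (gens - {v}) * a v" for v
  have pu: "prod u (gens - {v}) \<in> RR" for v using u by (intro is_subring_prod[OF subring_RR]) auto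
  have \<tau>R: "\<tau> v \<in> RR" if "v \<in> gens" for v
    unfolding \<tau>_def using pu a that by (intro is_subringD(4)[OF subring_RR]) auto
  have \<tau>: "U * local_gen v - \<tau> v * g \<in> L" if v: "v \<in> gens" for v
  proof -
    have "prod u (gens - {v}) * (u v * local_gen v - a v * g) \<in> L"
      using a[OF v] pu by (intro ideal_inD(4)[OF L(1)]) auto
    also have "prod u (gens - {v}) * (u v * local_gen v - a v * g) = U * local_gen v - \<tau> v * g"
      using v finite_gens by (simp add: U_def \<tau>_def prod.remove algebra_simps)
    finally show ?thesis .
  qed
  have eval: "U * (\<Sum>v\<in>gens. h v * local_gen v) - (\<Sum>v\<in>gens. h v * \<tau> v) * g \<in> L"
    if "\<forall>v\<in>gens. h v \<in> RR" for h
  proof -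
    have "(\<Sum>v\<in>gens. h v * (U * local_gen v - \<tau> v * g)) \<in> L"
      using that \<tau> by (intro ideal_in_sum[OF L(1)] ideal_inD(4)[OF L(1)]) auto
    then show ?thesis
      by (simp add: right_diff_distrib sum_subtractf sum_distrib_left sum_distrib_right mult.assoc mult.left_commute[of U])
  qed
  have sumR: "(\<Sum>v\<in>gens. h v * \<tau> v) \<in> RR" if "\<forall>v\<in>gens. h v \<in> RR" for h
    using that \<tau>R by (intro is_subring_sum[OF subring_RR] is_subringD(4)[OF subring_RR]) auto
  \<comment> \<open>For an element of \<open>L\<close> the value at \<open>\<tau>\<close> multiplies
    \<open>g\<close> into \<open>L\<close>, so it lies in the colon ideal \<open>P\<close>.\<close>
  have evalP: "(\<Sum>v\<in>gens. h v * \<tau> v) \<in> P"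
    if h: "\<forall>v\<in>gens. h v \<in> RR" and hL: "(\<Sum>v\<in>gens. h v * local_gen v) \<in> L" for h
  proof (rule colon(3)[OF sumR[OF h]])
    have "U * (\<Sum>v\<in>gens. h v * local_gen v) - (U * (\<Sum>v\<in>gens. h v * local_gen v) - (\<Sum>v\<in>gens. h v * \<tau> v) * g) \<in> L"
      by (rule ideal_in_diff[OF subring_RR L(1) ideal_inD(4)[OF L(1) U(1) hL] eval[OF h]])
    then show "(\<Sum>v\<in>gens. h v * \<tau> v) * g \<in> L" by simp
  qed
  have rep: "\<exists>h. (\<forall>v\<in>gens. h v \<in> RR) \<and> x = (\<Sum>v\<in>gens. h v * local_gen v)" if x: "x \<in> ?D" for x
  proof -
    have "x \<in> gen_ideal RR (local_gen ` gens)" using DD_local_gens x by blast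
    moreover have "local_gen ` gens \<subseteq> RR" using local_gen_RR by blast
    ultimately obtain h where "\<And>v. v \<in> gens \<Longrightarrow> h v \<in> RR" "x = (\<Sum>v\<in>gens. h v * local_gen v)"
      by (rule_tac gen_ideal_sum_rep[OF subring_RR finite_gens]) auto
    then show ?thesis by blast
  qed
  obtain gc where gc: "\<forall>v\<in>gens. gc v \<in> RR" "g = (\<Sum>v\<in>gens. gc v * local_gen v)" using rep[OF g(1)] by blast
  have gP: "(\<Sum>v\<in>gens. gc v * \<tau> v) \<notin> P"
  proof
    assume "(\<Sum>v\<in>gens. gc v * \<tau> v) \<in> P"
    then have "(\<Sum>v\<in>gens. gc v * \<tau> v) * g \<in> L" by (rule LP)
    moreover have "U * g - (\<Sum>v\<in>gens. gc v * \<tau> v) * g \<in> L" using eval[OF gc(1)] gc(2) by simp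
    ultimately have "(U * g - (\<Sum>v\<in>gens. gc v * \<tau> v) * g) + (\<Sum>v\<in>gens. gc v * \<tau> v) * g \<in> L"
      by (rule_tac ideal_inD(3)[OF L(1)])
    then have "U \<in> P" using colon(3)[OF U(1)] by simp
    with U(2) show False ..
  qed
  have "\<exists>c. (\<forall>N\<in>cellmons r. c N \<in> L) \<and> g * cmon M = (\<Sum>N\<in>cellmons r. c N * cmon N)" if M: "M \<in> cellmons r" for M
  proof -
    have "g \<in> monom_ideal 1" using g(1) diag_reduction_II by (auto simp: II_eq)
    then have "g * cmon M \<in> monom_ideal (Suc r)" using monom_ideal_mult[OF _ cmon_monom_ideal[OF M], of g 1] by simp
    then have "g * cmon M \<in> ideal_prod RR J (monom_ideal r)" using r unfolding ideal_pow_II by simp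
    then show ?thesis using L(2) by (rule_tac ideal_prod_monom_rep[OF J, of "g * cmon M" r]) blast+
  qed
  then obtain c where c: "\<And>M N. M \<in> cellmons r \<Longrightarrow> N \<in> cellmons r \<Longrightarrow> c M N \<in> L"
    "\<And>M. M \<in> cellmons r \<Longrightarrow> g * cmon M = (\<Sum>N\<in>cellmons r. c M N * cmon N)" by metis
  have "\<exists>h. (\<forall>v\<in>gens. h v \<in> RR) \<and> c M N = (\<Sum>v\<in>gens. h v * local_gen v)"
    if "M \<in> cellmons r" "N \<in> cellmons r" for M N using rep c(1)[OF that] L(3) by blast
  then obtain h where h: "\<And>M N v. M \<in> cellmons r \<Longrightarrow> N \<in> cellmons r \<Longrightarrow> v \<in> gens \<Longrightarrow> h M N v \<in> RR"
    "\<And>M N. M \<in> cellmons r \<Longrightarrow> N \<in> cellmons r \<Longrightarrow> c M N = (\<Sum>v\<in>gens. h M N v * local_gen v)" by metis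
  define d where "d = card (cellmons r)"
  obtain e where e: "bij_betw e {0..<d} (cellmons r)"
    using ex_bij_betw_nat_finite[OF finite_cellmons[of r]] unfolding d_def by blast
  have em: "e i \<in> cellmons r" if "i < d" for i using e that by (auto simp: bij_betw_def)
  have e_inj: "e i = e j \<longleftrightarrow> i = j" if "i < d" "j < d" for i j
    using e that by (auto simp: bij_betw_def inj_on_def)
  \<comment> \<open>The matrix of the determinant trick, lifted to forms: \<open>g\<close> on the
    diagonal, minus the coefficients in \<open>L\<close> of the products
    \<open>g * cmon M\<close>.\<close>
  define A where "A = mat d d (\<lambda>(i, j). (if i = j then linear_form gc else 0) - linear_form (h (e i) (e j)))"
  have A: "A \<in> carrier_mat d d" by (simp add: A_def)
  have "det A \<in> forms d"
  proof (rule forms_det[OF A])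
    fix i j assume "i < d" "j < d"
    then show "A $$ (i, j) \<in> forms 1"
      using forms_add[OF _ forms_uminus, of _ 1] forms_linear_form gc(1) h(1) em forms_zero
      by (auto simp: A_def)
  qed
  moreover have "subst (case_sum pvar local_gen) (det A) = 0"
  proof -
    let ?s = "case_sum pvar local_gen :: var + var \<Rightarrow> 'k mpoly"
    interpret s: comm_ring_hom "subst ?s" by (rule comm_ring_hom_subst)
    \<comment> \<open>At the local generators the vector of the monomials \<open>cmon (e j)\<close>
      lies in the kernel.\<close>
    have "det (map_mat (subst ?s) A) = 0"
    proof (rule det_eq_0_of_kernel[where e = "\<lambda>j. expo (e j)"])
      show "map_mat (subst ?s) A \<in> carrier_mat d d" using A by simp
      have "replicate_mset r (1, 1) \<in> cellmons r"
        using n_pos lam_pos[of 1] by (auto simp: cellmons_def cells_def)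
      then show "0 < d" using finite_cellmons[of r] by (auto simp: d_def card_gt_0_iff)
      fix i assume i: "i < d"
      have "(\<Sum>j = 0..<d. map_mat (subst ?s) A $$ (i, j) * cmon (e j))
          = (\<Sum>j = 0..<d. (if i = j then g * cmon (e i) else 0) - c (e i) (e j) * cmon (e j))"
        using i A em gc(2) h(2)
        by (intro sum.cong) (auto simp: A_def subst_diff subst_linear_form left_diff_distrib)
      also have "\<dots> = g * cmon (e i) - (\<Sum>j = 0..<d. c (e i) (e j) * cmon (e j))"
        using i by (simp add: sum_subtractf)
      also have "(\<Sum>j = 0..<d. c (e i) (e j) * cmon (e j)) = (\<Sum>N\<in>cellmons r. c (e i) N * cmon N)"
        by (rule sum.reindex_bij_betw[OF e])
      finally show "(\<Sum>j = 0..<d. map_mat (subst ?s) A $$ (i, j) * single (expo (e j)) 1) = 0"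
        using c(2)[OF em[OF i]] by (simp add: cmon_def)
    qed
    then show ?thesis by simp
  qed
  ultimately have "subst (case_sum pvar \<tau>) (det A) \<in> P"
    using analytic_independence[of "det A" d \<tau>] \<tau>R by (simp add: forms_def)
  moreover have "subst (case_sum pvar \<tau>) (det A) \<notin> P"
  proof -
    let ?s = "case_sum pvar \<tau> :: var + var \<Rightarrow> 'k mpoly"
    interpret s: comm_ring_hom "subst ?s" by (rule comm_ring_hom_subst)
    have ent: "map_mat (subst ?s) A $$ (i, j) = (if i = j then (\<Sum>v\<in>gens. gc v * \<tau> v) else 0) - (\<Sum>v\<in>gens. h (e i) (e j) v * \<tau> v)"
      if "i < d" "j < d" for i j
      using that by (simp add: A_def subst_diff subst_linear_form)
    have hP: "(\<Sum>v\<in>gens. h (e i) (e j) v * \<tau> v) \<in> P" if "i < d" "j < d" for i j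
      using that em h c(1) by (intro evalP) (auto simp: h(2)[symmetric])
    \<comment> \<open>At \<open>\<tau>\<close> the lifts of elements of \<open>L\<close> fall into
      \<open>P\<close> and the lift of \<open>g\<close> does not, so modulo \<open>P\<close> the
      matrix is diagonal with nonzero diagonal entries.\<close>
    have "det (map_mat (subst ?s) A) \<notin> P"
    proof (rule det_notin_prime[OF subring_RR P])
      show "map_mat (subst ?s) A \<in> carrier_mat d d" using A by simp
      fix i j assume ij: "i < d" "j < d"
      show "map_mat (subst ?s) A $$ (i, j) \<in> RR"
        unfolding ent[OF ij] using sumR[OF gc(1)] hP[OF ij] is_subringD(1)[OF subring_RR] ideal_inD(1)[OF PI]
        by (intro is_subringD(6)[OF subring_RR]) auto
      show "map_mat (subst ?s) A $$ (i, j) \<in> P" if "i \<noteq> j"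
        unfolding ent[OF ij] using that hP[OF ij] ideal_in_uminus[OF subring_RR PI] by simp
    next
      fix i assume i: "i < d"
      show "map_mat (subst ?s) A $$ (i, i) \<notin> P"
      proof
        assume "map_mat (subst ?s) A $$ (i, i) \<in> P"
        then have "(\<Sum>v\<in>gens. gc v * \<tau> v) - (\<Sum>v\<in>gens. h (e i) (e i) v * \<tau> v) + (\<Sum>v\<in>gens. h (e i) (e i) v * \<tau> v) \<in> P"
          using hP[OF i i] unfolding ent[OF i i] by (intro ideal_inD(3)[OF PI]) auto
        with gP show False by simp
      qed
    qed
    then show ?thesis by simp
  qed
  ultimately show False by blast
qed

lemma minimal_reduction_diag: "minimal_reduction RR (diag_reduction n lam) (II :: 'k::field mpoly set)"
  unfolding minimal_reduction_def using is_reduction_diag diag_reduction_minimal by blast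

end

theorem theorem6p7:
  fixes n :: nat and lam :: "nat \<Rightarrow> nat"
  assumes K_inf: "infinite (UNIV :: 'k::field set)"
    and n_pos: "1 \<le> n"
    and lam_pos: "\<forall>i. 1 \<le> i \<and> i \<le> n \<longrightarrow> 0 < lam i"
    and lam_noninc: "\<forall>i j. 1 \<le> i \<and> i \<le> j \<and> j \<le> n \<longrightarrow> lam j \<le> lam i"
  shows "reduction_number (ferrers_ring n lam :: 'k mpoly set) (ferrers_ideal n lam)
           = Min (insert (n - 1) {lam i + i - 3 | i. 2 \<le> i \<and> i \<le> n})
       \<and> minimal_reduction (ferrers_ring n lam :: 'k mpoly set) (diag_reduction n lam) (ferrers_ideal n lam)
       \<and> red_num_wrt (ferrers_ring n lam :: 'k mpoly set) (diag_reduction n lam) (ferrers_ideal n lam)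
           = Min (insert (n - 1) {lam i + i - 3 | i. 2 \<le> i \<and> i \<le> n})"
proof -
  interpret ferrers n lam
    using n_pos lam_pos lam_noninc by unfold_locales auto
  let ?R = "ferrers_ring n lam :: 'k mpoly set"
  have min: "minimal_reduction ?R (diag_reduction n lam) (ferrers_ideal n lam)"
    by (rule minimal_reduction_diag)
  have red: "red_num_wrt ?R (diag_reduction n lam) (ferrers_ideal n lam) = red_bound"
    using red_num_diag_le minimal_reduction_lower_bound[OF K_inf min] by (rule antisym)
  have "reduction_number ?R (ferrers_ideal n lam) = red_bound"
    unfolding reduction_number_def
  proof (rule Least_equality)
    show "\<exists>J. minimal_reduction ?R J (ferrers_ideal n lam) \<and> red_num_wrt ?R J (ferrers_ideal n lam) = red_bound"
      using min red by blast
    show "red_bound \<le> k" if "\<exists>J. minimal_reduction ?R J (ferrers_ideal n lam) \<and> red_num_wrt ?R J (ferrers_ideal n lam) = k" for k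
      using that minimal_reduction_lower_bound[OF K_inf] by blast
  qed
  with min red show ?thesis by blast
qed

end
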